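(* Let $F$ be a fixed set of integrity constraints that contains at most one functional dependency per relation name and no other constraints, and let $Q$ be a fixed closed quantifier-free query. Then computing preferred consistent answers to $Q$ is in PTIME for each of the families $\mathcal{P}\mathit{Rep}$, $\mathcal{G}\mathit{Rep}$, and $\mathcal{C}\mathit{Rep}$; that is, for each $\mathcal X\in\{\mathcal P,\mathcal G,\mathcal C\}$ the decision problem $$\mathcal D_{F,Q}^{\mathcal X}=\{(I,\succ) : \forall I'\in\mathcal{X}\mathit{Rep}(I,F,\succ).\ I'\models Q\}$$ is in PTIME.
   Context: A database schema is a set of relation names of fixed positive arity; each attribute ranges over one of two disjoint infinite domains: the rationals $\mathbb{Q}$ (with built-in predicates $=,\neq,<,\le,>,\ge$) or a set $D$ of uninterpreted constants (with built-in predicates $=,\neq$). A fact is an expression $R(t)$ with $R$ a relation name and $t$ a tuple of constants of the right arity and types. A database instance is a finite set of facts. A closed quantifier-free query is a Boolean combination of facts and ground built-in atoms; $I\models R(t)$ iff $R(t)\in I$. A functional dependency $R:X\to Y$ ($X,Y$ sets of attributes of $R$) is satisfied by an instance if any two of its $R$-facts that agree on all attributes in $X$ agree on all attributes in $Y$. A conflict in $I$ w.r.t. $F$ is a pair of facts of $I$ that together violate some dependency in $F$; an instance is consistent with $F$ iff it satisfies all dependencies in $F$. A repair of $I$ w.r.t. $F$ is a maximal (under inclusion) subset of $I$ consistent with $F$. Two facts of $I$ are neighbors if they form a conflict. A priority of $I$ w.r.t. $F$ is an acyclic binary relation $\succ$ on $I$ such that $x\succ y$ implies that $x$ and $y$ are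 neighbors. A priority is total if no different priority of $I$ w.r.t. $F$ contains it. A set $I'\subseteq I$ is globally optimal (resp. Pareto optimal) w.r.t. $\succ$ and $F$ if there are no nonempty $X\subseteq I'$ and nonempty $Y\subseteq I\setminus I'$ such that $(I'\setminus X)\cup Y$ is consistent with $F$ and $\forall x\in X.\ \exists y\in Y.\ y\succ x$ (resp. $\forall x\in X.\ \forall y\in Y.\ y\succ x$). $I'$ is completion optimal w.r.t. $\succ$ and $F$ if it is globally optimal w.r.t. some total priority $\succ'\supseteq\succ$ and $F$. $\mathcal{G}\mathit{Rep}(I,F,\succ)$, $\mathcal{P}\mathit{Rep}(I,F,\succ)$, $\mathcal{C}\mathit{Rep}(I,F,\succ)$ are the sets of all repairs of $I$ w.r.t. $F$ that are, respectively, globally, Pareto, completion optimal w.r.t. $\succ$ and $F$. Complexity is data complexity: $F$ and $Q$ are fixed, and the input is an instance $I$ and a priority $\succ$ of $I$ w.r.t. $F$. *)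

theory Defs
  imports "HOL.Rat" "HOL-Computational_Algebra.Polynomial"
begin

section \<open>Polynomial time: deterministic multi-tape Turing machines\<close>

text \<open>Languages are over an arbitrary finite alphabet \<open>'a\<close>. A machine may use finitely many
  additional tape symbols \<open>Work 0, Work 1, \<dots>\<close>, and its states are the numbers below
  \<open>tm_states\<close>. Hence, on a well-formed machine, the relevant part of the transition function
  is a finite table.\<close>

datatype 'a cell = Blank | Input 'a | Work nat

datatype move = MLeft | MStay | MRight

record 'a tm =
  tm_tapes :: nat
  tm_states :: nat
  tm_work :: nat
  tm_start :: nat
  tm_accept :: nat
  tm_reject :: nat
  tm_delta :: "nat \<Rightarrow> 'a cell list \<Rightarrow> nat \<times> ('a cell \<times> move) list"

definition tm_alphabet :: "'a tm \<Rightarrow> 'a cell set" where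
  "tm_alphabet M = {Blank} \<union> range Input \<union> Work ` {..<tm_work M}"

definition tm_halting :: "'a tm \<Rightarrow> nat \<Rightarrow> bool" where
  "tm_halting M q \<longleftrightarrow> q = tm_accept M \<or> q = tm_reject M"

definition wf_tm :: "'a tm \<Rightarrow> bool" where
  "wf_tm M \<longleftrightarrow>
     0 < tm_tapes M \<and> tm_start M < tm_states M \<and> tm_accept M < tm_states M \<and>
     tm_reject M < tm_states M \<and> tm_accept M \<noteq> tm_reject M \<and>
     (\<forall>q as q' acts. q < tm_states M \<and> \<not> tm_halting M q \<and> length as = tm_tapes M \<and>
        set as \<subseteq> tm_alphabet M \<and> tm_delta M q as = (q', acts) \<longrightarrow>
        q' < tm_states M \<and> length acts = tm_tapes M \<and> fst ` set acts \<subseteq> tm_alphabet M)"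

text \<open>A tape is a two-way infinite sequence of cells together with the head position.\<close>

type_synonym 'a tape = "(int \<Rightarrow> 'a cell) \<times> int"
type_synonym 'a config = "nat \<times> 'a tape list"

fun tape_read :: "'a tape \<Rightarrow> 'a cell" where
  "tape_read (t, h) = t h"

fun offset :: "move \<Rightarrow> int" where
  "offset MLeft = -1"
| "offset MStay = 0"
| "offset MRight = 1"

fun tape_act :: "'a cell \<times> move \<Rightarrow> 'a tape \<Rightarrow> 'a tape" where
  "tape_act (a, m) (t, h) = (t(h := a), h + offset m)"

fun tm_step :: "'a tm \<Rightarrow> 'a config \<Rightarrow> 'a config" where
  "tm_step M (q, ts) =
     (if tm_halting M q then (q, ts)
      else (case tm_delta M q (map tape_read ts) of
              (q', acts) \<Rightarrow> (q', map2 tape_act acts ts)))"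

definition blank_tape :: "'a tape" where
  "blank_tape = (\<lambda>_. Blank, 0)"

definition input_tape :: "'a list \<Rightarrow> 'a tape" where
  "input_tape w = (\<lambda>i. if 0 \<le> i \<and> i < int (length w) then Input (w ! nat i) else Blank, 0)"

definition tm_init :: "'a tm \<Rightarrow> 'a list \<Rightarrow> 'a config" where
  "tm_init M w = (tm_start M, input_tape w # replicate (tm_tapes M - 1) blank_tape)"

definition tm_decides_in_time :: "'a tm \<Rightarrow> 'a list set \<Rightarrow> (nat \<Rightarrow> nat) \<Rightarrow> bool" where
  "tm_decides_in_time M L T \<longleftrightarrow>
     (\<forall>w. \<exists>t \<le> T (length w).
        fst ((tm_step M ^^ t) (tm_init M w)) = (if w \<in> L then tm_accept M else tm_reject M))"

definition PTIME :: "'a::finite list set set" where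
  "PTIME = {L. \<exists>M p. wf_tm M \<and> tm_decides_in_time M L (poly (p :: nat poly))}"


section \<open>Databases\<close>

datatype sort = NumSort | NameSort

datatype 'd const = Num rat | Name 'd

fun has_sort :: "'d const \<Rightarrow> sort \<Rightarrow> bool" where
  "has_sort (Num _) s \<longleftrightarrow> s = NumSort"
| "has_sort (Name _) s \<longleftrightarrow> s = NameSort"

text \<open>The list assigned to a relation name consists of the sorts of its attributes; attributes
  are identified with their positions \<open>0, 1, \<dots>\<close>.\<close>

type_synonym 'r schema = "'r \<rightharpoonup> sort list"

definition wf_schema :: "'r schema \<Rightarrow> bool" where
  "wf_schema S \<longleftrightarrow> finite (dom S) \<and> [] \<notin> ran S"

datatype ('r, 'd) fact = Fact (rel: 'r) (args: "'d const list")

definition wf_fact :: "'r schema \<Rightarrow> ('r, 'd) fact \<Rightarrow> bool" where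
  "wf_fact S f \<longleftrightarrow> (\<exists>ss. S (rel f) = Some ss \<and> list_all2 has_sort (args f) ss)"

definition db_instance :: "'r schema \<Rightarrow> ('r, 'd) fact set \<Rightarrow> bool" where
  "db_instance S I \<longleftrightarrow> finite I \<and> (\<forall>f\<in>I. wf_fact S f)"

datatype rat_pred = RatEq | RatNeq | RatLess | RatLeq | RatGreater | RatGeq
datatype name_pred = NameEq | NameNeq

fun rat_holds :: "rat_pred \<Rightarrow> rat \<Rightarrow> rat \<Rightarrow> bool" where
  "rat_holds RatEq a b \<longleftrightarrow> a = b"
| "rat_holds RatNeq a b \<longleftrightarrow> a \<noteq> b"
| "rat_holds RatLess a b \<longleftrightarrow> a < b"
| "rat_holds RatLeq a b \<longleftrightarrow> a \<le> b"
| "rat_holds RatGreater a b \<longleftrightarrow> a > b"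
| "rat_holds RatGeq a b \<longleftrightarrow> a \<ge> b"

fun name_holds :: "name_pred \<Rightarrow> 'd \<Rightarrow> 'd \<Rightarrow> bool" where
  "name_holds NameEq a b \<longleftrightarrow> a = b"
| "name_holds NameNeq a b \<longleftrightarrow> a \<noteq> b"

datatype ('r, 'd) query =
  QFact "('r, 'd) fact"
| QRat rat_pred rat rat
| QName name_pred 'd 'd
| QNot "('r, 'd) query"
| QAnd "('r, 'd) query" "('r, 'd) query"
| QOr "('r, 'd) query" "('r, 'd) query"

fun wf_query :: "'r schema \<Rightarrow> ('r, 'd) query \<Rightarrow> bool" where
  "wf_query S (QFact f) \<longleftrightarrow> wf_fact S f"
| "wf_query S (QRat _ _ _) \<longleftrightarrow> True"
| "wf_query S (QName _ _ _) \<longleftrightarrow> True"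
| "wf_query S (QNot q) \<longleftrightarrow> wf_query S q"
| "wf_query S (QAnd q r) \<longleftrightarrow> wf_query S q \<and> wf_query S r"
| "wf_query S (QOr q r) \<longleftrightarrow> wf_query S q \<and> wf_query S r"

fun satisfies :: "('r, 'd) fact set \<Rightarrow> ('r, 'd) query \<Rightarrow> bool" (infix "\<Turnstile>" 50) where
  "I \<Turnstile> QFact f \<longleftrightarrow> f \<in> I"
| "I \<Turnstile> QRat p a b \<longleftrightarrow> rat_holds p a b"
| "I \<Turnstile> QName p a b \<longleftrightarrow> name_holds p a b"
| "I \<Turnstile> QNot q \<longleftrightarrow> \<not> I \<Turnstile> q"
| "I \<Turnstile> QAnd q r \<longleftrightarrow> I \<Turnstile> q \<and> I \<Turnstile> r"
| "I \<Turnstile> QOr q r \<longleftrightarrow> I \<Turnstile> q \<or> I \<Turnstile> r"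


section \<open>Functional dependencies, conflicts and repairs\<close>

datatype 'r fd = FD (fd_rel: 'r) (fd_lhs: "nat set") (fd_rhs: "nat set")

definition wf_fd :: "'r schema \<Rightarrow> 'r fd \<Rightarrow> bool" where
  "wf_fd S d \<longleftrightarrow> (\<exists>ss. S (fd_rel d) = Some ss \<and>
     fd_lhs d \<subseteq> {..<length ss} \<and> fd_rhs d \<subseteq> {..<length ss})"

definition agree_on :: "nat set \<Rightarrow> ('r, 'd) fact \<Rightarrow> ('r, 'd) fact \<Rightarrow> bool" where
  "agree_on X f g \<longleftrightarrow> (\<forall>i\<in>X. args f ! i = args g ! i)"

definition fd_holds :: "('r, 'd) fact set \<Rightarrow> 'r fd \<Rightarrow> bool" where
  "fd_holds I d \<longleftrightarrow> (\<forall>f\<in>I. \<forall>g\<in>I. rel f = fd_rel d \<and> rel g = fd_rel d \<and>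
     agree_on (fd_lhs d) f g \<longrightarrow> agree_on (fd_rhs d) f g)"

definition consistent :: "'r fd set \<Rightarrow> ('r, 'd) fact set \<Rightarrow> bool" where
  "consistent F I \<longleftrightarrow> (\<forall>d\<in>F. fd_holds I d)"

definition neighbors ::
  "('r, 'd) fact set \<Rightarrow> 'r fd set \<Rightarrow> ('r, 'd) fact \<Rightarrow> ('r, 'd) fact \<Rightarrow> bool" where
  "neighbors I F f g \<longleftrightarrow> f \<in> I \<and> g \<in> I \<and> (\<exists>d\<in>F. \<not> fd_holds {f, g} d)"

definition repair :: "('r, 'd) fact set \<Rightarrow> 'r fd set \<Rightarrow> ('r, 'd) fact set \<Rightarrow> bool" where
  "repair I F I' \<longleftrightarrow> I' \<subseteq> I \<and> consistent F I' \<and>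
     (\<forall>J. I' \<subseteq> J \<and> J \<subseteq> I \<and> consistent F J \<longrightarrow> J = I')"


section \<open>Priorities and preferred repairs\<close>

text \<open>A pair \<open>(x, y)\<close> in a priority \<open>P\<close> means that \<open>x\<close> is preferred to \<open>y\<close>.\<close>

type_synonym ('r, 'd) prio = "(('r, 'd) fact \<times> ('r, 'd) fact) set"

definition priority :: "('r, 'd) fact set \<Rightarrow> 'r fd set \<Rightarrow> ('r, 'd) prio \<Rightarrow> bool" where
  "priority I F P \<longleftrightarrow> P \<subseteq> I \<times> I \<and> acyclic P \<and> (\<forall>(x, y)\<in>P. neighbors I F x y)"

definition total_priority :: "('r, 'd) fact set \<Rightarrow> 'r fd set \<Rightarrow> ('r, 'd) prio \<Rightarrow> bool" where
  "total_priority I F P \<longleftrightarrow> priority I F P \<and> (\<forall>P'. priority I F P' \<and> P \<subseteq> P' \<longrightarrow> P' = P)"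

definition globally_optimal ::
  "('r, 'd) fact set \<Rightarrow> 'r fd set \<Rightarrow> ('r, 'd) prio \<Rightarrow> ('r, 'd) fact set \<Rightarrow> bool" where
  "globally_optimal I F P I' \<longleftrightarrow> I' \<subseteq> I \<and>
     \<not> (\<exists>X Y. X \<noteq> {} \<and> X \<subseteq> I' \<and> Y \<noteq> {} \<and> Y \<subseteq> I - I' \<and> consistent F ((I' - X) \<union> Y) \<and>
         (\<forall>x\<in>X. \<exists>y\<in>Y. (y, x) \<in> P))"

definition pareto_optimal ::
  "('r, 'd) fact set \<Rightarrow> 'r fd set \<Rightarrow> ('r, 'd) prio \<Rightarrow> ('r, 'd) fact set \<Rightarrow> bool" where
  "pareto_optimal I F P I' \<longleftrightarrow> I' \<subseteq> I \<and>
     \<not> (\<exists>X Y. X \<noteq> {} \<and> X \<subseteq> I' \<and> Y \<noteq> {} \<and> Y \<subseteq> I - I' \<and> consistent F ((I' - X) \<union> Y) \<and>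
         (\<forall>x\<in>X. \<forall>y\<in>Y. (y, x) \<in> P))"

definition completion_optimal ::
  "('r, 'd) fact set \<Rightarrow> 'r fd set \<Rightarrow> ('r, 'd) prio \<Rightarrow> ('r, 'd) fact set \<Rightarrow> bool" where
  "completion_optimal I F P I' \<longleftrightarrow>
     (\<exists>P'. total_priority I F P' \<and> P \<subseteq> P' \<and> globally_optimal I F P' I')"

type_synonym ('r, 'd) repair_family =
  "('r, 'd) fact set \<Rightarrow> 'r fd set \<Rightarrow> ('r, 'd) prio \<Rightarrow> ('r, 'd) fact set set"

definition GRep :: "('r, 'd) repair_family" where
  "GRep I F P = {I'. repair I F I' \<and> globally_optimal I F P I'}"

definition PRep :: "('r, 'd) repair_family" where
  "PRep I F P = {I'. repair I F I' \<and> pareto_optimal I F P I'}"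

definition CRep :: "('r, 'd) repair_family" where
  "CRep I F P = {I'. repair I F I' \<and> completion_optimal I F P I'}"

definition preferred_consistent_answers ::
  "'r schema \<Rightarrow> 'r fd set \<Rightarrow> ('r, 'd) query \<Rightarrow> ('r, 'd) repair_family \<Rightarrow>
   (('r, 'd) fact set \<times> ('r, 'd) prio) set" where
  "preferred_consistent_answers S F Q XRep =
     {(I, P). db_instance S I \<and> priority I F P \<and> (\<forall>I'\<in>XRep I F P. I' \<Turnstile> Q)}"


section \<open>Encoding of inputs as words\<close>

text \<open>Relation names and uninterpreted constants are written as bit strings given by \<open>rn\<close> and
  \<open>cn\<close>. Rationals are written as fractions of binary numbers (least significant bit first), not
  necessarily in lowest terms and possibly with superfluous zeros. Sets are written as lists of
  their elements, in any order and possibly with repetitions. So an input has several encodings,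
  but a word encodes at most one input (if \<open>rn\<close> and \<open>cn\<close> are injective).\<close>

datatype sym = Bit bool | Minus | Slash | NumTag | NameTag | FactTag | PairTag

instance sym :: finite
proof
  have "x \<in> range Bit \<union> {Minus, Slash, NumTag, NameTag, FactTag, PairTag}" for x :: sym
    by (cases x) simp_all
  then have "(UNIV :: sym set) \<subseteq> range Bit \<union> {Minus, Slash, NumTag, NameTag, FactTag, PairTag}"
    by blast
  then show "finite (UNIV :: sym set)"
    by (rule finite_subset) simp
qed

definition bits_val :: "bool list \<Rightarrow> nat" where
  "bits_val bs = horner_sum of_bool 2 bs"

definition encodes_rat :: "sym list \<Rightarrow> rat \<Rightarrow> bool" where
  "encodes_rat w q \<longleftrightarrow> (\<exists>neg n d. bits_val d \<noteq> 0 \<and>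
     w = (if neg then [Minus] else []) @ map Bit n @ [Slash] @ map Bit d \<and>
     q = (if neg then -1 else 1) * (of_nat (bits_val n) / of_nat (bits_val d)))"

fun encodes_const :: "('d \<Rightarrow> bool list) \<Rightarrow> sym list \<Rightarrow> 'd const \<Rightarrow> bool" where
  "encodes_const cn w (Num q) \<longleftrightarrow> (\<exists>u. w = NumTag # u \<and> encodes_rat u q)"
| "encodes_const cn w (Name c) \<longleftrightarrow> w = NameTag # map Bit (cn c)"

definition encodes_list :: "('b list \<Rightarrow> 'x \<Rightarrow> bool) \<Rightarrow> 'b list \<Rightarrow> 'x list \<Rightarrow> bool" where
  "encodes_list enc w xs \<longleftrightarrow> (\<exists>ws. list_all2 enc ws xs \<and> w = concat ws)"

fun encodes_fact ::
  "('r \<Rightarrow> bool list) \<Rightarrow> ('d \<Rightarrow> bool list) \<Rightarrow> sym list \<Rightarrow> ('r, 'd) fact \<Rightarrow> bool" where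
  "encodes_fact rn cn w (Fact r cs) \<longleftrightarrow>
     (\<exists>u. encodes_list (encodes_const cn) u cs \<and> w = FactTag # map Bit (rn r) @ u)"

fun encodes_pair ::
  "('r \<Rightarrow> bool list) \<Rightarrow> ('d \<Rightarrow> bool list) \<Rightarrow> sym list \<Rightarrow> ('r, 'd) fact \<times> ('r, 'd) fact \<Rightarrow> bool" where
  "encodes_pair rn cn w (x, y) \<longleftrightarrow>
     (\<exists>u v. encodes_fact rn cn u x \<and> encodes_fact rn cn v y \<and> w = PairTag # u @ v)"

fun encodes_input ::
  "('r \<Rightarrow> bool list) \<Rightarrow> ('d \<Rightarrow> bool list) \<Rightarrow> sym list \<Rightarrow>
   ('r, 'd) fact set \<times> ('r, 'd) prio \<Rightarrow> bool" where
  "encodes_input rn cn w (I, P) \<longleftrightarrow>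
     (\<exists>u v fs ps. set fs = I \<and> set ps = P \<and> encodes_list (encodes_fact rn cn) u fs \<and>
        encodes_list (encodes_pair rn cn) v ps \<and> w = u @ v)"

definition language_of ::
  "('r \<Rightarrow> bool list) \<Rightarrow> ('d \<Rightarrow> bool list) \<Rightarrow>
   (('r, 'd) fact set \<times> ('r, 'd) prio) set \<Rightarrow> sym list set" where
  "language_of rn cn D = {w. \<exists>x\<in>D. encodes_input rn cn w x}"

end

theory Submission imports Defs begin

text \<open>With at most one functional dependency per relation name, the facts of an instance split into
  clusters (same relation name, same left-hand side), and each cluster into parts (same right-hand side as
  well). A repair picks one part from every cluster, and it is preferred, in each of the three senses, iff
  every picked part is good by itself, where goodness is a first-order property of the part and the
  priority: no fact dominates all of the part (Pareto), no other part dominates it fact by fact (global),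
  some fact of the part is undominated (completion). As the query mentions a fixed finite set of facts, it
  only matters which subsets of this set are cut out by preferred repairs, and since clusters are
  independent, this is again first-order.

  Polynomial time is obtained from a logic on the positions of the input word: first-order logic with the
  order of positions, extended by tables filled by dynamic programming. Every formula compiles to a
  multi-tape Turing machine with one head per variable and one tape per table. The tables suffice to
  compare rationals (by multiplying out, column by column with carries) and to test acyclicity.\<close>

section \<open>Structured tape programs and their Turing machines\<close>

text \<open>There may be exponentially many repairs, so quantifying over them is replaced by
  quantifying over the finitely many subsets of the facts of \<open>Q\<close>. The order of
  rationals never has to be decided on the input: order atoms are ground and occur only in the fixed
  query. Equality does have to be decided, because a rational has many codes and equal facts may be
  written as different words. Formulas can only speak of pieces of the word they are evaluated on,
  whereas the facts of \<open>Q\<close> may be absent from the input. Hence the machine evaluates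
  its formula on \<open>pre @ w @ [Minus]\<close>: \<open>pre\<close> contains codes of all facts of
  \<open>Q\<close>, and the last symbol gives the end of the input a position of its own. The logic
  makes the time bound compositional: it is proved once, by induction on formulas, and everything
  after that is a matter of closure properties. The price is that every number used by a formula is
  a position. Sums, carries, bit indices and path lengths must stay below the length of the word,
  which is the origin of the length bounds found throughout.\<close>

datatype 'a prog =
    Skip
  | Act nat "(nat \<Rightarrow> 'a cell) \<Rightarrow> 'a cell \<times> move"
  | Seq "'a prog" "'a prog"
  | Cond "(nat \<Rightarrow> 'a cell) \<Rightarrow> bool" "'a prog" "'a prog"
  | While "(nat \<Rightarrow> 'a cell) \<Rightarrow> bool" "'a prog"

type_synonym 'a tapes = "nat \<Rightarrow> 'a tape"

definition reads :: "'a tapes \<Rightarrow> nat \<Rightarrow> 'a cell" where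
  "reads T = (\<lambda>i. tape_read (T i))"

text \<open>Each constructor costs one step of its own, because the machine built below spends one
  step on unfolding the program on top of its stack. The count is therefore an exact number of stack
  steps.\<close>

inductive runs :: "'a prog \<Rightarrow> 'a tapes \<Rightarrow> nat \<Rightarrow> 'a tapes \<Rightarrow> bool" where
  Skip: "runs Skip T 1 T"
| Act: "runs (Act i f) T 1 (T(i := tape_act (f (reads T)) (T i)))"
| Seq: "runs p T a T1 \<Longrightarrow> runs q T1 b T2 \<Longrightarrow> runs (Seq p q) T (Suc (a + b)) T2"
| CondT: "b (reads T) \<Longrightarrow> runs p T a T1 \<Longrightarrow> runs (Cond b p q) T (Suc a) T1"
| CondF: "\<not> b (reads T) \<Longrightarrow> runs q T a T1 \<Longrightarrow> runs (Cond b p q) T (Suc a) T1"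
| WhileF: "\<not> b (reads T) \<Longrightarrow> runs (While b p) T 1 T"
| WhileT: "b (reads T) \<Longrightarrow> runs p T a T1 \<Longrightarrow> runs (While b p) T1 c T2 \<Longrightarrow>
    runs (While b p) T (Suc (a + c)) T2"

text \<open>One work symbol is enough: flags and tables hold truth values, with
  \<open>Work 0\<close> for true and \<open>Blank\<close> for false.\<close>

definition cells :: "'a cell set" where
  "cells = {Blank} \<union> range Input \<union> {Work 0}"

definition local_on :: "nat \<Rightarrow> ((nat \<Rightarrow> 'a cell) \<Rightarrow> 'b) \<Rightarrow> bool" where
  "local_on k f \<longleftrightarrow> (\<forall>r s. (\<forall>j<k. r j = s j) \<longrightarrow> f r = f s)"

fun wf_prog :: "nat \<Rightarrow> 'a prog \<Rightarrow> bool" where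
  "wf_prog k Skip \<longleftrightarrow> True"
| "wf_prog k (Act i f) \<longleftrightarrow> i < k \<and> local_on k f \<and>
     (\<forall>r. (\<forall>j<k. r j \<in> cells) \<longrightarrow> fst (f r) \<in> cells)"
| "wf_prog k (Seq p q) \<longleftrightarrow> wf_prog k p \<and> wf_prog k q"
| "wf_prog k (Cond b p q) \<longleftrightarrow> local_on k b \<and> wf_prog k p \<and> wf_prog k q"
| "wf_prog k (While b p) \<longleftrightarrow> local_on k b \<and> wf_prog k p"

lemma local_on_mono: "local_on k f \<Longrightarrow> k \<le> l \<Longrightarrow> local_on l f"
  unfolding local_on_def by (meson order_less_le_trans)

lemma wf_prog_mono: "wf_prog k p \<Longrightarrow> k \<le> l \<Longrightarrow> wf_prog l p"
  by (induction p) (auto intro: local_on_mono)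

text \<open>Programs are run on infinitely many tapes. This lemma allows the tapes from
  \<open>k\<close> on to be replaced by anything, so that a correctness statement about idealized
  tapes carries over to the finitely many tapes of a machine.\<close>

lemma runs_local:
  assumes "runs p T t T'" "wf_prog k p" "\<forall>i<k. T i = V i"
  shows "\<exists>V'. runs p V t V' \<and> (\<forall>i<k. T' i = V' i)"
  using assms
proof (induction arbitrary: V rule: runs.induct)
  case (Skip T)
  then show ?case using runs.Skip by blast
next
  case (Act i f T)
  have "f (reads T) = f (reads V)"
    using Act unfolding wf_prog.simps local_on_def reads_def by metis
  then show ?case using Act
    by (intro exI[of _ "V(i := tape_act (f (reads V)) (V i))"] conjI runs.Act) auto
next
  case (Seq p T a T1 q b T2)
  then show ?case by (metis runs.Seq wf_prog.simps(3))
next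
  case (CondT b T p a T1 q)
  have "b (reads T) = b (reads V)"
    using CondT.prems unfolding wf_prog.simps local_on_def reads_def by metis
  then show ?case using CondT by (metis runs.CondT wf_prog.simps(4))
next
  case (CondF b T q a T1 p)
  have "b (reads T) = b (reads V)"
    using CondF.prems unfolding wf_prog.simps local_on_def reads_def by metis
  then show ?case using CondF by (metis runs.CondF wf_prog.simps(4))
next
  case (WhileF b T p)
  have "b (reads T) = b (reads V)"
    using WhileF.prems unfolding wf_prog.simps local_on_def reads_def by metis
  then show ?case using WhileF by (metis runs.WhileF)
next
  case (WhileT b T p a T1 c T2)
  have "b (reads T) = b (reads V)"
    using WhileT.prems unfolding wf_prog.simps local_on_def reads_def by metis
  then show ?case using WhileT by (metis runs.WhileT wf_prog.simps(5))
qed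

text \<open>The control states of the machine are stacks of programs that remain to be run. Only finitely
  many stacks are reachable from a given program.\<close>

fun next_stack :: "'a prog list \<Rightarrow> (nat \<Rightarrow> 'a cell) \<Rightarrow> 'a prog list" where
  "next_stack [] r = []"
| "next_stack (Skip # K) r = K"
| "next_stack (Act i f # K) r = K"
| "next_stack (Seq p q # K) r = p # q # K"
| "next_stack (Cond b p q # K) r = (if b r then p else q) # K"
| "next_stack (While b p # K) r = (if b r then p # While b p # K else K)"

fun stack_act :: "'a prog list \<Rightarrow> (nat \<Rightarrow> 'a cell) \<Rightarrow> nat \<Rightarrow> 'a cell \<times> move" where
  "stack_act (Act i f # K) r = (\<lambda>j. if j = i then f r else (r j, MStay))"
| "stack_act _ r = (\<lambda>j. (r j, MStay))"

text \<open>An upper bound for the stacks met while \<open>p\<close> runs above \<open>K\<close>;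
  both branches of a conditional are followed. A loop body returns to the loop itself, which is
  already the continuation, so plain recursion on the program covers all iterations.\<close>

fun stacks :: "'a prog \<Rightarrow> 'a prog list \<Rightarrow> 'a prog list set" where
  "stacks Skip K = {Skip # K}"
| "stacks (Act i f) K = {Act i f # K}"
| "stacks (Seq p q) K = insert (Seq p q # K) (stacks p (q # K) \<union> stacks q K)"
| "stacks (Cond b p q) K = insert (Cond b p q # K) (stacks p K \<union> stacks q K)"
| "stacks (While b p) K = insert (While b p # K) (stacks p (While b p # K))"

lemma finite_stacks: "finite (stacks p K)"
  by (induction p arbitrary: K) auto

lemma stacks_self: "p # K \<in> stacks p K"
  by (cases p) auto

lemma next_stack_in: "s \<in> stacks p K \<Longrightarrow> next_stack s r \<in> insert K (stacks p K)"
proof (induction p arbitrary: K)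
  case (Seq p q)
  then show ?case using stacks_self[of p "q # K"] stacks_self[of q K] by fastforce
next
  case (Cond b p q)
  then show ?case using stacks_self[of p K] stacks_self[of q K] by auto
next
  case (While b p)
  then show ?case using stacks_self[of p "While b p # K"] by fastforce
qed auto

lemma stacks_wf:
  "s \<in> stacks p K \<Longrightarrow> wf_prog k p \<Longrightarrow> list_all (wf_prog k) K \<Longrightarrow> s \<noteq> [] \<and> list_all (wf_prog k) s"
  by (induction p arbitrary: K) fastforce+

fun stack_step :: "'a prog list \<times> 'a tapes \<Rightarrow> 'a prog list \<times> 'a tapes" where
  "stack_step (s, T) =
     (next_stack s (reads T), \<lambda>i. tape_act (stack_act s (reads T) i) (T i))"

lemma tape_act_stay [simp]: "tape_act (tape_read t, MStay) t = t"
  by (cases t) simp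

lemma tape_act_stay' [simp]: "tape_act (reads T i, MStay) (T i) = T i"
  by (simp add: reads_def)

lemma runs_stack: "runs p T t T' \<Longrightarrow> (stack_step ^^ t) (p # K, T) = (K, T')"
proof (induction arbitrary: K rule: runs.induct)
  case (Seq p T a T1 q b T2)
  have "(stack_step ^^ Suc (a + b)) (Seq p q # K, T) = (stack_step ^^ (b + a)) (p # q # K, T)"
    by (simp add: funpow_swap1 add.commute)
  also have "\<dots> = (K, T2)" by (simp add: funpow_add Seq.IH)
  finally show ?case .
next
  case (WhileT b T p a T1 c T2)
  have "(stack_step ^^ Suc (a + c)) (While b p # K, T) =
      (stack_step ^^ (c + a)) (p # While b p # K, T)"
    using WhileT.hyps by (simp add: funpow_swap1 add.commute)
  also have "\<dots> = (K, T2)" by (simp add: funpow_add WhileT.IH)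
  finally show ?case .
next
  case (CondT b T p a T1 q)
  then show ?case by (simp add: funpow_swap1)
next
  case (CondF b T q a T1 p)
  then show ?case by (simp add: funpow_swap1)
qed (auto simp: fun_eq_iff)

section \<open>The Turing machine of a program\<close>

locale prog_machine =
  fixes p :: "'a prog" and k :: nat
  assumes wf: "wf_prog k p" and k: "1 < k"
begin

definition Stk :: "'a prog list set" where "Stk = insert [] (stacks p [])"
definition enc :: "'a prog list \<Rightarrow> nat" where "enc = (SOME f. bij_betw f Stk {0..<card Stk})"
definition dec :: "nat \<Rightarrow> 'a prog list" where "dec = inv_into Stk enc"
definition rd :: "'a cell list \<Rightarrow> nat \<Rightarrow> 'a cell" where
  "rd cs = (\<lambda>i. if i < k then cs ! i else Blank)"

text \<open>The empty stack is an ordinary state. From it the machine makes one more step, which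
  reads the flag on tape 1 and enters \<open>card Stk\<close> (accept) or
  \<open>card Stk + 1\<close> (reject), two numbers that code no stack.\<close>

definition M :: "'a tm" where
  "M = \<lparr>tm_tapes = k, tm_states = card Stk + 2, tm_work = 1, tm_start = enc [p],
     tm_accept = card Stk, tm_reject = card Stk + 1,
     tm_delta = (\<lambda>q cs.
       if dec q = [] then
         (if cs ! 1 = Blank then card Stk + 1 else card Stk, map (\<lambda>c. (c, MStay)) cs)
       else (enc (next_stack (dec q) (rd cs)), map (stack_act (dec q) (rd cs)) [0..<k]))\<rparr>"

lemma fin: "finite Stk"
  by (simp add: Stk_def finite_stacks)

lemma enc: "bij_betw enc Stk {0..<card Stk}"
  unfolding enc_def using ex_bij_betw_finite_nat[OF fin] by (rule someI_ex)

lemma dec_enc: "s \<in> Stk \<Longrightarrow> dec (enc s) = s"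
  unfolding dec_def using enc by (simp add: bij_betw_def)

lemma enc_less: "s \<in> Stk \<Longrightarrow> enc s < card Stk"
  using enc by (auto simp: bij_betw_def)

lemma dec_in: "q < card Stk \<Longrightarrow> dec q \<in> Stk"
  unfolding dec_def using enc by (metis atLeastLessThan_iff bij_betw_imp_surj_on inv_into_into le0)

lemma next_in: "s \<in> Stk \<Longrightarrow> next_stack s r \<in> Stk"
  unfolding Stk_def using next_stack_in[of s p "[]" r] by auto

lemma start_in: "[p] \<in> Stk"
  by (simp add: Stk_def stacks_self)

lemma alphabet: "tm_alphabet M = cells"
  by (auto simp: tm_alphabet_def cells_def M_def)

lemma act_cells:
  assumes "s \<in> Stk" "\<forall>j<k. r j \<in> cells" "j < k"
  shows "fst (stack_act s r j) \<in> cells"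
proof -
  have "list_all (wf_prog k) s"
    using assms(1) stacks_wf[of s p "[]" k] wf by (auto simp: Stk_def)
  then show ?thesis using assms(2,3)
    by (cases "(s, r)" rule: stack_act.cases) auto
qed

lemma wf_M: "wf_tm M"
proof -
  have *: "q' < tm_states M \<and> length acts = tm_tapes M \<and> fst ` set acts \<subseteq> tm_alphabet M"
    if q: "q < tm_states M" "\<not> tm_halting M q" and cs: "length cs = tm_tapes M" "set cs \<subseteq> tm_alphabet M"
      and d: "tm_delta M q cs = (q', acts)" for q cs q' acts
  proof -
    have lt: "q < card Stk" using q by (auto simp: M_def tm_halting_def)
    have len: "length cs = k" using cs by (simp add: M_def)
    have r: "\<forall>j<k. rd cs j \<in> cells" using cs unfolding alphabet by (auto simp: rd_def M_def)
    have cs': "set cs \<subseteq> cells" using cs unfolding alphabet by simp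
    show ?thesis
    proof (cases "dec q = []")
      case True
      then show ?thesis using d cs cs' unfolding alphabet by (auto simp: M_def split: if_splits)
    next
      case False
      then have q': "q' = enc (next_stack (dec q) (rd cs))"
        and acts: "acts = map (stack_act (dec q) (rd cs)) [0..<k]"
        using d by (auto simp: M_def)
      have "fst ` set acts \<subseteq> cells"
        using act_cells[OF dec_in[OF lt] r] unfolding acts by auto
      moreover have "q' < tm_states M"
        using enc_less[OF next_in[OF dec_in[OF lt], of "rd cs"]] unfolding q' by (simp add: M_def)
      moreover have "length acts = tm_tapes M" unfolding acts by (simp add: M_def)
      ultimately show ?thesis unfolding alphabet by blast
    qed
  qed
  show ?thesis
    unfolding wf_tm_def
  proof (intro conjI allI impI)
    show "0 < tm_tapes M" "tm_start M < tm_states M" "tm_accept M < tm_states M"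
      "tm_reject M < tm_states M" "tm_accept M \<noteq> tm_reject M"
      using k enc_less[OF start_in] by (auto simp: M_def)
  qed (use * in blast)+
qed

lemma list_local:
  assumes "s \<in> Stk" "\<forall>j<k. r j = r' j"
  shows "next_stack s r = next_stack s r' \<and> (\<forall>j<k. stack_act s r j = stack_act s r' j)"
proof -
  have "list_all (wf_prog k) s"
    using assms(1) stacks_wf[of s p "[]" k] wf by (auto simp: Stk_def)
  then show ?thesis using assms(2)
    unfolding local_on_def
    by (cases "(s, r)" rule: next_stack.cases) (simp_all add: local_on_def, metis+)
qed

definition conf :: "'a prog list \<times> 'a tapes \<Rightarrow> 'a config" where
  "conf x = (enc (fst x), map (snd x) [0..<k])"

lemma step_conf:
  assumes "fst x \<in> Stk" "fst x \<noteq> []"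
  shows "tm_step M (conf x) = conf (stack_step x)"
proof -
  obtain s T where x: "x = (s, T)" by force
  let ?cs = "map tape_read (map T [0..<k])"
  have nh: "\<not> tm_halting M (enc s)"
    using enc_less[of s] assms x by (auto simp: tm_halting_def M_def)
  have r: "\<forall>j<k. rd ?cs j = reads T j" by (auto simp: rd_def reads_def)
  note l = list_local[of s "rd ?cs" "reads T", OF _ r]
  have m: "map2 tape_act (map (stack_act s (rd ?cs)) [0..<k]) (map T [0..<k]) =
      map (\<lambda>i. tape_act (stack_act s (reads T) i) (T i)) [0..<k]"
    using l assms x by (intro nth_equalityI) auto
  show ?thesis
    unfolding x conf_def fst_conv snd_conv tm_step.simps stack_step.simps
    using nh assms x l m by (simp add: M_def dec_enc)
qed

lemma steps_conf:
  assumes "fst x \<in> Stk" and "\<And>u. u < t \<Longrightarrow> fst ((stack_step ^^ u) x) \<noteq> []"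
  shows "(tm_step M ^^ t) (conf x) = conf ((stack_step ^^ t) x) \<and> fst ((stack_step ^^ t) x) \<in> Stk"
  using assms(2)
proof (induction t)
  case 0
  then show ?case using assms by simp
next
  case (Suc t)
  let ?y = "(stack_step ^^ t) x"
  have IH: "(tm_step M ^^ t) (conf x) = conf ?y" "fst ?y \<in> Stk" "fst ?y \<noteq> []"
    using Suc by auto
  have "fst (stack_step ?y) \<in> Stk" using IH(2) next_in by (cases ?y) simp
  then show ?case using IH step_conf[of ?y] by simp
qed

lemma stack_step_nil: "stack_step ([], T) = ([], T)"
  by (simp add: fun_eq_iff)

lemma halts:
  assumes "runs p T t T'"
  shows "\<exists>u \<le> Suc t. fst ((tm_step M ^^ u) (enc [p], map T [0..<k])) =
    (if reads T' 1 = Blank then tm_reject M else tm_accept M)"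
proof -
  let ?x = "([p], T)"
  \<comment> \<open>\<open>steps_conf\<close> follows the stack machine only while the stack is
    nonempty. Afterwards \<open>stack_step\<close> stands still but the Turing machine moves on to a
    halting state, so the first moment with an empty stack is the one to use.\<close>
  define u where "u = (LEAST u. fst ((stack_step ^^ u) ?x) = [])"
  have e: "(stack_step ^^ t) ?x = ([], T')" using runs_stack[OF assms, of "[]"] by simp
  then have u: "fst ((stack_step ^^ u) ?x) = []" "u \<le> t"
    unfolding u_def by (metis (mono_tags, lifting) LeastI fst_conv, simp add: Least_le)
  have n: "fst ((stack_step ^^ v) ?x) \<noteq> []" if "v < u" for v
    using that not_less_Least unfolding u_def by blast
  have stable: "(stack_step ^^ v) ([], W) = ([], W)" for v and W :: "'a tapes"
    by (induction v) (simp_all only: funpow.simps comp_apply id_apply stack_step_nil)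
  obtain W where W: "(stack_step ^^ u) ?x = ([], W)" using u(1) by (metis prod.collapse)
  have "(stack_step ^^ t) ?x = (stack_step ^^ (t - u)) ((stack_step ^^ u) ?x)"
    using u(2) by (metis comp_apply funpow_add le_add_diff_inverse2)
  then have W': "W = T'" using e W stable by simp
  have "(tm_step M ^^ u) (conf ?x) = conf ([], T')"
    using steps_conf[of ?x u] start_in n W W' by simp
  moreover have "fst (tm_step M (conf ([], T'))) =
    (if reads T' 1 = Blank then tm_reject M else tm_accept M)"
  proof -
    have "\<not> tm_halting M (enc [])"
      using enc_less[of "[]"] by (auto simp: tm_halting_def M_def Stk_def)
    then show ?thesis using k
      by (simp add: conf_def M_def dec_enc Stk_def reads_def)
  qed
  ultimately have "fst ((tm_step M ^^ Suc u) (conf ?x)) =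
    (if reads T' 1 = Blank then tm_reject M else tm_accept M)" by simp
  then show ?thesis using u(2) by (auto simp: conf_def intro!: exI[of _ "Suc u"])
qed

end

definition start_tapes :: "'a list \<Rightarrow> 'a tapes" where
  "start_tapes w = (\<lambda>i. if i = 0 then input_tape w else blank_tape)"

lemma prog_decides_PTIME:
  fixes p :: "'a::finite prog" and P :: "nat poly"
  assumes "wf_prog k p"
    and run: "\<And>w. \<exists>t T'. t \<le> poly P (length w) \<and> runs p (start_tapes w) t T' \<and>
      (reads T' 1 \<noteq> Blank \<longleftrightarrow> w \<in> L)"
  shows "L \<in> PTIME"
proof -
  \<comment> \<open>Tape 1, which the last step reads, has to exist whatever \<open>k\<close>
    is.\<close>
  define K where "K = k + 2"
  interpret prog_machine p K
    by standard (use assms(1) wf_prog_mono[of k p K] in \<open>auto simp: K_def\<close>)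
  have init: "tm_init M w = (enc [p], map (start_tapes w) [0..<K])" for w
  proof -
    have "map (start_tapes w) [0..<K] = input_tape w # replicate (K - 1) blank_tape"
      using k by (intro nth_equalityI) (auto simp: start_tapes_def nth_Cons')
    then show ?thesis by (simp add: tm_init_def M_def)
  qed
  have "tm_decides_in_time M L (poly (P + 1))"
    unfolding tm_decides_in_time_def
  proof
    fix w
    obtain t T' where t: "t \<le> poly P (length w)" "runs p (start_tapes w) t T'"
      "reads T' 1 \<noteq> Blank \<longleftrightarrow> w \<in> L" using run by blast
    show "\<exists>t\<le>poly (P + 1) (length w). fst ((tm_step M ^^ t) (tm_init M w)) =
        (if w \<in> L then tm_accept M else tm_reject M)"
      using halts[OF t(2), folded init] t(1,3)
      by (metis (no_types, lifting) Suc_eq_plus1 Suc_le_mono order_trans poly_1 poly_add)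
  qed
  then show ?thesis using wf_M unfolding PTIME_def by blast
qed

section \<open>Basic tape programs\<close>

text \<open>Tape 0 holds the input and tape 1 a flag; pointers and tables alternate on the remaining tapes.\<close>

definition ptr :: "nat \<Rightarrow> nat" where "ptr i = 2 * i + 2"
definition tab :: "nat \<Rightarrow> nat" where "tab i = 2 * i + 3"

lemma ptr_tab_simps [simp]:
  "ptr i = ptr j \<longleftrightarrow> i = j" "tab i = tab j \<longleftrightarrow> i = j" "ptr i \<noteq> tab j" "tab j \<noteq> ptr i"
  "ptr i \<noteq> 0" "0 \<noteq> ptr i" "ptr i \<noteq> Suc 0" "Suc 0 \<noteq> ptr i"
  "tab i \<noteq> 0" "0 \<noteq> tab i" "tab i \<noteq> Suc 0" "Suc 0 \<noteq> tab i"
  unfolding ptr_def tab_def by presburger+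

definition contents :: "'a list \<Rightarrow> int \<Rightarrow> 'a cell" where
  "contents u = (\<lambda>i. if 0 \<le> i \<and> i < int (length u) then Input (u ! nat i) else Blank)"

definition flag :: "bool \<Rightarrow> 'a tape" where
  "flag b = (\<lambda>i. if i = 0 \<and> b then Work 0 else Blank, 0)"

lemma reads_upd [simp]: "reads (T(i := t)) j = (if j = i then tape_read t else reads T j)"
  by (simp add: reads_def)

lemma read_flag [simp]: "fst (flag b) (snd (flag b)) = Blank \<longleftrightarrow> \<not> b" "tape_read (flag b) = Blank \<longleftrightarrow> \<not> b"
  by (simp_all add: flag_def)

lemma contents_Blank [simp]: "contents u i = Blank \<longleftrightarrow> i < 0 \<or> int (length u) \<le> i"
  by (auto simp: contents_def)

section \<open>Programs confined to finitely many tapes\<close>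

definition bounded_prog :: "'a prog \<Rightarrow> bool" where
  "bounded_prog p \<longleftrightarrow> (\<exists>k. wf_prog k p)"

definition bounded_test :: "((nat \<Rightarrow> 'a cell) \<Rightarrow> 'b) \<Rightarrow> bool" where
  "bounded_test b \<longleftrightarrow> (\<exists>k. local_on k b)"

lemma bounded_test_const [intro, simp]: "bounded_test (\<lambda>_. c)"
  by (auto simp: bounded_test_def local_on_def)

lemma bounded_test_read [intro, simp]: "bounded_test (\<lambda>r. P (r i))"
  unfolding bounded_test_def local_on_def by (rule exI[of _ "Suc i"]) auto

lemma bounded_test_conj [intro]:
  "bounded_test b \<Longrightarrow> bounded_test c \<Longrightarrow> bounded_test (\<lambda>r. b r \<and> c r)"
proof -
  assume "bounded_test b" "bounded_test c"
  then obtain k l where kl: "local_on k b" "local_on l c" unfolding bounded_test_def by blast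
  have "local_on (k + l) b" "local_on (k + l) c"
    using kl local_on_mono by (metis le_add1, metis le_add2)
  then have "local_on (k + l) (\<lambda>r. b r \<and> c r)" unfolding local_on_def by blast
  then show ?thesis unfolding bounded_test_def by blast
qed

lemma bounded_Skip [intro, simp]: "bounded_prog Skip"
  by (simp add: bounded_prog_def)

lemma bounded_Seq [intro]: "bounded_prog p \<Longrightarrow> bounded_prog q \<Longrightarrow> bounded_prog (Seq p q)"
proof -
  assume "bounded_prog p" "bounded_prog q"
  then obtain k l where "wf_prog k p" "wf_prog l q" unfolding bounded_prog_def by blast
  then have "wf_prog (k + l) (Seq p q)" by (auto intro: wf_prog_mono)
  then show ?thesis unfolding bounded_prog_def by blast
qed

lemma bounded_Cond [intro]:
  assumes "bounded_test b" "bounded_prog p" "bounded_prog q"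
  shows "bounded_prog (Cond b p q)"
proof -
  obtain k l m where "local_on k b" "wf_prog l p" "wf_prog m q"
    using assms unfolding bounded_test_def bounded_prog_def by blast
  then have "wf_prog (k + l + m) (Cond b p q)"
    by (auto intro: local_on_mono wf_prog_mono)
  then show ?thesis unfolding bounded_prog_def by blast
qed

lemma bounded_While [intro]:
  assumes "bounded_test b" "bounded_prog p"
  shows "bounded_prog (While b p)"
proof -
  obtain k l where "local_on k b" "wf_prog l p"
    using assms unfolding bounded_test_def bounded_prog_def by blast
  then have "wf_prog (k + l) (While b p)"
    by (auto intro: local_on_mono wf_prog_mono)
  then show ?thesis unfolding bounded_prog_def by blast
qed

lemma bounded_Act:
  assumes "local_on k f" "\<And>r. (\<forall>j<k. r j \<in> cells) \<Longrightarrow> fst (f r) \<in> cells"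
  shows "bounded_prog (Act i f)"
proof -
  have "wf_prog (Suc (k + i)) (Act i f)"
    using local_on_mono[OF assms(1)] assms(2) by auto
  then show ?thesis unfolding bounded_prog_def by blast
qed

definition mv :: "nat \<Rightarrow> move \<Rightarrow> 'a prog" where
  "mv i m = Act i (\<lambda>r. (r i, m))"

definition put_cell :: "nat \<Rightarrow> 'a cell \<Rightarrow> move \<Rightarrow> 'a prog" where
  "put_cell i c m = Act i (\<lambda>_. (c, m))"

definition set_flag :: "((nat \<Rightarrow> 'a cell) \<Rightarrow> bool) \<Rightarrow> 'a prog" where
  "set_flag b = Act 1 (\<lambda>r. (if b r then Work 0 else Blank, MStay))"

lemma bounded_mv [intro, simp]: "bounded_prog (mv i m)"
  unfolding mv_def by (rule bounded_Act[of "Suc i"]) (auto simp: local_on_def)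

lemma bounded_put_cell [intro, simp]: "c \<in> cells \<Longrightarrow> bounded_prog (put_cell i c m)"
  unfolding put_cell_def by (rule bounded_Act[of 0]) (auto simp: local_on_def)

lemma bounded_set_flag [intro]:
  assumes "bounded_test b" shows "bounded_prog (set_flag b)"
proof -
  obtain k where k: "local_on k b" using assms unfolding bounded_test_def by blast
  have "local_on k (\<lambda>r. (if b r then Work 0 else Blank, MStay))"
    unfolding local_on_def
  proof (intro allI impI)
    fix r s :: "nat \<Rightarrow> 'a cell"
    assume "\<forall>j<k. r j = s j"
    then have "b r = b s" using k unfolding local_on_def by blast
    then show "(if b r then Work 0 else Blank, MStay) = (if b s then Work 0 else Blank, MStay)" by simp
  qed
  then show ?thesis unfolding set_flag_def by (rule bounded_Act) (auto simp: cells_def)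
qed

text \<open>Time is measured by a power of the word length \<open>N\<close> instead of a polynomial.
  For \<open>2 \<le> N\<close> constants and sums are absorbed by raising the exponent, so composing
  programs is just addition of small numbers to exponents.\<close>

definition runs_in :: "nat \<Rightarrow> nat \<Rightarrow> 'a prog \<Rightarrow> 'a tapes \<Rightarrow> 'a tapes \<Rightarrow> bool" where
  "runs_in N c p T T' \<longleftrightarrow> (\<exists>t \<le> N ^ c. runs p T t T')"

lemma runs_in_mono: "runs_in N c p T T' \<Longrightarrow> c \<le> d \<Longrightarrow> 2 \<le> N \<Longrightarrow> runs_in N d p T T'"
  unfolding runs_in_def using power_increasing[of c d N]
  by (meson one_le_numeral order_trans)

lemma runs_in_Skip: "runs_in N c Skip T T" if "2 \<le> N"
  unfolding runs_in_def using that by (auto intro!: exI[of _ 1] runs.Skip)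

lemma runs_in_Act: "runs_in N c (Act i f) T (T(i := tape_act (f (reads T)) (T i)))" if "2 \<le> N"
  unfolding runs_in_def using that by (auto intro!: exI[of _ 1] runs.Act)

lemma runs_in_Seq:
  assumes "runs_in N a p T T1" "runs_in N b q T1 T2" "2 \<le> N"
  shows "runs_in N (a + b + 2) (Seq p q) T T2"
proof -
  obtain s t where st: "s \<le> N ^ a" "t \<le> N ^ b" "runs (Seq p q) T (Suc (s + t)) T2"
    using assms(1,2) unfolding runs_in_def by (meson runs.Seq)
  have "N ^ a \<le> N ^ (a + b)" "N ^ b \<le> N ^ (a + b)" "1 \<le> N ^ (a + b)"
    using assms(3) by (auto intro: power_increasing)
  then have "Suc (s + t) \<le> 4 * N ^ (a + b)" using st by linarith
  also have "\<dots> \<le> N ^ 2 * N ^ (a + b)"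
    using power_mono[of 2 N 2] assms(3) by (intro mult_right_mono) auto
  also have "\<dots> = N ^ (a + b + 2)" by (simp add: power_add power2_eq_square)
  finally show ?thesis using st(3) unfolding runs_in_def by blast
qed

lemma runs_in_Cond:
  assumes "b (reads T) \<Longrightarrow> runs_in N a p T T'" "\<not> b (reads T) \<Longrightarrow> runs_in N a q T T'" "2 \<le> N"
  shows "runs_in N (a + 1) (Cond b p q) T T'"
proof -
  obtain t where t: "t \<le> N ^ a" "runs (Cond b p q) T (Suc t) T'"
    using assms(1,2) unfolding runs_in_def by (cases "b (reads T)") (meson runs.CondT runs.CondF)+
  have "1 \<le> N ^ a" using assms(3) by simp
  then have "Suc t \<le> 2 * N ^ a" using t(1) by linarith
  also have "\<dots> \<le> N * N ^ a" using assms(3) by (intro mult_right_mono) auto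
  finally show ?thesis using t(2) unfolding runs_in_def by (auto intro!: exI[of _ "Suc t"])
qed

lemma runs_in_While:
  assumes body: "\<And>v. v < m \<Longrightarrow> b (reads (S v)) \<and> runs_in N a p (S v) (S (Suc v))"
    and stop: "\<not> b (reads (S m))" and "m \<le> N" "2 \<le> N"
  shows "runs_in N (a + 3) (While b p) (S 0) (S m)"
proof -
  \<comment> \<open>\<open>j\<close> counts the rounds still to run, since \<open>WhileT\<close>
    puts a round in front of the remaining loop.\<close>
  have "\<exists>t \<le> j * (N ^ a + 1) + 1. runs (While b p) (S (m - j)) t (S m)" if "j \<le> m" for j
    using that
  proof (induction j)
    case 0
    then show ?case using runs.WhileF[of b "S m" p, OF stop] by auto
  next
    case (Suc j)
    then obtain t where t: "t \<le> j * (N ^ a + 1) + 1" "runs (While b p) (S (m - j)) t (S m)" by auto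
    obtain s where s: "s \<le> N ^ a" "runs p (S (m - Suc j)) s (S (m - j))"
    proof -
      have "m - Suc j < m" "Suc (m - Suc j) = m - j" using Suc.prems by auto
      then show thesis using body[of "m - Suc j"] that unfolding runs_in_def by auto
    qed
    have "runs (While b p) (S (m - Suc j)) (Suc (s + t)) (S m)"
      using runs.WhileT[OF _ s(2) t(2)] body[of "m - Suc j"] Suc.prems by auto
    then show ?case using s t by (auto intro!: exI[of _ "Suc (s + t)"])
  qed
  from this[of m] obtain t where t: "t \<le> m * (N ^ a + 1) + 1" "runs (While b p) (S 0) t (S m)"
    by auto
  have 1: "1 \<le> N ^ a" using assms(4) by simp
  have "t \<le> N * (2 * N ^ a) + N ^ a"
    using t(1) 1 assms(3) mult_mono[of m N "N ^ a + 1" "2 * N ^ a"] by linarith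
  also have "\<dots> \<le> N * N * N ^ a + N * N * N ^ a"
    using assms(4) by (intro add_mono) (auto simp: algebra_simps)
  also have "\<dots> = 2 * (N * N * N ^ a)" by simp
  also have "\<dots> \<le> N * (N * N * N ^ a)" using assms(4) by (intro mult_right_mono) auto
  finally show ?thesis using t(2) unfolding runs_in_def
    by (auto intro!: exI[of _ t] simp: power_add power3_eq_cube algebra_simps)
qed

lemma runs_in_mv: "2 \<le> N \<Longrightarrow> T i = (c, h) \<Longrightarrow> runs_in N a (mv i m) T (T(i := (c, h + offset m)))"
  using runs_in_Act[of N a i "\<lambda>r. (r i, m)" T] by (simp add: mv_def reads_def)

lemma runs_in_put_cell:
  "2 \<le> N \<Longrightarrow> T i = (f, h) \<Longrightarrow> runs_in N a (put_cell i c m) T (T(i := (f(h := c), h + offset m)))"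
  using runs_in_Act[of N a i "\<lambda>r. (c, m)" T] by (simp add: put_cell_def)

lemma runs_in_set_flag: "2 \<le> N \<Longrightarrow> T 1 = flag b \<Longrightarrow> runs_in N a (set_flag f) T (T(1 := flag (f (reads T))))"
proof -
  assume a: "2 \<le> N" "T 1 = flag b"
  have "tape_act (if f (reads T) then Work 0 else Blank, MStay) (T 1) = flag (f (reads T))"
    unfolding a by (auto simp: flag_def fun_eq_iff)
  then show ?thesis
    using runs_in_Act[of N a 1 "\<lambda>r. (if f r then Work 0 else Blank, MStay)" T] a by (simp add: set_flag_def)
qed

text \<open>The first move to the left is needed when a scan has ended on the blank cell behind the
  word; from position 0 it leads to the blank cell before the word, and the loop is skipped.\<close>

definition rewind :: "nat \<Rightarrow> 'a prog" where
  "rewind i = Seq (mv i MLeft) (Seq (While (\<lambda>r. r i \<noteq> Blank) (mv i MLeft)) (mv i MRight))"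

lemma bounded_rewind [intro, simp]: "bounded_prog (rewind i)"
  unfolding rewind_def by (intro bounded_Seq bounded_While bounded_mv bounded_test_read)

lemma runs_in_rewind:
  assumes "T i = (contents u, int v)" "v \<le> length u" "length u \<le> N" "2 \<le> N"
  shows "runs_in N 7 (rewind i) T (T(i := (contents u, 0)))"
proof -
  define S where "S j = T(i := (contents u, int v - 1 - int j))" for j
  have 1: "runs_in N 0 (mv i MLeft) T (S 0)"
    using runs_in_mv[of N T i _ _ 0 MLeft, OF assms(4,1)] by (simp add: S_def)
  have 2: "runs_in N (0 + 3) (While (\<lambda>r. r i \<noteq> Blank) (mv i MLeft)) (S 0) (S v)"
  proof (rule runs_in_While)
    fix j assume "j < v"
    then have "reads (S j) i \<noteq> Blank" using assms(2) by (auto simp: S_def)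
    moreover have "runs_in N 0 (mv i MLeft) (S j) ((S j)(i := (contents u, int v - 1 - int j + offset MLeft)))"
      by (rule runs_in_mv[OF assms(4)]) (simp add: S_def)
    ultimately show "reads (S j) i \<noteq> Blank \<and> runs_in N 0 (mv i MLeft) (S j) (S (Suc j))"
      by (simp add: S_def algebra_simps)
  qed (use assms in \<open>auto simp: S_def reads_def\<close>)
  have 3: "runs_in N 0 (mv i MRight) (S v) (T(i := (contents u, 0)))"
    using runs_in_mv[of N "S v" i _ _ 0 MRight, OF assms(4)] by (simp add: S_def)
  show ?thesis
    using runs_in_Seq[OF 1 runs_in_Seq[OF 2 3 assms(4)] assms(4)] by (simp add: rewind_def)
qed

definition For :: "nat \<Rightarrow> 'a prog \<Rightarrow> 'a prog" where
  "For i p = Seq (While (\<lambda>r. r i \<noteq> Blank) (Seq p (mv i MRight))) (rewind i)"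

lemma bounded_For [intro]: "bounded_prog p \<Longrightarrow> bounded_prog (For i p)"
  unfolding For_def by (intro bounded_Seq bounded_While bounded_mv bounded_test_read bounded_rewind)

lemma runs_in_For:
  assumes body: "\<And>v. v < length u \<Longrightarrow>
      runs_in N a p ((S v)(i := (contents u, int v))) ((S (Suc v))(i := (contents u, int v)))"
    and N: "length u \<le> N" "2 \<le> N"
    and T: "T = (S 0)(i := (contents u, 0))" "T' = (S (length u))(i := (contents u, 0))"
  shows "runs_in N (a + 14) (For i p) T T'"
proof -
  define S' where "S' v = (S v)(i := (contents u, int v))" for v
  have 1: "runs_in N (a + 0 + 2 + 3) (While (\<lambda>r. r i \<noteq> Blank) (Seq p (mv i MRight))) (S' 0) (S' (length u))"
  proof (rule runs_in_While)
    fix v assume v: "v < length u"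
    have "runs_in N 0 (mv i MRight) ((S (Suc v))(i := (contents u, int v))) (S' (Suc v))"
      using runs_in_mv[of N "(S (Suc v))(i := (contents u, int v))" i _ _ 0 MRight, OF N(2)]
      by (simp add: S'_def add.commute)
    from runs_in_Seq[OF body[OF v] this N(2)]
    show "reads (S' v) i \<noteq> Blank \<and> runs_in N (a + 0 + 2) (Seq p (mv i MRight)) (S' v) (S' (Suc v))"
      using v by (simp add: S'_def)
  qed (use N in \<open>auto simp: S'_def reads_def\<close>)
  have 2: "runs_in N 7 (rewind i) (S' (length u)) T'"
    using runs_in_rewind[of "S' (length u)" i u "length u" N] N T(2) by (simp add: S'_def)
  show ?thesis using runs_in_Seq[OF 1 2 N(2)] T(1) by (simp add: For_def S'_def add.commute)
qed

text \<open>The body overwrites the flag in every round. Stopping as soon as the flag is raised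
  keeps a positive answer from being lost.\<close>

definition Search :: "nat \<Rightarrow> 'a prog \<Rightarrow> 'a prog" where
  "Search i p = Seq (set_flag (\<lambda>_. False))
     (Seq (While (\<lambda>r. r i \<noteq> Blank \<and> r 1 = Blank) (Seq p (mv i MRight))) (rewind i))"

lemma bounded_Search [intro]: "bounded_prog p \<Longrightarrow> bounded_prog (Search i p)"
  unfolding Search_def
  by (intro bounded_Seq bounded_While bounded_mv bounded_test_read bounded_rewind
      bounded_test_conj bounded_set_flag bounded_test_const)

lemma runs_in_Search:
  assumes body: "\<And>v. v < length u \<Longrightarrow>
      runs_in (length u) a p (T(i := (contents u, int v), 1 := flag False))
        (T(i := (contents u, int v), 1 := flag (Q v)))"
    and N: "2 \<le> length u" and i: "i \<noteq> 1" and T: "T i = (contents u, 0)" "T 1 = flag b"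
  shows "runs_in (length u) (a + 16) (Search i p) T (T(1 := flag (\<exists>v<length u. Q v)))"
proof -
  define S where "S v = T(i := (contents u, int v), 1 := flag (\<exists>w<v. Q w))" for v
  \<comment> \<open>The number of rounds: one past the first witness, or all positions if there is
    none.\<close>
  define m where "m = (if \<exists>v<length u. Q v then Suc (LEAST v. Q v) else length u)"
  have m: "m \<le> length u" "\<And>v. v < m \<Longrightarrow> \<not> (\<exists>w<v. Q w)" "(\<exists>v<m. Q v) = (\<exists>v<length u. Q v)"
    "m = length u \<or> (\<exists>v<m. Q v)"
  proof -
    have L: "\<exists>v<length u. Q v \<Longrightarrow> Q (LEAST v. Q v) \<and> (LEAST v. Q v) < length u"
      by (metis LeastI Least_le le_less_trans)
    show "m \<le> length u" using L unfolding m_def by (simp add: Suc_le_eq)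
    show "\<not> (\<exists>w<v. Q w)" if "v < m" for v
    proof
      assume "\<exists>w<v. Q w"
      then obtain w where w: "w < v" "Q w" by blast
      show False
      proof (cases "\<exists>v<length u. Q v")
        case True
        then show False using that w not_less_Least[of w Q] by (simp add: m_def)
      next
        case False
        then have "m = length u" by (simp only: m_def if_False)
        then show False using that w False by auto
      qed
    qed
    show "m = length u \<or> (\<exists>v<m. Q v)" using L by (auto simp: m_def)
    then show "(\<exists>v<m. Q v) = (\<exists>v<length u. Q v)" using \<open>m \<le> length u\<close> by (meson less_le_trans)
  qed  have 1: "runs_in (length u) 0 (set_flag (\<lambda>_. False)) T (S 0)"
    using runs_in_set_flag[of "length u" T b 0 "\<lambda>_. False"] N T i
    by (simp add: S_def fun_upd_idem)
  have 2: "runs_in (length u) (a + 0 + 2 + 3) (While (\<lambda>r. r i \<noteq> Blank \<and> r 1 = Blank)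
      (Seq p (mv i MRight))) (S 0) (S m)"
  proof (rule runs_in_While)
    fix v assume v: "v < m"
    then have f: "\<not> (\<exists>w<v. Q w)" using m(2) by blast
    have vu: "v < length u" using v m(1) by simp
    have "(\<exists>w<Suc v. Q w) = Q v" using f less_Suc_eq by blast
    moreover have "runs_in (length u) 0 (mv i MRight) (T(i := (contents u, int v), 1 := flag (Q v)))
        (T(1 := flag (Q v), i := (contents u, int v + 1)))"
      using runs_in_mv[of "length u" "T(i := (contents u, int v), 1 := flag (Q v))" i _ _ 0 MRight, OF N] i
      by (simp add: fun_upd_twist)
    ultimately have "runs_in (length u) 0 (mv i MRight) (T(i := (contents u, int v), 1 := flag (Q v))) (S (Suc v))"
      using i by (simp add: S_def fun_upd_twist add.commute)
    moreover have "S v = T(i := (contents u, int v), 1 := flag False)"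
    proof -
      have "(\<exists>w<v. Q w) = False" using f by blast
      then show ?thesis unfolding S_def by (simp only:)
    qed
    ultimately show "(reads (S v) i \<noteq> Blank \<and> reads (S v) 1 = Blank) \<and>
        runs_in (length u) (a + 0 + 2) (Seq p (mv i MRight)) (S v) (S (Suc v))"
      using runs_in_Seq[OF body[OF vu] _ N, of 0 "mv i MRight" "S (Suc v)"] vu i by simp
  next
    show "\<not> (reads (S m) i \<noteq> Blank \<and> reads (S m) 1 = Blank)"
      using m(4) i by (auto simp: S_def)
  qed (use N m in auto)
  have 3: "runs_in (length u) 7 (rewind i) (S m) (T(1 := flag (\<exists>v<length u. Q v)))"
    using runs_in_rewind[of "S m" i u m "length u"] N m(1) i T(1)
    by (simp add: S_def m(3) fun_upd_twist fun_upd_idem)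
  show ?thesis
    using runs_in_Seq[OF 1 runs_in_Seq[OF 2 3 N] N] by (simp add: Search_def add.commute)
qed

text \<open>Both heads walk left in lockstep while the spare head \<open>l\<close> counts the steps.
  When one of them leaves the word, head \<open>i\<close> is outside iff its position was at most
  that of \<open>j\<close>; then \<open>l\<close> is walked back to restore all three. Equal tapes
  are treated apart because one head would be moved twice per round.\<close>

definition leq :: "nat \<Rightarrow> nat \<Rightarrow> nat \<Rightarrow> 'a prog" where
  "leq i j l = (if i = j then set_flag (\<lambda>_. True) else
     Seq (While (\<lambda>r. r i \<noteq> Blank \<and> r j \<noteq> Blank) (Seq (mv i MLeft) (Seq (mv j MLeft) (mv l MRight))))
    (Seq (set_flag (\<lambda>r. r i = Blank))
    (Seq (mv l MLeft)
    (Seq (While (\<lambda>r. r l \<noteq> Blank) (Seq (mv i MRight) (Seq (mv j MRight) (mv l MLeft))))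
         (mv l MRight)))))"

lemma bounded_leq [intro, simp]: "bounded_prog (leq i j l)"
  unfolding leq_def
  by (auto intro!: bounded_Seq bounded_While bounded_test_conj bounded_set_flag)

lemma runs_in_leq:
  assumes T: "T i = (contents u, int a)" "T j = (contents u, int b)" "T l = (contents u, 0)" "T 1 = flag f"
    and d: "i \<noteq> l" "j \<noteq> l" "i \<noteq> 1" "j \<noteq> 1" "l \<noteq> 1"
    and ab: "a < length u" "b < length u" and N: "2 \<le> length u"
  shows "runs_in (length u) 30 (leq i j l) T (T(1 := flag (a \<le> b)))"
proof (cases "i = j")
  case True
  then have "a = b" using T by simp
  then show ?thesis
    using runs_in_set_flag[OF N, of T f 30 "\<lambda>_. True"] T(4) True by (simp add: leq_def)
next
  case ij: False
  define m where "m = Suc (min a b)"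
  let ?N = "length u"
  define S where "S v = T(i := (contents u, int a - int v), j := (contents u, int b - int v),
    l := (contents u, int v))" for v
  define S' where "S' v = T(1 := flag (a \<le> b), i := (contents u, int a - int m + int v),
    j := (contents u, int b - int m + int v), l := (contents u, int m - 1 - int v))" for v
  have S0: "S 0 = T" using T d ij by (auto simp: S_def fun_eq_iff)
  have 1: "runs_in ?N (0 + (0 + 0 + 2) + 2 + 3) (While (\<lambda>r. r i \<noteq> Blank \<and> r j \<noteq> Blank)
      (Seq (mv i MLeft) (Seq (mv j MLeft) (mv l MRight)))) T (S m)"
    unfolding S0[symmetric]
  proof (rule runs_in_While)
    fix v assume v: "v < m"
    let ?A = "(S v)(i := (contents u, int a - int v + offset MLeft))"
    let ?B = "?A(j := (contents u, int b - int v + offset MLeft))"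
    have a: "runs_in ?N 0 (mv i MLeft) (S v) ?A"
      by (rule runs_in_mv[OF N]) (use d ij in \<open>simp add: S_def\<close>)
    have b: "runs_in ?N 0 (mv j MLeft) ?A ?B"
      by (rule runs_in_mv[OF N]) (use d ij in \<open>simp add: S_def\<close>)
    have c: "runs_in ?N 0 (mv l MRight) ?B (?B(l := (contents u, int v + offset MRight)))"
      by (rule runs_in_mv[OF N]) (use d ij in \<open>simp add: S_def\<close>)
    have "?B(l := (contents u, int v + offset MRight)) = S (Suc v)"
      using d ij by (auto simp: S_def fun_eq_iff)
    then show "(reads (S v) i \<noteq> Blank \<and> reads (S v) j \<noteq> Blank) \<and> runs_in ?N (0 + (0 + 0 + 2) + 2)
        (Seq (mv i MLeft) (Seq (mv j MLeft) (mv l MRight))) (S v) (S (Suc v))"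
      using runs_in_Seq[OF a runs_in_Seq[OF b c N] N] v d ij ab by (auto simp: S_def m_def reads_def)
  qed (use d ij ab N in \<open>auto simp: S_def m_def reads_def\<close>)
  have 2: "runs_in ?N 0 (set_flag (\<lambda>r. r i = Blank)) (S m) ((S m)(1 := flag (reads (S m) i = Blank)))"
    by (rule runs_in_set_flag[OF N]) (use d T in \<open>simp add: S_def\<close>)
  have r: "(reads (S m) i = Blank) = (a \<le> b)"
    using d ij ab by (auto simp: S_def m_def)
  have 3: "runs_in ?N 0 (mv l MLeft) ((S m)(1 := flag (reads (S m) i = Blank))) (S' 0)"
  proof -
    have "S' 0 = (S m)(1 := flag (reads (S m) i = Blank), l := (contents u, int m + offset MLeft))"
      using d ij unfolding r by (auto simp: S_def S'_def fun_eq_iff)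
    then show ?thesis
      using runs_in_mv[OF N, of "(S m)(1 := flag (reads (S m) i = Blank))" l "contents u" "int m" 0 MLeft] d
      by (simp add: S_def)
  qed
  have 4: "runs_in ?N (0 + (0 + 0 + 2) + 2 + 3) (While (\<lambda>r. r l \<noteq> Blank)
      (Seq (mv i MRight) (Seq (mv j MRight) (mv l MLeft)))) (S' 0) (S' m)"
  proof (rule runs_in_While)
    fix v assume v: "v < m"
    let ?A = "(S' v)(i := (contents u, int a - int m + int v + offset MRight))"
    let ?B = "?A(j := (contents u, int b - int m + int v + offset MRight))"
    have a: "runs_in ?N 0 (mv i MRight) (S' v) ?A"
      by (rule runs_in_mv[OF N]) (use d ij in \<open>simp add: S'_def\<close>)
    have b: "runs_in ?N 0 (mv j MRight) ?A ?B"
      by (rule runs_in_mv[OF N]) (use d ij in \<open>simp add: S'_def\<close>)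
    have c: "runs_in ?N 0 (mv l MLeft) ?B (?B(l := (contents u, int m - 1 - int v + offset MLeft)))"
      by (rule runs_in_mv[OF N]) (use d ij in \<open>simp add: S'_def\<close>)
    have "?B(l := (contents u, int m - 1 - int v + offset MLeft)) = S' (Suc v)"
      using d ij by (auto simp: S'_def fun_eq_iff)
    then show "reads (S' v) l \<noteq> Blank \<and> runs_in ?N (0 + (0 + 0 + 2) + 2)
        (Seq (mv i MRight) (Seq (mv j MRight) (mv l MLeft))) (S' v) (S' (Suc v))"
      using runs_in_Seq[OF a runs_in_Seq[OF b c N] N] v d ij ab by (auto simp: S'_def m_def reads_def)
  qed (use d ij ab N in \<open>auto simp: S'_def m_def reads_def\<close>)
  have 5: "runs_in ?N 0 (mv l MRight) (S' m) (T(1 := flag (a \<le> b)))"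
  proof -
    have "T(1 := flag (a \<le> b)) = (S' m)(l := (contents u, -1 + offset MRight))"
      using d ij T by (auto simp: S'_def fun_eq_iff)
    then show ?thesis
      using runs_in_mv[OF N, of "S' m" l "contents u" "-1" 0 MRight] d by (simp add: S'_def)
  qed
  have "runs_in ?N (7 + (0 + (0 + (7 + 0 + 2) + 2) + 2) + 2) (leq i j l) T (T(1 := flag (a \<le> b)))"
    using runs_in_Seq[OF 1 runs_in_Seq[OF 2 runs_in_Seq[OF 3 runs_in_Seq[OF 4 5 N] N] N] N] ij by (simp add: leq_def)
  then show ?thesis by (rule runs_in_mono) (use N in auto)
qed

section \<open>Tuples of positions and the addresses of table entries\<close>

fun tuples :: "nat \<Rightarrow> nat \<Rightarrow> nat list list" where
  "tuples 0 N = [[]]"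
| "tuples (Suc r) N = concat (map (\<lambda>v. map ((#) v) (tuples r N)) [0..<N])"

lemma set_tuples: "set (tuples r N) = {vs. length vs = r \<and> set vs \<subseteq> {..<N}}"
proof (induction r)
  case (Suc r)
  show ?case
  proof (intro set_eqI iffI)
    fix vs assume "vs \<in> {vs. length vs = Suc r \<and> set vs \<subseteq> {..<N}}"
    then show "vs \<in> set (tuples (Suc r) N)" using Suc by (cases vs) auto
  qed (use Suc in auto)
qed auto

lemma length_tuples: "length (tuples r N) = N ^ r"
  by (induction r) (simp_all add: length_concat comp_def sum_list_triv)

fun put :: "'a list \<Rightarrow> nat \<Rightarrow> nat list \<Rightarrow> 'a tapes \<Rightarrow> 'a tapes" where
  "put u n [] T = T"
| "put u n (v # vs) T = put u (Suc n) vs (T(ptr n := (contents u, int v)))"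

lemma put_other:
  assumes "\<And>j. n \<le> j \<Longrightarrow> j < n + length vs \<Longrightarrow> k \<noteq> ptr j"
  shows "put u n vs T k = T k"
  using assms
proof (induction vs arbitrary: n T)
  case (Cons v vs)
  have "put u n (v # vs) T k = (T(ptr n := (contents u, int v))) k"
    unfolding put.simps by (rule Cons.IH) (use Cons.prems in auto)
  then show ?case using Cons.prems[of n] by simp
qed simp

lemma put_ptr:
  "put u n vs T (ptr j) =
    (if n \<le> j \<and> j < n + length vs then (contents u, int (vs ! (j - n))) else T (ptr j))"
proof (induction vs arbitrary: n T)
  case (Cons v vs)
  show ?case
    unfolding put.simps Cons.IH by (auto simp: nth_Cons' Suc_diff_Suc)
qed auto

lemma put_simps [simp]: "put u n vs T (tab j) = T (tab j)" "put u n vs T (Suc 0) = T (Suc 0)"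
  "put u n vs T 0 = T 0"
  by (rule put_other; simp)+

lemma put_upd:
  assumes "\<And>j. k \<noteq> ptr j"
  shows "put u n vs (T(k := x)) = (put u n vs T)(k := x)"
  using assms
proof (induction vs arbitrary: n T)
  case (Cons v vs)
  have "T(k := x, ptr n := (contents u, int v)) = T(ptr n := (contents u, int v), k := x)"
    using Cons.prems[of n] by (rule fun_upd_twist)
  then show ?case unfolding put.simps by (metis Cons.IH Cons.prems)
qed simp

fun fors :: "nat \<Rightarrow> nat \<Rightarrow> 'a prog \<Rightarrow> 'a prog" where
  "fors n 0 p = p"
| "fors n (Suc r) p = For (ptr n) (fors (Suc n) r p)"

lemma bounded_fors [intro]: "bounded_prog p \<Longrightarrow> bounded_prog (fors n r p)"
  by (induction r arbitrary: n) auto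

lemma fold_concat_map: "fold g (concat (map f xs)) a = fold (\<lambda>x. fold g (f x)) xs a"
  by (induction xs arbitrary: a) simp_all

text \<open>The tapes are abstracted to a state \<open>a\<close> with representation
  \<open>S a\<close>, so that a nest of loops becomes a \<open>fold\<close> of the update
  \<open>g\<close> over all tuples. \<open>Inv\<close> records what the body may rely on about the
  abstract state.\<close>

lemma runs_in_fors:
  assumes body: "\<And>vs a. length vs = r \<Longrightarrow> set vs \<subseteq> {..<length u} \<Longrightarrow> Inv a \<Longrightarrow>
      runs_in (length u) c p (put u n vs (S a)) (put u n vs (S (g vs a))) \<and> Inv (g vs a)"
    and fresh: "\<And>a i. Inv a \<Longrightarrow> n \<le> i \<Longrightarrow> S a (ptr i) = (contents u, 0)"
    and a: "Inv a" and N: "2 \<le> length u"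
  shows "runs_in (length u) (c + 14 * r) (fors n r p) (S a) (S (fold g (tuples r (length u)) a)) \<and>
    Inv (fold g (tuples r (length u)) a)"
  using assms(1-3)
proof (induction r arbitrary: n S g a)
  case 0
  then show ?case using "0.prems"(1)[of "[]" a] by simp
next
  case (Suc r)
  define h where "h v = fold (\<lambda>vs. g (v # vs)) (tuples r (length u))" for v
  have inner: "runs_in (length u) (c + 14 * r) (fors (Suc n) r p) ((S b)(ptr n := (contents u, int v)))
      ((S (h v b))(ptr n := (contents u, int v))) \<and> Inv (h v b)"
    if "v < length u" "Inv b" for v b
    unfolding h_def
  proof (rule Suc.IH[where n = "Suc n" and S = "\<lambda>a. (S a)(ptr n := (contents u, int v))"])
    fix vs a assume "length vs = r" "set vs \<subseteq> {..<length u}" "Inv a"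
    then show "runs_in (length u) c p (put u (Suc n) vs ((S a)(ptr n := (contents u, int v))))
        (put u (Suc n) vs ((S (g (v # vs) a))(ptr n := (contents u, int v)))) \<and> Inv (g (v # vs) a)"
      using Suc.prems(1)[of "v # vs" a] that(1) unfolding put.simps by simp
  next
    fix a i assume "Inv a" "Suc n \<le> i"
    then show "((S a)(ptr n := (contents u, int v))) (ptr i) = (contents u, 0)"
      using Suc.prems(2)[of a i] by simp
  qed fact
  have inv: "Inv (fold h [0..<v] a)" if "v \<le> length u" for v
    using that by (induction v) (use Suc.prems(3) inner in auto)
  have idem: "(S b)(ptr n := (contents u, 0)) = S b" if "Inv b" for b
    using Suc.prems(2)[OF that, of n] by (simp add: fun_upd_idem)
  have "runs_in (length u) (c + 14 * r + 14) (For (ptr n) (fors (Suc n) r p)) (S a)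
      (S (fold h [0..<length u] a))"
  proof (rule runs_in_For[where S = "\<lambda>v. S (fold h [0..<v] a)" and u = u])
    fix v assume "v < length u"
    then show "runs_in (length u) (c + 14 * r) (fors (Suc n) r p)
        ((S (fold h [0..<v] a))(ptr n := (contents u, int v)))
        ((S (fold h [0..<Suc v] a))(ptr n := (contents u, int v)))"
      using inner[of v "fold h [0..<v] a"] inv[of v] by simp
  qed (use N idem inv Suc.prems(3) in auto)
  moreover have "fold g (tuples (Suc r) (length u)) a = fold h [0..<length u] a"
    unfolding tuples.simps by (simp only: fold_concat_map h_def[abs_def] fold_map comp_def)
  ultimately show ?case using inv[of "length u"] by (simp add: add.commute add.left_commute)
qed

text \<open>The loops serve only as a counter: \<open>r\<close> nested passes over a word of length
  \<open>N\<close> move the table head by \<open>N ^ r\<close> cells.\<close>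

definition adv :: "nat \<Rightarrow> nat \<Rightarrow> nat \<Rightarrow> move \<Rightarrow> 'a prog" where
  "adv n r t m = fors n r (mv (tab t) m)"

definition fresh :: "'a list \<Rightarrow> nat \<Rightarrow> 'a tapes \<Rightarrow> bool" where
  "fresh u n T \<longleftrightarrow> (\<forall>i\<ge>n. T (ptr i) = (contents u, 0))"

lemma fresh_mono: "fresh u n T \<Longrightarrow> n \<le> m \<Longrightarrow> fresh u m T"
  by (simp add: fresh_def)

lemma fresh_upd [simp]: "(\<And>j. k \<noteq> ptr j) \<Longrightarrow> fresh u n (T(k := x)) = fresh u n T"
  unfolding fresh_def by (metis fun_upd_other)

lemma fresh_put: "fresh u n T \<Longrightarrow> n + length vs \<le> m \<Longrightarrow> fresh u m (put u n vs T)"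
  by (simp add: fresh_def put_ptr)

lemma fold_const_add: "fold (\<lambda>_ h. h + d) xs (h :: int) = h + int (length xs) * d"
  by (induction xs arbitrary: h) (auto simp: algebra_simps)

lemma runs_in_adv:
  assumes "fresh u n T" "T (tab t) = (c, h)" "2 \<le> length u"
  shows "runs_in (length u) (14 * r) (adv n r t m) T (T(tab t := (c, h + int (length u ^ r) * offset m)))"
proof -
  define S where "S h = T(tab t := (c, h))" for h
  have "runs_in (length u) (0 + 14 * r) (fors n r (mv (tab t) m)) (S h)
      (S (fold (\<lambda>_ h. h + offset m) (tuples r (length u)) h)) \<and> True"
  proof (rule runs_in_fors)
    fix vs :: "nat list" and h
    show "runs_in (length u) 0 (mv (tab t) m) (put u n vs (S h)) (put u n vs (S (h + offset m))) \<and> True"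
      using runs_in_mv[OF assms(3), of "put u n vs (S h)" "tab t" c h 0 m]
      by (simp add: S_def put_upd)
  qed (use assms in \<open>auto simp: S_def fresh_def\<close>)
  then show ?thesis
    using assms(2) by (simp add: S_def adv_def fold_const_add length_tuples fun_upd_idem)
qed

text \<open>Pointer \<open>n\<close> runs over all positions, and \<open>p\<close> is executed at
  those strictly left of pointer \<open>x\<close>. So \<open>p\<close> runs as many times as the
  position of \<open>x\<close> says. Pointer \<open>Suc n\<close> is the scratch head of the
  comparison.\<close>

definition rep :: "nat \<Rightarrow> nat \<Rightarrow> 'a prog \<Rightarrow> 'a prog" where
  "rep n x p = For (ptr n) (Seq (leq (ptr x) (ptr n) (ptr (Suc n))) (Cond (\<lambda>r. r 1 = Blank) p Skip))"

text \<open>The tuple of pointers is read as a number in base \<open>N\<close>, first coordinate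
  most significant, and the table head travels that many cells. The same program with
  \<open>MLeft\<close> brings it home.\<close>

fun goto :: "nat \<Rightarrow> nat \<Rightarrow> nat list \<Rightarrow> move \<Rightarrow> 'a prog" where
  "goto n t [] m = set_flag (\<lambda>_. False)"
| "goto n t (y # ys) m = Seq (rep n y (adv (Suc (Suc n)) (length ys) t m)) (goto n t ys m)"

lemma bounded_goto [intro, simp]: "bounded_prog (goto n t ys m)"
  unfolding adv_def rep_def
  by (induction ys) (auto simp: adv_def rep_def intro!: bounded_Seq bounded_For bounded_Cond bounded_fors bounded_set_flag)

fun code :: "nat \<Rightarrow> nat list \<Rightarrow> nat" where
  "code N [] = 0"
| "code N (y # ys) = y * N ^ length ys + code N ys"

lemma code_less: "set ys \<subseteq> {..<N} \<Longrightarrow> code N ys < N ^ length ys"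
proof (induction ys)
  case (Cons y ys)
  then have "code N (y # ys) < (y + 1) * N ^ length ys" by simp
  also have "\<dots> \<le> N * N ^ length ys" using Cons.prems by (intro mult_right_mono) auto
  finally show ?case by simp
qed simp

lemma code_inj:
  "length xs = length ys \<Longrightarrow> set xs \<subseteq> {..<N} \<Longrightarrow> set ys \<subseteq> {..<N} \<Longrightarrow> code N xs = code N ys \<Longrightarrow> xs = ys"
proof (induction xs ys rule: list_induct2)
  case (Cons x xs y ys)
  let ?M = "N ^ length ys"
  have l: "code N xs < ?M" "code N ys < ?M" using code_less[of xs N] code_less[of ys N] Cons.prems(1,2) Cons.hyps by auto
  have e: "code N xs + x * ?M = code N ys + y * ?M"
    using Cons.prems(3) Cons.hyps by (simp add: add.commute)
  have M: "?M \<noteq> 0" using l by linarith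
  have "x = (code N xs + x * ?M) div ?M" "y = (code N ys + y * ?M) div ?M"
    using l by (simp_all only: div_mult_self1[OF M] div_less add_0_right)
  then have "x = y" using e by metis
  then show ?case using Cons.IH Cons.prems(1,2) e by simp
qed simp

lemma runs_in_rep:
  assumes T: "fresh u n T" "T (tab t) = (c, h)" "T 1 = flag b" "T (ptr x) = (contents u, int a)"
    and a: "x < n" "a < length u" "2 \<le> length u"
  shows "\<exists>b'. runs_in (length u) (14 * r + 47) (rep n x (adv (Suc (Suc n)) r t m)) T
    (T(1 := flag b', tab t := (c, h + int a * int (length u ^ r) * offset m)))"
proof -
  let ?N = "length u"
  \<comment> \<open>The flag before round \<open>v\<close>: its initial value, later the answer of
    the previous comparison.\<close>
  define f where "f v = (if v = 0 then b else a \<le> v - 1)" for v :: nat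
  define S where "S v = T(1 := flag (f v), tab t := (c, h + int (min v a) * int (?N ^ r) * offset m))" for v
  have "runs_in ?N (30 + (14 * r + 1) + 2 + 14) (rep n x (adv (Suc (Suc n)) r t m)) T (S ?N)"
    unfolding rep_def
  proof (rule runs_in_For[where S = S and u = u])
    fix v assume v: "v < length u"
    let ?S = "(S v)(ptr n := (contents u, int v))"
    let ?A = "?S(1 := flag (a \<le> v))"
    have 1: "runs_in ?N 30 (leq (ptr x) (ptr n) (ptr (Suc n))) ?S ?A"
      by (rule runs_in_leq) (use T a v in \<open>auto simp: S_def fresh_def\<close>)
    have A: "?A (tab t) = (c, h + int (min v a) * int (?N ^ r) * offset m)"
      by (simp add: S_def)
    have fr: "fresh u (Suc (Suc n)) ?A" using T(1) by (auto simp: fresh_def S_def)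
    have 2: "runs_in ?N (14 * r + 1) (Cond (\<lambda>r. r 1 = Blank) (adv (Suc (Suc n)) r t m) Skip) ?A
        ((S (Suc v))(ptr n := (contents u, int v)))"
    proof (rule runs_in_Cond)
      assume "reads ?A 1 = Blank"
      then have "\<not> a \<le> v" by simp
      then have "?A(tab t := (c, h + int (min v a) * int (?N ^ r) * offset m + int (?N ^ r) * offset m))
          = (S (Suc v))(ptr n := (contents u, int v))"
        by (auto simp: S_def fun_eq_iff f_def algebra_simps min_def)
      then show "runs_in ?N (14 * r) (adv (Suc (Suc n)) r t m) ?A ((S (Suc v))(ptr n := (contents u, int v)))"
        using runs_in_adv[OF fr A a(3), of r m] by (simp only:)
    next
      assume "\<not> reads ?A 1 = Blank"
      then have "a \<le> v" by simp
      then have "?A = (S (Suc v))(ptr n := (contents u, int v))"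
        by (auto simp: S_def fun_eq_iff f_def)
      then show "runs_in ?N (14 * r) Skip ?A ((S (Suc v))(ptr n := (contents u, int v)))"
        using runs_in_Skip[OF a(3)] by (simp only:)
    qed fact
    show "runs_in ?N (30 + (14 * r + 1) + 2) (Seq (leq (ptr x) (ptr n) (ptr (Suc n)))
        (Cond (\<lambda>r. r 1 = Blank) (adv (Suc (Suc n)) r t m) Skip)) ?S
        ((S (Suc v))(ptr n := (contents u, int v)))"
      by (rule runs_in_Seq[OF 1 2 a(3)])
  next
    show "T = (S 0)(ptr n := (contents u, 0))"
      using T by (auto simp: S_def fun_eq_iff f_def fresh_def)
    show "S ?N = (S ?N)(ptr n := (contents u, 0))"
      using T by (auto simp: S_def fun_eq_iff f_def fresh_def)
  qed (use a in auto)
  then show ?thesis using a(2) by (auto simp: S_def min_def algebra_simps)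
qed

lemma runs_in_goto:
  assumes "fresh u n T" "T (tab t) = (c, h)" "T 1 = flag b" "2 \<le> length u"
    and "\<And>y. y \<in> set ys \<Longrightarrow> y < n \<and> T (ptr y) = (contents u, int (e y)) \<and> e y < length u"
  shows "runs_in (length u) ((14 * length ys + 49) * length ys) (goto n t ys m) T
    (T(1 := flag False, tab t := (c, h + int (code (length u) (map e ys)) * offset m)))"
  using assms
proof (induction ys arbitrary: T h b)
  case Nil
  have "T(1 := flag False, tab t := (c, h + int (code (length u) (map e [])) * offset m)) =
      T(1 := flag False)"
    using Nil by (auto simp: fun_eq_iff)
  then show ?case
    using runs_in_set_flag[of "length u" T b 0 "\<lambda>_. False"] Nil
    by (metis goto.simps(1) list.size(3) mult_0_right)
next
  case (Cons y ys)
  let ?N = "length u"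
  let ?h = "h + int (e y) * int (?N ^ length ys) * offset m"
  obtain b' where 1: "runs_in ?N (14 * length ys + 47) (rep n y (adv (Suc (Suc n)) (length ys) t m)) T
      (T(1 := flag b', tab t := (c, ?h)))"
    using runs_in_rep[of u n T t c h b y "e y" "length ys" m] Cons.prems by auto
  have 2: "runs_in ?N ((14 * length ys + 49) * length ys) (goto n t ys m) (T(1 := flag b', tab t := (c, ?h)))
     (T(1 := flag b', tab t := (c, ?h), 1 := flag False,
      tab t := (c, ?h + int (code ?N (map e ys)) * offset m)))"
  proof (rule Cons.IH[where T = "T(1 := flag b', tab t := (c, ?h))" and b = b'])
    show "fresh u n (T(1 := flag b', tab t := (c, ?h)))"
      using Cons.prems(1) by (simp only: fresh_upd ptr_tab_simps One_nat_def not_False_eq_True)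
    show "y < n \<and> (T(1 := flag b', tab t := (c, ?h))) (ptr y) = (contents u, int (e y)) \<and> e y < length u"
      if "y \<in> set ys" for y
      using Cons.prems(5)[of y] that by simp
  qed (use Cons.prems(4) in auto)
  have 3: "T(1 := flag b', tab t := (c, ?h), 1 := flag False,
      tab t := (c, ?h + int (code ?N (map e ys)) * offset m)) =
     T(1 := flag False, tab t := (c, h + int (code ?N (map e (y # ys))) * offset m))"
    by (auto simp: fun_eq_iff algebra_simps)
  have "runs_in ?N (14 * length ys + 47 + (14 * length ys + 49) * length ys + 2) (goto n t (y # ys) m) T
    (T(1 := flag False, tab t := (c, h + int (code ?N (map e (y # ys))) * offset m)))"
    unfolding goto.simps using runs_in_Seq[OF 1 2[unfolded 3] Cons.prems(4)] by simp
  then show ?case by (rule runs_in_mono) (use Cons.prems in \<open>auto simp: algebra_simps\<close>)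
qed

section \<open>Formulas over the positions of a word\<close>

text \<open>Variables and tables are de Bruijn indices. \<open>Ex\<close> binds position variable 0;
  \<open>Fix r f xs\<close> binds table 0 and the first \<open>r\<close> position variables in
  \<open>f\<close>, fills the table, and looks up the entry \<open>xs\<close>.\<close>

datatype 'a fm =
    Chk "'a set" nat
  | Leq nat nat
  | Rel nat "nat list"
  | Neg "'a fm"
  | And "'a fm" "'a fm"
  | Ex "'a fm"
  | Fix nat "'a fm" "nat list"

text \<open>A single pass instead of an iteration to a fixed point: every tuple is visited once, in
  lexicographic order, and decided from the entries made so far. This costs only
  \<open>N ^ r\<close> evaluations of the body.\<close>

definition dp :: "nat \<Rightarrow> nat \<Rightarrow> ((nat list \<Rightarrow> bool) \<Rightarrow> nat list \<Rightarrow> bool) \<Rightarrow> nat list \<Rightarrow> bool" where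
  "dp N r B = fold (\<lambda>vs X. if B X vs then X(vs := True) else X) (tuples r N) (\<lambda>_. False)"

fun eval :: "'a list \<Rightarrow> (nat \<Rightarrow> nat list \<Rightarrow> bool) \<Rightarrow> (nat \<Rightarrow> nat) \<Rightarrow> 'a fm \<Rightarrow> bool" where
  "eval u D e (Chk A x) \<longleftrightarrow> u ! e x \<in> A"
| "eval u D e (Leq x y) \<longleftrightarrow> e x \<le> e y"
| "eval u D e (Rel t xs) \<longleftrightarrow> D t (map e xs)"
| "eval u D e (Neg f) \<longleftrightarrow> \<not> eval u D e f"
| "eval u D e (And f g) \<longleftrightarrow> eval u D e f \<and> eval u D e g"
| "eval u D e (Ex f) \<longleftrightarrow> (\<exists>v<length u. eval u D (case_nat v e) f)"
| "eval u D e (Fix r f xs) \<longleftrightarrow>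
     dp (length u) r (\<lambda>X vs. eval u (case_nat X D) (\<lambda>i. if i < r then vs ! i else e (i - r)) f) (map e xs)"

text \<open>\<open>goto\<close> destroys the flag, so the bit read from the table is remembered in
  the control state: each branch first walks back and then sets the flag to its own
  constant.\<close>

definition access :: "nat \<Rightarrow> nat \<Rightarrow> nat list \<Rightarrow> 'a prog" where
  "access n t ys = Seq (goto n t ys MRight) (Cond (\<lambda>r. r (tab t) = Blank)
     (Seq (goto n t ys MLeft) (set_flag (\<lambda>_. False))) (Seq (goto n t ys MLeft) (set_flag (\<lambda>_. True))))"

definition store :: "nat \<Rightarrow> nat \<Rightarrow> nat list \<Rightarrow> bool \<Rightarrow> 'a prog" where
  "store n t ys b = Seq (goto n t ys MRight)
     (Seq (put_cell (tab t) (if b then Work 0 else Blank) MStay) (goto n t ys MLeft))"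

text \<open>A \<open>Fix\<close> below a quantifier or inside another \<open>Fix\<close> is executed
  many times on the same tape, so its table must be blank again afterwards.\<close>

definition erase :: "nat \<Rightarrow> nat \<Rightarrow> 'a prog" where
  "erase n r = Seq (set_flag (\<lambda>_. False)) (fors n r (store (n + r) n [n..<n + r] False))"

lemma bounded_access [intro, simp]: "bounded_prog (access n t ys)"
  unfolding access_def by (auto intro!: bounded_Seq bounded_Cond bounded_set_flag)

lemma bounded_store [intro, simp]: "bounded_prog (store n t ys b)"
  unfolding store_def by (auto intro!: bounded_Seq simp: cells_def)

lemma bounded_erase [intro, simp]: "bounded_prog (erase n r)"
  unfolding erase_def by (auto intro!: bounded_Seq bounded_set_flag bounded_fors)

text \<open>\<open>n\<close> is the first free index, \<open>x\<close> sends variables to pointers,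
  and \<open>tb\<close> lists the index and arity of each table in scope. Pointers and tables share
  the counter; the body of \<open>Fix\<close> continues with \<open>Suc (n + r)\<close> so that the
  new table index \<open>n\<close> is used up even when \<open>r = 0\<close>.\<close>

fun compile :: "nat \<Rightarrow> (nat \<Rightarrow> nat) \<Rightarrow> (nat \<times> nat) list \<Rightarrow> 'a fm \<Rightarrow> 'a prog" where
  "compile n x tb (Chk A i) = set_flag (\<lambda>r. r (ptr (x i)) \<in> Input ` A)"
| "compile n x tb (Leq i j) = leq (ptr (x i)) (ptr (x j)) (ptr n)"
| "compile n x tb (Rel t js) = (if t < length tb \<and> snd (tb ! t) = length js
     then access n (fst (tb ! t)) (map x js) else set_flag (\<lambda>_. False))"
| "compile n x tb (Neg f) = Seq (compile n x tb f) (set_flag (\<lambda>r. r 1 = Blank))"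
| "compile n x tb (And f g) = Seq (compile n x tb f) (Cond (\<lambda>r. r 1 = Blank) Skip (compile n x tb g))"
| "compile n x tb (Ex f) = Search (ptr n) (compile (Suc n) (case_nat n x) tb f)"
| "compile n x tb (Fix r f js) =
     Seq (set_flag (\<lambda>_. False))
    (Seq (fors n r (Seq (compile (Suc (n + r)) (\<lambda>i. if i < r then n + i else x (i - r)) ((n, r) # tb) f)
        (Cond (\<lambda>r. r 1 = Blank) Skip (store (n + r) n [n..<n + r] True))))
    (Seq (if length js = r then access (n + r) n (map x js) else set_flag (\<lambda>_. False))
         (Cond (\<lambda>r. r 1 = Blank) (Seq (erase n r) (set_flag (\<lambda>_. False)))
           (Seq (erase n r) (set_flag (\<lambda>_. True))))))"

lemma bounded_compile: "bounded_prog (compile n x tb f)"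
  by (induction f arbitrary: n x tb)
    (auto intro!: bounded_Seq bounded_Cond bounded_set_flag bounded_fors bounded_Search)

definition tabc :: "nat \<Rightarrow> nat \<Rightarrow> (nat list \<Rightarrow> bool) \<Rightarrow> int \<Rightarrow> 'a cell" where
  "tabc N r X = (\<lambda>j. if \<exists>vs. length vs = r \<and> set vs \<subseteq> {..<N} \<and> X vs \<and> j = int (code N vs)
     then Work 0 else Blank)"

lemma tabc_code:
  assumes "length vs = r" "set vs \<subseteq> {..<N}"
  shows "tabc N r X (int (code N vs)) = (if X vs then Work 0 else Blank)"
proof -
  have "ws = vs" if "length ws = r" "set ws \<subseteq> {..<N}" "code N vs = code N ws" for ws
    using code_inj[of ws vs N] that assms by simp
  then show ?thesis using assms by (auto simp: tabc_def)
qed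

lemma tabc_upd:
  assumes "length vs = r" "set vs \<subseteq> {..<N}"
  shows "(tabc N r X)(int (code N vs) := (if b then Work 0 else Blank)) = tabc N r (X(vs := b))"
proof
  fix j
  show "((tabc N r X)(int (code N vs) := (if b then Work 0 else Blank))) j = tabc N r (X(vs := b)) j"
  proof (cases "j = int (code N vs)")
    case True
    then show ?thesis by (cases b) (simp_all add: tabc_code[OF assms])
  next
    case False
    then have "(\<exists>ws. length ws = r \<and> set ws \<subseteq> {..<N} \<and> (X(vs := b)) ws \<and> j = int (code N ws)) =
      (\<exists>ws. length ws = r \<and> set ws \<subseteq> {..<N} \<and> X ws \<and> j = int (code N ws))"
      by (metis fun_upd_apply)
    then show ?thesis using False by (simp add: tabc_def)
  qed
qed

lemma tabc_empty: "(tabc N r (\<lambda>_. False), 0) = blank_tape"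
  by (simp add: tabc_def blank_tape_def)

definition goto_cost :: "nat \<Rightarrow> nat" where "goto_cost r = (14 * r + 49) * r"

lemma runs_in_store:
  assumes T: "fresh u n T" "T (tab t) = (tabc (length u) r X, 0)" "T 1 = flag f" and N: "2 \<le> length u"
    and ys: "\<And>y. y \<in> set ys \<Longrightarrow> y < n \<and> T (ptr y) = (contents u, int (e y)) \<and> e y < length u"
      "length ys = r"
  shows "runs_in (length u) (2 * goto_cost r + 4) (store n t ys b) T
    (T(1 := flag False, tab t := (tabc (length u) r (X(map e ys := b)), 0)))"
proof -
  let ?N = "length u" let ?c = "int (code (length u) (map e ys))"
  let ?w = "if b then Work 0 else Blank :: 'a cell"
  let ?X = "tabc ?N r (X(map e ys := b)) :: int \<Rightarrow> 'a cell"
  let ?A = "T(1 := flag False, tab t := (tabc ?N r X, ?c))"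
  let ?B = "T(1 := flag False, tab t := (?X, ?c))"
  have 1: "runs_in ?N (goto_cost r) (goto n t ys MRight) T ?A"
    using runs_in_goto[OF T N, of ys e MRight] ys by (simp add: goto_cost_def)
  have vs: "length (map e ys) = r" "set (map e ys) \<subseteq> {..<?N}" using ys by auto
  have 2: "runs_in ?N 0 (put_cell (tab t) ?w MStay) ?A ?B"
    using runs_in_put_cell[OF N, of ?A "tab t" "tabc ?N r X" ?c 0 ?w MStay]
    unfolding tabc_upd[OF vs] by simp
  have fr: "fresh u n ?B" using T(1) by (simp only: fresh_upd ptr_tab_simps One_nat_def not_False_eq_True)
  have 3: "runs_in ?N (goto_cost r) (goto n t ys MLeft) ?B
     (?B(1 := flag False, tab t := (?X, ?c + ?c * offset MLeft)))"
    using runs_in_goto[OF fr, of t ?X ?c False ys e MLeft] N ys by (simp add: goto_cost_def)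
  have "?B(1 := flag False, tab t := (?X, ?c + ?c * offset MLeft)) = T(1 := flag False, tab t := (?X, 0))"
    by (auto simp: fun_eq_iff)
  then show ?thesis
    using runs_in_Seq[OF 1 runs_in_Seq[OF 2 3 N] N] unfolding store_def
    by (auto simp: algebra_simps mult_2 numeral_eq_Suc)
qed

lemma runs_in_access:
  assumes T: "fresh u n T" "T (tab t) = (tabc (length u) r X, 0)" "T 1 = flag f" and N: "2 \<le> length u"
    and ys: "\<And>y. y \<in> set ys \<Longrightarrow> y < n \<and> T (ptr y) = (contents u, int (e y)) \<and> e y < length u"
      "length ys = r"
  shows "runs_in (length u) (2 * goto_cost r + 5) (access n t ys) T (T(1 := flag (X (map e ys))))"
proof -
  let ?N = "length u" let ?c = "int (code (length u) (map e ys))"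
  let ?X = "tabc ?N r X :: int \<Rightarrow> 'a cell"
  let ?B = "T(1 := flag False, tab t := (?X, ?c))"
  have 1: "runs_in ?N (goto_cost r) (goto n t ys MRight) T ?B"
    using runs_in_goto[OF T N, of ys e MRight] ys by (simp add: goto_cost_def)
  have vs: "length (map e ys) = r" "set (map e ys) \<subseteq> {..<?N}" using ys by auto
  have fr: "fresh u n ?B" using T(1) by (simp only: fresh_upd ptr_tab_simps One_nat_def not_False_eq_True)
  have 3: "runs_in ?N (goto_cost r) (goto n t ys MLeft) ?B
     (?B(1 := flag False, tab t := (?X, ?c + ?c * offset MLeft)))"
    using runs_in_goto[OF fr, of t ?X ?c False ys e MLeft] N ys by (simp add: goto_cost_def)
  have eq: "?B(1 := flag False, tab t := (?X, ?c + ?c * offset MLeft)) = T(1 := flag False)"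
    using T by (auto simp: fun_eq_iff)
  have 4: "runs_in ?N (goto_cost r + 0 + 2) (Seq (goto n t ys MLeft) (set_flag (\<lambda>_. b))) ?B (T(1 := flag b))" for b
  proof (rule runs_in_Seq[OF 3[unfolded eq] _ N])
    show "runs_in ?N 0 (set_flag (\<lambda>_. b)) (T(1 := flag False)) (T(1 := flag b))"
      using runs_in_set_flag[OF N, of "T(1 := flag False)" False 0 "\<lambda>_. b"] by simp
  qed
  have rd: "(reads ?B (tab t) = Blank) = (\<not> X (map e ys))"
    by (simp add: tabc_code[OF vs])
  have 5: "runs_in ?N (goto_cost r + 0 + 2 + 1) (Cond (\<lambda>r. r (tab t) = Blank)
     (Seq (goto n t ys MLeft) (set_flag (\<lambda>_. False))) (Seq (goto n t ys MLeft) (set_flag (\<lambda>_. True))))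
     ?B (T(1 := flag (X (map e ys))))"
  proof (rule runs_in_Cond)
    assume "reads ?B (tab t) = Blank"
    then have "X (map e ys) = False" using rd by blast
    then show "runs_in ?N (goto_cost r + 0 + 2) (Seq (goto n t ys MLeft) (set_flag (\<lambda>_. False))) ?B
      (T(1 := flag (X (map e ys))))" using 4[of False] by (simp only:)
  next
    assume "\<not> reads ?B (tab t) = Blank"
    then have "X (map e ys) = True" using rd by blast
    then show "runs_in ?N (goto_cost r + 0 + 2) (Seq (goto n t ys MLeft) (set_flag (\<lambda>_. True))) ?B
      (T(1 := flag (X (map e ys))))" using 4[of True] by (simp only:)
  qed fact
  have "goto_cost r + (goto_cost r + 0 + 2 + 1) + 2 = 2 * goto_cost r + 5" by simp
  then show ?thesis
    using runs_in_Seq[OF 1 5 N] unfolding access_def by (simp only:)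
qed

lemma fold_store_pred:
  "fold (\<lambda>vs X. X(vs := False)) xs X = (\<lambda>vs. X vs \<and> vs \<notin> set xs)"
  by (induction xs arbitrary: X) (auto simp: fun_eq_iff)

text \<open>Pointers and tables are allocated from the index \<open>n\<close> on.\<close>

definition ready ::
  "'a list \<Rightarrow> (nat \<Rightarrow> nat list \<Rightarrow> bool) \<Rightarrow> (nat \<Rightarrow> nat) \<Rightarrow> nat \<Rightarrow> (nat \<Rightarrow> nat) \<Rightarrow> (nat \<times> nat) list \<Rightarrow>
   'a tapes \<Rightarrow> bool" where
  "ready u D e n x tb T \<longleftrightarrow> fresh u n T \<and> (\<forall>t\<ge>n. T (tab t) = blank_tape) \<and> (\<exists>b. T 1 = flag b) \<and>
     (\<forall>i. x i < n \<and> T (ptr (x i)) = (contents u, int (e i)) \<and> e i < length u) \<and>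
     (\<forall>t<length tb. fst (tb ! t) < n \<and> T (tab (fst (tb ! t))) = (tabc (length u) (snd (tb ! t)) (D t), 0)) \<and>
     (\<forall>t vs. D t vs \<longrightarrow> t < length tb \<and> length vs = snd (tb ! t) \<and> set vs \<subseteq> {..<length u})"

lemma ready_flag: "ready u D e n x tb T \<Longrightarrow> ready u D e n x tb (T(1 := flag b))"
  unfolding ready_def by (simp only: fresh_upd ptr_tab_simps One_nat_def not_False_eq_True
      fun_upd_other fun_upd_same) blast


lemma runs_in_put_store:
  assumes "fresh u n T" "T (tab n) = (tabc (length u) r X, 0)" "T 1 = flag f" "2 \<le> length u"
    and vs: "length vs = r" "set vs \<subseteq> {..<length u}"
  shows "runs_in (length u) (2 * goto_cost r + 4) (store (n + r) n [n..<n + r] b) (put u n vs T)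
    (put u n vs (T(1 := flag False, tab n := (tabc (length u) r (X(vs := b)), 0))))"
proof -
  let ?e = "\<lambda>y. vs ! (y - n)"
  have m: "map ?e [n..<n + r] = vs" using vs(1) by (intro nth_equalityI) auto
  have "runs_in (length u) (2 * goto_cost r + 4) (store (n + r) n [n..<n + r] b) (put u n vs T)
    ((put u n vs T)(1 := flag False, tab n := (tabc (length u) r (X(map ?e [n..<n + r] := b)), 0)))"
  proof (rule runs_in_store)
    show "fresh u (n + r) (put u n vs T)" using assms(1) vs by (simp add: fresh_put)
    show "y < n + r \<and> put u n vs T (ptr y) = (contents u, int (?e y)) \<and> ?e y < length u"
      if "y \<in> set [n..<n + r]" for y
    proof -
      have "vs ! (y - n) \<in> set vs" using that vs by auto
      then show ?thesis using that vs by (auto simp: put_ptr)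
    qed
  qed (use assms in auto)
  then show ?thesis unfolding m by (simp add: put_upd)
qed

lemma runs_in_erase:
  fixes T :: "'a tapes"
  assumes "fresh u n T" "T (tab n) = (tabc (length u) r X, 0)" "T 1 = flag f" "2 \<le> length u"
  shows "runs_in (length u) (2 * goto_cost r + 14 * r + 6) (erase n r) T (T(1 := flag False, tab n := blank_tape))"
proof -
  define S where "S X = T(1 := flag False, tab n := (tabc (length u) r X, 0))" for X
  let ?g = "\<lambda>vs X. X(vs := False)"
  have "T(1 := flag False) = S X" using assms(2) by (auto simp: S_def fun_eq_iff)
  then have 1: "runs_in (length u) 0 (set_flag (\<lambda>_. False)) T (S X)"
    using runs_in_set_flag[of "length u" T f 0 "\<lambda>_. False"] assms by simp
  have 2: "runs_in (length u) (2 * goto_cost r + 4 + 14 * r) (fors n r (store (n + r) n [n..<n + r] False))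
      (S X) (S (fold ?g (tuples r (length u)) X)) \<and> True"
  proof (rule runs_in_fors[where S = S and u = u and g = ?g and Inv = "\<lambda>_. True"])
    fix vs and X :: "nat list \<Rightarrow> bool"
    assume vs: "length vs = r" "set vs \<subseteq> {..<length u}"
    have fr: "fresh u n (S X)"
      using assms(1) unfolding S_def by (simp only: fresh_upd ptr_tab_simps One_nat_def not_False_eq_True)
    have "(S X)(1 := flag False, tab n := (tabc (length u) r (X(vs := False)), 0)) = S (X(vs := False))"
      by (auto simp: S_def fun_eq_iff)
    then show "runs_in (length u) (2 * goto_cost r + 4) (store (n + r) n [n..<n + r] False)
        (put u n vs (S X)) (put u n vs (S (X(vs := False)))) \<and> True"
      using runs_in_put_store[OF fr, of r X False vs False] vs assms(4) by (simp add: S_def)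
  qed (use assms in \<open>auto simp: S_def fresh_def\<close>)
  have "tabc (length u) r (fold ?g (tuples r (length u)) X) = (tabc (length u) r (\<lambda>_. False) :: int \<Rightarrow> 'a cell)"
    unfolding tabc_def fold_store_pred set_tuples by auto
  then have "S (fold ?g (tuples r (length u)) X) = T(1 := flag False, tab n := blank_tape)"
    unfolding S_def by (simp only: tabc_empty)
  moreover have "0 + (2 * goto_cost r + 4 + 14 * r) + 2 = 2 * goto_cost r + 14 * r + 6" by simp
  ultimately show ?thesis using runs_in_Seq[OF 1 conjunct1[OF 2] assms(4)] unfolding erase_def by metis
qed

lemma dp_range:
  "dp N r B vs \<Longrightarrow> length vs = r \<and> set vs \<subseteq> {..<N}"
proof -
  have "fold (\<lambda>vs X. if B X vs then X(vs := True) else X) xs X vs \<Longrightarrow> X vs \<or> vs \<in> set xs" for xs X vs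
    by (induction xs arbitrary: X) (fastforce split: if_splits)+
  then show "dp N r B vs \<Longrightarrow> length vs = r \<and> set vs \<subseteq> {..<N}"
    using set_tuples unfolding dp_def by blast
qed

text \<open>The exponent bounding the running time depends only on the compiled formula, not on the word.\<close>

lemma runs_in_compile:
  "\<exists>c. \<forall>u D e T. 2 \<le> length u \<longrightarrow> ready u D e n x tb T \<longrightarrow>
     runs_in (length u) c (compile n x tb f) T (T(1 := flag (eval u D e f)))"
proof (induction f arbitrary: n x tb)
  case (Chk A i)
  show ?case
  proof (intro exI allI impI)
    fix u :: "'a list" and D e T
    assume N: "2 \<le> length u" and r: "ready u D e n x tb T"
    obtain b where b: "T 1 = flag b" using r unfolding ready_def by blast
    have "reads T (ptr (x i)) = Input (u ! e i)"
      using r unfolding ready_def by (auto simp: reads_def contents_def)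
    moreover have "(Input (u ! e i) \<in> Input ` A) = (u ! e i \<in> A)" by auto
    ultimately show "runs_in (length u) 0 (compile n x tb (Chk A i)) T (T(1 := flag (eval u D e (Chk A i))))"
      using runs_in_set_flag[where T = T and b = b, OF N b, of 0 "\<lambda>r. r (ptr (x i)) \<in> Input ` A"] by auto
  qed
next
  case (Leq i j)
  show ?case
  proof (intro exI allI impI)
    fix u :: "'a list" and D e T
    assume N: "2 \<le> length u" and r: "ready u D e n x tb T"
    obtain b where b: "T 1 = flag b" using r unfolding ready_def by blast
    have x: "x i < n" "x j < n" "T (ptr (x i)) = (contents u, int (e i))" "T (ptr (x j)) = (contents u, int (e j))"
      "e i < length u" "e j < length u" "T (ptr n) = (contents u, 0)"
      using r unfolding ready_def fresh_def by auto
    show "runs_in (length u) 30 (compile n x tb (Leq i j)) T (T(1 := flag (eval u D e (Leq i j))))"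
      using runs_in_leq[OF x(3,4,7) b] x N by simp
  qed
next
  case (Rel t xs)
  show ?case
  proof (intro exI allI impI)
    fix u :: "'a list" and D e T
    assume N: "2 \<le> length u" and r: "ready u D e n x tb T"
    obtain b where b: "T 1 = flag b" using r unfolding ready_def by blast
    show "runs_in (length u) (2 * goto_cost (length xs) + 5) (compile n x tb (Rel t xs)) T
      (T(1 := flag (eval u D e (Rel t xs))))"
    proof (cases "t < length tb \<and> snd (tb ! t) = length xs")
      case True
      \<comment> \<open>\<open>runs_in_access\<close> wants values attached to pointers, not to
        variables. Variables sharing a pointer have equal values because its head has one position,
        so any preimage will do.\<close>
      define e' where "e' y = e (SOME i. x i = y)" for y
      have e': "e' (x i) = e i" for i
      proof -
        have "x (SOME j. x j = x i) = x i" by (rule someI) simp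
        then have "(contents u, int (e' (x i))) = (contents u, int (e i))"
          using r unfolding ready_def e'_def by metis
        then show ?thesis by simp
      qed
      have fr: "fresh u n T" and tab: "T (tab (fst (tb ! t))) = (tabc (length u) (length xs) (D t), 0)"
        using r True unfolding ready_def by auto
      have "runs_in (length u) (2 * goto_cost (length xs) + 5) (access n (fst (tb ! t)) (map x xs)) T
        (T(1 := flag (D t (map e' (map x xs)))))"
        by (rule runs_in_access[OF fr tab b N]) (use r e' in \<open>auto simp: ready_def\<close>)
      then show ?thesis using True e' by (simp add: comp_def)
    next
      case False
      \<comment> \<open>\<open>ready\<close> makes \<open>D\<close> false on unknown tables and on
        tuples of the wrong length, in agreement with the constant produced by
        \<open>compile\<close>.\<close>
      then have "\<not> D t (map e xs)" using r unfolding ready_def by fastforce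
      then show ?thesis using False runs_in_set_flag[where T = T and b = b, OF N b, of _ "\<lambda>_. False"] by auto
    qed
  qed
next
  case (Neg f)
  obtain c where c: "\<And>u D e T. 2 \<le> length u \<Longrightarrow> ready u D e n x tb T \<Longrightarrow>
     runs_in (length u) c (compile n x tb f) T (T(1 := flag (eval u D e f)))"
    using Neg.IH by blast
  show ?case
  proof (intro exI allI impI)
    fix u :: "'a list" and D e T
    assume N: "2 \<le> length u" and r: "ready u D e n x tb T"
    have "runs_in (length u) 0 (set_flag (\<lambda>r. r 1 = Blank)) (T(1 := flag (eval u D e f)))
      (T(1 := flag (eval u D e (Neg f))))"
      using runs_in_set_flag[OF N, of "T(1 := flag (eval u D e f))" "eval u D e f" 0 "\<lambda>r. r 1 = Blank"] by simp
    from runs_in_Seq[OF c[OF N r] this N]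
    show "runs_in (length u) (c + 0 + 2) (compile n x tb (Neg f)) T (T(1 := flag (eval u D e (Neg f))))"
      by (simp only: compile.simps)
  qed
next
  case (And f g)
  obtain c where c: "\<And>u D e T. 2 \<le> length u \<Longrightarrow> ready u D e n x tb T \<Longrightarrow>
     runs_in (length u) c (compile n x tb f) T (T(1 := flag (eval u D e f)))"
    using And.IH(1) by blast
  obtain d where d: "\<And>u D e T. 2 \<le> length u \<Longrightarrow> ready u D e n x tb T \<Longrightarrow>
     runs_in (length u) d (compile n x tb g) T (T(1 := flag (eval u D e g)))"
    using And.IH(2) by blast
  show ?case
  proof (intro exI allI impI)
    fix u :: "'a list" and D e T
    assume N: "2 \<le> length u" and r: "ready u D e n x tb T"
    let ?T = "T(1 := flag (eval u D e f))"
    have "runs_in (length u) (d + 1) (Cond (\<lambda>r. r 1 = Blank) Skip (compile n x tb g)) ?T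
      (T(1 := flag (eval u D e (And f g))))"
    proof (rule runs_in_Cond)
      assume "reads ?T 1 = Blank"
      then have "\<not> eval u D e f" by simp
      then have "T(1 := flag (eval u D e (And f g))) = ?T" by simp
      then show "runs_in (length u) d Skip ?T (T(1 := flag (eval u D e (And f g))))"
        using runs_in_Skip[OF N] by (simp only:)
    next
      assume "\<not> reads ?T 1 = Blank"
      then have "T(1 := flag (eval u D e (And f g))) = ?T(1 := flag (eval u D e g))" by simp
      then show "runs_in (length u) d (compile n x tb g) ?T (T(1 := flag (eval u D e (And f g))))"
        using d[OF N ready_flag[OF r]] by (simp only:)
    qed fact
    from runs_in_Seq[OF c[OF N r] this N]
    show "runs_in (length u) (c + (d + 1) + 2) (compile n x tb (And f g)) T (T(1 := flag (eval u D e (And f g))))"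
      by (simp only: compile.simps)
  qed
next
  case (Ex f)
  obtain c where c: "\<And>u D e T. 2 \<le> length u \<Longrightarrow> ready u D e (Suc n) (case_nat n x) tb T \<Longrightarrow>
     runs_in (length u) c (compile (Suc n) (case_nat n x) tb f) T (T(1 := flag (eval u D e f)))"
    using Ex.IH by blast
  show ?case
  proof (intro exI allI impI)
    fix u :: "'a list" and D e T
    assume N: "2 \<le> length u" and r: "ready u D e n x tb T"
    obtain b where b: "T 1 = flag b" using r unfolding ready_def by blast
    have n: "T (ptr n) = (contents u, 0)" using r unfolding ready_def fresh_def by auto
    have "runs_in (length u) (c + 16) (Search (ptr n) (compile (Suc n) (case_nat n x) tb f)) T
      (T(1 := flag (\<exists>v<length u. eval u D (case_nat v e) f)))"
    proof (rule runs_in_Search[OF _ N _ n b])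
      fix v assume v: "v < length u"
      let ?T = "T(ptr n := (contents u, int v), 1 := flag False)"
      have "ready u D (case_nat v e) (Suc n) (case_nat n x) tb ?T"
        unfolding ready_def
      proof (intro conjI allI impI)
        show "fresh u (Suc n) ?T" using r unfolding ready_def fresh_def by simp
        show "\<exists>b. ?T 1 = flag b" by auto
        show "?T (tab t) = blank_tape" if "Suc n \<le> t" for t
          using that r unfolding ready_def by simp
        fix i
        have xi: "x j < n" "T (ptr (x j)) = (contents u, int (e j))" "e j < length u" for j
          using r unfolding ready_def by auto
        show "case_nat n x i < Suc n" using xi(1) by (cases i) (auto intro: less_SucI)
        show "?T (ptr (case_nat n x i)) = (contents u, int (case_nat v e i))"
          using xi less_not_refl by (cases i) auto
        show "case_nat v e i < length u" using v xi(3) by (cases i) auto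
      next
        fix t assume t: "t < length tb"
        then show "fst (tb ! t) < Suc n" using r unfolding ready_def by (auto intro: less_SucI)
        show "?T (tab (fst (tb ! t))) = (tabc (length u) (snd (tb ! t)) (D t), 0)"
          using t r unfolding ready_def by simp
      next
        fix t vs assume "D t vs"
        then show "t < length tb" "length vs = snd (tb ! t)" "set vs \<subseteq> {..<length u}"
          using r unfolding ready_def by blast+
      qed
      then show "runs_in (length u) c (compile (Suc n) (case_nat n x) tb f) ?T
          (T(ptr n := (contents u, int v), 1 := flag (eval u D (case_nat v e) f)))"
        using c[OF N] by (metis fun_upd_upd)
    qed simp
    then show "runs_in (length u) (c + 16) (compile n x tb (Ex f)) T (T(1 := flag (eval u D e (Ex f))))"
      by simp
  qed
next
  case (Fix r f js)
  let ?x = "\<lambda>i. if i < r then n + i else x (i - r)"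
  obtain c where c: "\<And>u D e T. 2 \<le> length u \<Longrightarrow> ready u D e (Suc (n + r)) ?x ((n, r) # tb) T \<Longrightarrow>
     runs_in (length u) c (compile (Suc (n + r)) ?x ((n, r) # tb) f) T (T(1 := flag (eval u D e f)))"
    using Fix.IH by blast
  let ?g = "2 * goto_cost r"
  show ?case
  proof (intro exI allI impI)
    fix u :: "'a list" and D e T
    assume N: "2 \<le> length u" and rdy: "ready u D e n x tb T"
    let ?N = "length u"
    define B where "B X vs = eval u (case_nat X D) (\<lambda>i. if i < r then vs ! i else e (i - r)) f" for X vs
    define g where "g vs X = (if B X vs then X(vs := True) else X)" for vs X
    define R where "R = dp ?N r B"
    define S where "S X = T(1 := flag False, tab n := (tabc ?N r X, 0))" for X
    \<comment> \<open>\<open>ready\<close> demands that tables contain only tuples of positions of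
      the right length, so this has to be carried through the loops.\<close>
    define Inv where "Inv X \<longleftrightarrow> (\<forall>vs. X vs \<longrightarrow> length vs = r \<and> set vs \<subseteq> {..<?N})" for X
    let ?body = "Seq (compile (Suc (n + r)) ?x ((n, r) # tb) f)
        (Cond (\<lambda>r. r 1 = Blank) Skip (store (n + r) n [n..<n + r] True))"
    obtain b where b: "T 1 = flag b" using rdy unfolding ready_def by blast
    have frT: "fresh u n T" using rdy unfolding ready_def by blast
    have frS: "fresh u n (S X)" for X
      using frT unfolding S_def by (simp only: fresh_upd ptr_tab_simps One_nat_def not_False_eq_True)
    have S0: "S (\<lambda>_. False) = T(1 := flag False)"
      using rdy unfolding S_def tabc_empty ready_def by (auto simp: fun_eq_iff)
    have 1: "runs_in ?N 0 (set_flag (\<lambda>_. False)) T (S (\<lambda>_. False))"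
      unfolding S0 using runs_in_set_flag[where T = T and b = b, OF N b] by blast
    have body: "runs_in ?N (c + (?g + 4 + 1) + 2) ?body (put u n vs (S X)) (put u n vs (S (g vs X))) \<and> Inv (g vs X)"
      if vs: "length vs = r" "set vs \<subseteq> {..<?N}" and X: "Inv X" for vs X
    proof
      let ?P = "put u n vs (S X)"
      have vi: "i < r \<Longrightarrow> vs ! i < ?N" for i using vs nth_mem by (metis lessThan_iff subset_iff)
      have rb: "ready u (case_nat X D) (\<lambda>i. if i < r then vs ! i else e (i - r)) (Suc (n + r)) ?x ((n, r) # tb) ?P"
        unfolding ready_def
      proof (intro conjI allI impI)
        show "fresh u (Suc (n + r)) ?P" using frS vs by (simp add: fresh_put)
        show "\<exists>b. ?P 1 = flag b" by (auto simp: S_def)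
        show "?P (tab t) = blank_tape" if "Suc (n + r) \<le> t" for t
          using that rdy unfolding ready_def by (simp add: S_def)
        show "?x i < Suc (n + r)" for i using rdy unfolding ready_def by (auto simp: less_Suc_eq trans_less_add1)
        show "?P (ptr (?x i)) = (contents u, int (if i < r then vs ! i else e (i - r)))" for i
        proof (cases "i < r")
          case True
          then show ?thesis using vs by (simp add: put_ptr)
        next
          case False
          have "x (i - r) < n" "T (ptr (x (i - r))) = (contents u, int (e (i - r)))"
            using rdy unfolding ready_def by auto
          then show ?thesis using False by (simp add: put_ptr S_def)
        qed
        show "(if i < r then vs ! i else e (i - r)) < ?N" for i
          using vi rdy unfolding ready_def by simp
        fix t assume t: "t < length ((n, r) # tb)"
        show "fst (((n, r) # tb) ! t) < Suc (n + r)"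
          using t rdy unfolding ready_def by (cases t) (auto simp: less_Suc_eq trans_less_add1)
        show "?P (tab (fst (((n, r) # tb) ! t))) = (tabc ?N (snd (((n, r) # tb) ! t)) (case t of 0 \<Rightarrow> X | Suc t \<Rightarrow> D t), 0)"
        proof (cases t)
          case (Suc s)
          then have "fst (tb ! s) < n" "T (tab (fst (tb ! s))) = (tabc ?N (snd (tb ! s)) (D s), 0)"
            using t rdy unfolding ready_def by auto
          then show ?thesis using Suc by (simp add: S_def)
        qed (simp add: S_def)
      next
        fix t vs assume "(case t of 0 \<Rightarrow> X | Suc t \<Rightarrow> D t) vs"
        then show "t < length ((n, r) # tb)" "length vs = snd (((n, r) # tb) ! t)" "set vs \<subseteq> {..<?N}"
          using X rdy unfolding ready_def Inv_def by (cases t; fastforce)+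
      qed
      have a1: "runs_in ?N c (compile (Suc (n + r)) ?x ((n, r) # tb) f) ?P (?P(1 := flag (B X vs)))"
        using c[OF N rb] unfolding B_def .
      have a2: "runs_in ?N (?g + 4 + 1) (Cond (\<lambda>r. r 1 = Blank) Skip (store (n + r) n [n..<n + r] True))
        (?P(1 := flag (B X vs))) (put u n vs (S (g vs X)))"
      proof (rule runs_in_Cond)
        assume "reads (?P(1 := flag (B X vs))) 1 = Blank"
        then have nb: "\<not> B X vs" by simp
        then have "?P(1 := flag (B X vs)) = put u n vs (S (g vs X))"
          by (auto simp: fun_eq_iff g_def S_def)
        then show "runs_in ?N (?g + 4) Skip (?P(1 := flag (B X vs))) (put u n vs (S (g vs X)))"
          using runs_in_Skip[OF N] by (simp only:)
      next
        assume "\<not> reads (?P(1 := flag (B X vs))) 1 = Blank"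
        then have bt: "B X vs" by simp
        let ?S = "(S X)(1 := flag True)"
        have frs: "fresh u n ?S" using frS[of X] by (simp only: fresh_upd ptr_tab_simps One_nat_def not_False_eq_True)
        have e1: "?P(1 := flag (B X vs)) = put u n vs ?S" using bt by (simp add: put_upd)
        have e2: "?S(1 := flag False, tab n := (tabc ?N r (X(vs := True)), 0)) = S (g vs X)"
          using bt by (auto simp: fun_eq_iff g_def S_def)
        have t: "?S (tab n) = (tabc ?N r X, 0)" by (simp add: S_def)
        have "runs_in ?N (?g + 4) (store (n + r) n [n..<n + r] True) (put u n vs ?S) (put u n vs (S (g vs X)))"
          unfolding e2[symmetric] by (rule runs_in_put_store[OF frs t _ N vs, of True]) simp
        then show "runs_in ?N (?g + 4) (store (n + r) n [n..<n + r] True) (?P(1 := flag (B X vs))) (put u n vs (S (g vs X)))"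
          unfolding e1 .
      qed fact
      show "runs_in ?N (c + (?g + 4 + 1) + 2) ?body ?P (put u n vs (S (g vs X)))"
        by (rule runs_in_Seq[OF a1 a2 N])
      show "Inv (g vs X)" using X vs by (auto simp: Inv_def g_def)
    qed
    have 2: "runs_in ?N (c + (?g + 4 + 1) + 2 + 14 * r) (fors n r ?body) (S (\<lambda>_. False)) (S R)"
    proof -
      have "runs_in ?N (c + (?g + 4 + 1) + 2 + 14 * r) (fors n r ?body) (S (\<lambda>_. False))
        (S (fold g (tuples r ?N) (\<lambda>_. False))) \<and> Inv (fold g (tuples r ?N) (\<lambda>_. False))"
      proof (rule runs_in_fors[where S = S and u = u and g = g and Inv = Inv])
        show "S X (ptr i) = (contents u, 0)" if "n \<le> i" for X i
          using frS[of X] that unfolding fresh_def by blast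
        show "Inv (\<lambda>_. False)" by (simp add: Inv_def)
      qed (fact body N)+
      moreover have "fold g (tuples r ?N) (\<lambda>_. False) = R"
        unfolding R_def dp_def g_def[abs_def] by simp
      ultimately show ?thesis by simp
    qed
    let ?S = "(S R)(1 := flag (R (map e js)))"
    have 3: "runs_in ?N (?g + 5) (if length js = r then access (n + r) n (map x js) else set_flag (\<lambda>_. False)) (S R) ?S"
    proof (cases "length js = r")
      case True
      define e' where "e' y = e (SOME i. x i = y)" for y
      have e': "e' (x i) = e i" for i
      proof -
        have "x (SOME j. x j = x i) = x i" by (rule someI) simp
        then have "(contents u, int (e' (x i))) = (contents u, int (e i))"
          using rdy unfolding ready_def e'_def by metis
        then show ?thesis by simp
      qed
      have "fresh u (n + r) (S R)" using frS fresh_mono by (metis le_add1)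
      then have "runs_in ?N (?g + 5) (access (n + r) n (map x js)) (S R) ((S R)(1 := flag (R (map e' (map x js)))))"
        by (rule runs_in_access[where f = False]) (use rdy e' N True in \<open>auto simp: ready_def S_def trans_less_add1\<close>)
      then show ?thesis using True e' by (simp add: comp_def)
    next
      case False
      then have "\<not> R (map e js)" using dp_range unfolding R_def by fastforce
      then show ?thesis using False runs_in_set_flag[OF N, of "S R" False _ "\<lambda>_. False"] by (simp add: S_def)
    qed
    let ?F = "T(1 := flag (R (map e js)))"
    have fr: "fresh u n ?S" using frS[of R] by (simp only: fresh_upd ptr_tab_simps One_nat_def not_False_eq_True)
    have er: "runs_in ?N (?g + 14 * r + 6) (erase n r) ?S (?S(1 := flag False, tab n := blank_tape))"
      by (rule runs_in_erase[OF fr, where X = R]) (use N in \<open>auto simp: S_def\<close>)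
    have eq: "?S(1 := flag False, tab n := blank_tape) = T(1 := flag False)"
      using rdy unfolding ready_def by (auto simp: S_def fun_eq_iff)
    have fin: "runs_in ?N (?g + 14 * r + 6 + 0 + 2) (Seq (erase n r) (set_flag (\<lambda>_. b))) ?S (T(1 := flag b))" for b
    proof (rule runs_in_Seq[OF er[unfolded eq] _ N])
      show "runs_in ?N 0 (set_flag (\<lambda>_. b)) (T(1 := flag False)) (T(1 := flag b))"
        using runs_in_set_flag[OF N, of "T(1 := flag False)" False 0 "\<lambda>_. b"] by simp
    qed
    have 4: "runs_in ?N (?g + 14 * r + 6 + 0 + 2 + 1) (Cond (\<lambda>r. r 1 = Blank) (Seq (erase n r) (set_flag (\<lambda>_. False)))
           (Seq (erase n r) (set_flag (\<lambda>_. True)))) ?S ?F"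
    proof (rule runs_in_Cond)
      assume "reads ?S 1 = Blank"
      then have "R (map e js) = False" by simp
      then show "runs_in ?N (?g + 14 * r + 6 + 0 + 2) (Seq (erase n r) (set_flag (\<lambda>_. False))) ?S ?F"
        using fin[of False] by (simp only:)
    next
      assume "\<not> reads ?S 1 = Blank"
      then have "R (map e js) = True" by simp
      then show "runs_in ?N (?g + 14 * r + 6 + 0 + 2) (Seq (erase n r) (set_flag (\<lambda>_. True))) ?S ?F"
        using fin[of True] by (simp only:)
    qed fact
    have "eval u D e (Fix r f js) = R (map e js)"
      by (simp add: R_def B_def[abs_def])
    then show "runs_in ?N (0 + (c + (?g + 4 + 1) + 2 + 14 * r + (?g + 5 + (?g + 14 * r + 6 + 0 + 2 + 1) + 2) + 2) + 2)
      (compile n x tb (Fix r f js)) T (T(1 := flag (eval u D e (Fix r f js))))"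
      using runs_in_Seq[OF 1 runs_in_Seq[OF 2 runs_in_Seq[OF 3 4 N] N] N] by (simp only: compile.simps)
  qed
qed

section \<open>Copying the padded word to the pointer tapes\<close>

fun write_list :: "nat \<Rightarrow> 'a list \<Rightarrow> 'a prog" where
  "write_list i [] = Skip"
| "write_list i (a # as) = Seq (put_cell i (Input a) MRight) (write_list i as)"

text \<open>A tape has a single head, so every position variable needs its own copy of the word. The
  fixed padding is written by the program itself.\<close>

definition copy_input :: "'a list \<Rightarrow> 'a \<Rightarrow> nat \<Rightarrow> 'a prog" where
  "copy_input pre z i = Seq (write_list i pre)
     (Seq (While (\<lambda>r. r 0 \<noteq> Blank) (Seq (Act i (\<lambda>r. (r 0, MRight))) (mv 0 MRight)))
     (Seq (put_cell i (Input z) MStay) (Seq (rewind i) (rewind 0))))"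

fun copies :: "'a list \<Rightarrow> 'a \<Rightarrow> nat \<Rightarrow> 'a prog" where
  "copies pre z 0 = Skip"
| "copies pre z (Suc m) = Seq (copies pre z m) (copy_input pre z (ptr m))"

lemma bounded_copies: "bounded_prog (copies pre z m)"
proof -
  have "bounded_prog (write_list i as)" for i and as :: "'a list"
    by (induction as) (auto intro!: bounded_Seq simp: cells_def)
  moreover have "bounded_prog (Act i (\<lambda>r. (r 0, MRight)))" for i
    by (rule bounded_Act[of 1]) (auto simp: local_on_def)
  ultimately have "bounded_prog (copy_input pre z i)" for i
    unfolding copy_input_def by (auto intro!: bounded_Seq bounded_While simp: cells_def)
  then show ?thesis by (induction m) auto
qed

lemma contents_snoc: "(contents s)(int (length s) := Input a) = contents (s @ [a])"
  by (auto simp: contents_def fun_eq_iff nth_append)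

lemma contents_nil: "(contents [], 0) = blank_tape"
  by (auto simp: contents_def blank_tape_def fun_eq_iff)

lemma runs_in_write_list:
  assumes "T i = (contents s, int (length s))" "2 \<le> N"
  shows "runs_in N (2 * length as) (write_list i as) T (T(i := (contents (s @ as), int (length (s @ as)))))"
  using assms(1)
proof (induction as arbitrary: s T)
  case Nil
  then show ?case using runs_in_Skip[OF assms(2)] by (simp add: fun_upd_idem)
next
  case (Cons a as)
  let ?T = "T(i := (contents (s @ [a]), int (length (s @ [a]))))"
  have 1: "runs_in N 0 (put_cell i (Input a) MRight) T ?T"
    using runs_in_put_cell[OF assms(2), of T i "contents s" "int (length s)" 0 "Input a" MRight] Cons.prems
    by (simp add: contents_snoc add.commute)
  have 2: "runs_in N (2 * length as) (write_list i as) ?T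
      (?T(i := (contents ((s @ [a]) @ as), int (length ((s @ [a]) @ as)))))"
    by (rule Cons.IH) simp
  have e: "(s @ [a]) @ as = s @ a # as" "0 + 2 * length as + 2 = 2 * length (a # as)" by simp_all
  show ?case using runs_in_Seq[OF 1 2[unfolded fun_upd_upd e] assms(2)] unfolding write_list.simps e .
qed

lemma runs_in_copy_input:
  fixes pre w :: "'a list" and z :: 'a
  defines "u \<equiv> pre @ w @ [z]"
  assumes T: "T i = blank_tape" "T 0 = input_tape w" and i: "i \<noteq> 0" and pre: "pre \<noteq> []"
  shows "runs_in (length u) (2 * length pre + 31) (copy_input pre z i) T (T(i := (contents u, 0)))"
proof -
  let ?N = "length u" let ?l = "length pre"
  have N: "2 \<le> ?N" using pre unfolding u_def by (cases pre) auto
  define S where "S v = T(i := (contents (pre @ take v w), int (?l + v)), 0 := (contents w, int v))" for v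
  have T0: "T 0 = (contents w, 0)" using T(2) by (simp add: input_tape_def contents_def)
  have "T(i := (contents ([] @ pre), int (length ([] @ pre)))) = S 0"
    using T0 i by (auto simp: S_def fun_eq_iff)
  then have 1: "runs_in ?N (2 * ?l) (write_list i pre) T (S 0)"
    using runs_in_write_list[of T i "[]" ?N pre] T(1) N by (simp add: contents_nil)
  have 2: "runs_in ?N (0 + 0 + 2 + 3) (While (\<lambda>r. r 0 \<noteq> Blank)
      (Seq (Act i (\<lambda>r. (r 0, MRight))) (mv 0 MRight))) (S 0) (S (length w))"
  proof (rule runs_in_While)
    fix v assume v: "v < length w"
    let ?A = "T(i := (contents (pre @ take (Suc v) w), int (?l + Suc v)), 0 := (contents w, int v))"
    have r: "reads (S v) 0 = Input (w ! v)" using v i by (simp add: S_def contents_def)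
    have "(contents (pre @ take v w))(int (length (pre @ take v w)) := Input (w ! v)) =
      contents (pre @ take (Suc v) w)"
      unfolding contents_snoc using v by (simp add: take_Suc_conv_app_nth)
    then have "tape_act (reads (S v) 0, MRight) (S v i) = (contents (pre @ take (Suc v) w), int (?l + Suc v))"
      unfolding r using v i by (simp add: S_def)
    then have "(S v)(i := tape_act (reads (S v) 0, MRight) (S v i)) = ?A"
      using i by (auto simp: S_def fun_eq_iff)
    then have a: "runs_in ?N 0 (Act i (\<lambda>r. (r 0, MRight))) (S v) ?A"
      using runs_in_Act[OF N, of 0 i "\<lambda>r. (r 0, MRight)" "S v"] by simp
    have b: "runs_in ?N 0 (mv 0 MRight) ?A (S (Suc v))"
      using runs_in_mv[OF N, of ?A 0 "contents w" "int v" 0 MRight] by (simp add: S_def add.commute)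
    show "reads (S v) 0 \<noteq> Blank \<and> runs_in ?N (0 + 0 + 2) (Seq (Act i (\<lambda>r. (r 0, MRight))) (mv 0 MRight)) (S v) (S (Suc v))"
      using runs_in_Seq[OF a b N] r by simp
  qed (use N in \<open>auto simp: S_def u_def reads_def\<close>)
  let ?B = "T(0 := (contents w, int (length w)), i := (contents u, int (?l + length w)))"
  have 3: "runs_in ?N 0 (put_cell i (Input z) MStay) (S (length w)) ?B"
  proof -
    have "contents u = (contents (pre @ w))(int (length (pre @ w)) := Input z)"
      unfolding contents_snoc u_def by simp
    then have "(S (length w))(i := ((contents (pre @ w))(int (length (pre @ w)) := Input z),
       int (length (pre @ w)) + offset MStay)) = ?B"
      using i by (auto simp: S_def fun_eq_iff)
    then show ?thesis
      using runs_in_put_cell[OF N, of "S (length w)" i "contents (pre @ w)" "int (length (pre @ w))" 0 "Input z" MStay] i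
      by (simp add: S_def)
  qed
  let ?C = "T(0 := (contents w, int (length w)), i := (contents u, 0))"
  have 4: "runs_in ?N 7 (rewind i) ?B ?C"
    using runs_in_rewind[of ?B i u "?l + length w" ?N] N by (simp add: u_def)
  have "?C(0 := (contents w, 0)) = T(i := (contents u, 0))"
    using i T0 by (auto simp: fun_eq_iff)
  then have 5: "runs_in ?N 7 (rewind 0) ?C (T(i := (contents u, 0)))"
    using runs_in_rewind[of ?C 0 w "length w" ?N] N i by (simp add: u_def)
  have "2 * ?l + (0 + 0 + 2 + 3 + (0 + (7 + 7 + 2) + 2) + 2) + 2 \<le> 2 * ?l + 31" by simp
  then show ?thesis
    using runs_in_mono[OF runs_in_Seq[OF 1 runs_in_Seq[OF 2 runs_in_Seq[OF 3 runs_in_Seq[OF 4 5 N] N] N] N]] N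
    unfolding copy_input_def by blast
qed

lemma runs_in_copies:
  fixes pre w :: "'a list" and z :: 'a
  defines "u \<equiv> pre @ w @ [z]"
  assumes pre: "pre \<noteq> []"
  shows "runs_in (length u) ((2 * length pre + 33) * m) (copies pre z m) (start_tapes w)
    (\<lambda>k. if \<exists>i<m. k = ptr i then (contents u, 0) else start_tapes w k)"
proof (induction m)
  case 0
  have "2 \<le> length u" using pre unfolding u_def by (cases pre) auto
  then show ?case using runs_in_Skip by simp
next
  case (Suc m)
  let ?T = "\<lambda>k. if \<exists>i<m. k = ptr i then (contents u, 0) else start_tapes w k"
  have N: "2 \<le> length u" using pre unfolding u_def by (cases pre) auto
  have "runs_in (length u) (2 * length pre + 31) (copy_input pre z (ptr m)) ?T (?T(ptr m := (contents u, 0)))"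
    unfolding u_def by (rule runs_in_copy_input) (use pre in \<open>auto simp: start_tapes_def\<close>)
  moreover have "?T(ptr m := (contents u, 0)) =
      (\<lambda>k. if \<exists>i<Suc m. k = ptr i then (contents u, 0) else start_tapes w k)"
    by (auto simp: fun_eq_iff less_Suc_eq)
  ultimately have "runs_in (length u) ((2 * length pre + 33) * m + (2 * length pre + 31) + 2) (copies pre z (Suc m))
      (start_tapes w) (\<lambda>k. if \<exists>i<Suc m. k = ptr i then (contents u, 0) else start_tapes w k)"
    using runs_in_Seq[OF Suc _ N, of "2 * length pre + 31" "copy_input pre z (ptr m)"] by simp
  then show ?case by (simp add: algebra_simps)
qed

text \<open>A nonempty \<open>pre\<close> together with \<open>z\<close> makes the padded word at
  least two symbols long, as the bounds by powers of its length require.\<close>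

theorem sentence_PTIME:
  fixes f :: "'a::finite fm"
  assumes pre: "pre \<noteq> []"
  shows "{w. eval (pre @ w @ [z]) (\<lambda>_ _. False) (\<lambda>_. 0) f} \<in> PTIME"
proof -
  let ?q = "compile 1 (\<lambda>_. 0) [] f"
  obtain k0 where "wf_prog k0 ?q" using bounded_compile unfolding bounded_prog_def by blast
  then obtain k where k: "wf_prog k ?q" "1 < k" by (meson wf_prog_mono nat_le_linear lessI less_le_trans max.cobounded1 max.cobounded2 Suc_leI)
  let ?p = "Seq (copies pre z k) ?q"
  obtain l where l: "wf_prog l ?p"
    using bounded_Seq[OF bounded_copies[of pre z k] bounded_compile[of 1 "\<lambda>_. 0" "[]" f]]
    unfolding bounded_prog_def by (elim exE)
  obtain c where c: "\<And>u D e T. 2 \<le> length u \<Longrightarrow> ready u D e 1 (\<lambda>_. 0) [] T \<Longrightarrow>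
     runs_in (length u) c ?q T (T(1 := flag (eval u D e f)))"
    using runs_in_compile[of 1 "\<lambda>_. 0" "[]" f] by blast
  let ?d = "(2 * length pre + 33) * k + c + 2"
  \<comment> \<open>The linear polynomial gives the length of \<open>pre @ w @ [z]\<close> in terms
    of the length of \<open>w\<close>.\<close>
  let ?P = "[:length pre + 1, 1:] ^ ?d :: nat poly"
  show ?thesis
  proof (rule prog_decides_PTIME[OF l, where P = ?P])
    fix w
    define u where "u = pre @ w @ [z]"
    have N: "2 \<le> length u" using pre unfolding u_def by (cases pre) auto
    let ?T = "\<lambda>j. if \<exists>i<k. j = ptr i then (contents u, 0) else start_tapes w j"
    \<comment> \<open>\<open>ready\<close> asks for the word on all pointer tapes, but only the
      first \<open>k\<close> of them can be prepared. Since \<open>ptr i\<close> exceeds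
      \<open>i\<close>, both assignments agree on the tapes below \<open>k\<close>, and these are
      all that the compiled program can see.\<close>
    let ?V = "\<lambda>j. if \<exists>i. j = ptr i then (contents u, 0) else start_tapes w j"
    let ?b = "eval u (\<lambda>_ _. False) (\<lambda>_. 0) f"
    have 1: "runs_in (length u) ((2 * length pre + 33) * k) (copies pre z k) (start_tapes w) ?T"
      unfolding u_def by (rule runs_in_copies[OF pre])
    have "ready u (\<lambda>_ _. False) (\<lambda>_. 0) 1 (\<lambda>_. 0) [] ?V"
      using N by (auto simp: ready_def fresh_def start_tapes_def flag_def blank_tape_def intro!: exI[of _ False])
    then obtain t where t: "t \<le> length u ^ c" "runs ?q ?V t (?V(1 := flag ?b))"
      using c[OF N] unfolding runs_in_def by blast
    have "(\<exists>i. j = ptr i) = (\<exists>i<k. j = ptr i)" if "j < k" for j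
      using that by (auto simp: ptr_def)
    then have "\<forall>j<k. ?V j = ?T j" by simp
    from runs_local[OF t(2) k(1) this] obtain V where
      V: "runs ?q ?T t V" "\<forall>j<k. (?V(1 := flag ?b)) j = V j" by blast
    have 2: "runs_in (length u) c ?q ?T V" using t(1) V(1) unfolding runs_in_def by blast
    obtain s where s: "s \<le> length u ^ ?d" "runs ?p (start_tapes w) s V"
      using runs_in_Seq[OF 1 2 N] unfolding runs_in_def by (metis add.assoc)
    have "V 1 = flag ?b" using V(2)[rule_format, of 1] k(2) by simp
    then have "reads V 1 \<noteq> Blank \<longleftrightarrow> w \<in> {w. eval (pre @ w @ [z]) (\<lambda>_ _. False) (\<lambda>_. 0) f}"
      by (simp add: reads_def u_def)
    moreover have "length u ^ ?d = poly ?P (length w)"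
      by (simp only: poly_power) (simp add: u_def add_ac)
    ultimately show "\<exists>t T'. t \<le> poly ?P (length w) \<and> runs ?p (start_tapes w) t T' \<and>
        (reads T' 1 \<noteq> Blank \<longleftrightarrow> w \<in> {w. eval (pre @ w @ [z]) (\<lambda>_ _. False) (\<lambda>_. 0) f})"
      using s by metis
  qed
qed

section \<open>Definable relations on words\<close>

type_synonym 'a pred = "'a list \<Rightarrow> (nat \<Rightarrow> nat list \<Rightarrow> bool) \<Rightarrow> (nat \<Rightarrow> nat) \<Rightarrow> bool"

text \<open>One formula must serve all words of \<open>U\<close>, all assignments of positions and
  all tables. Keeping \<open>D\<close> as an argument of the predicate allows the body of a
  recursion to be called definable before its table is bound.\<close>

definition definable :: "'a list set \<Rightarrow> 'a pred \<Rightarrow> bool" where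
  "definable U P \<longleftrightarrow>
     (\<exists>f. \<forall>u\<in>U. \<forall>D e. (\<forall>i. e i < length u) \<longrightarrow> eval u D e f = P u D e)"

lemma definableI:
  "(\<And>u D e. u \<in> U \<Longrightarrow> \<forall>i. e i < length u \<Longrightarrow> eval u D e f = P u D e) \<Longrightarrow> definable U P"
  unfolding definable_def by blast

lemma definable_cong:
  assumes "definable U P"
    and "\<And>u D e. u \<in> U \<Longrightarrow> \<forall>i. e i < length u \<Longrightarrow> P u D e = Q u D e"
  shows "definable U Q"
  using assms unfolding definable_def by metis

lemma definable_Chk: "definable U (\<lambda>u D e. u ! e i \<in> A)"
  by (rule definableI[where f = "Chk A i"]) simp

lemma definable_le: "definable U (\<lambda>u D e. e i \<le> e j)"
  by (rule definableI[where f = "Leq i j"]) simp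

lemma definable_Rel: "definable U (\<lambda>u D e. D t (map e is))"
  by (rule definableI[where f = "Rel t is"]) simp

lemma definable_not: "definable U P \<Longrightarrow> definable U (\<lambda>u D e. \<not> P u D e)"
  unfolding definable_def by (metis eval.simps(4))

lemma definable_conj: "definable U P \<Longrightarrow> definable U Q \<Longrightarrow> definable U (\<lambda>u D e. P u D e \<and> Q u D e)"
  unfolding definable_def by (metis eval.simps(5))

text \<open>The premise is the body with the bound position as variable 0 and all others shifted by
  one. In this form higher-order unification can match it, and definability follows by
  \<open>intro\<close> from the mere shape of a statement.\<close>

lemma definable_ex:
  fixes P :: "'a list \<Rightarrow> (nat \<Rightarrow> nat list \<Rightarrow> bool) \<Rightarrow> (nat \<Rightarrow> nat) \<Rightarrow> nat \<Rightarrow> bool"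
  assumes "definable U (\<lambda>u D e. P u D (\<lambda>i. e (Suc i)) (e 0))"
  shows "definable U (\<lambda>u D e. \<exists>y<length u. P u D e y)"
proof -
  obtain f where f: "\<And>u D e. u \<in> U \<Longrightarrow> \<forall>i. e i < length u \<Longrightarrow>
      eval u D e f = P u D (\<lambda>i. e (Suc i)) (e 0)"
    using assms unfolding definable_def by blast
  show ?thesis
  proof (rule definableI)
    fix u D and e :: "nat \<Rightarrow> nat" assume u: "u \<in> U" "\<forall>i. e i < length u"
    have "eval u D (case_nat y e) f = P u D e y" if "y < length u" for y
      using f[of u "case_nat y e" D] u that by (simp split: nat.split)
    then show "eval u D e (Ex f) = (\<exists>y<length u. P u D e y)" by auto
  qed
qed

lemma definable_const: "definable U (\<lambda>u D e. b)"
proof -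
  have "definable U (\<lambda>u D e. e 0 \<le> e 0)" by (rule definable_le)
  then show ?thesis using definable_not[of U "\<lambda>u D e. e 0 \<le> e 0"] by (cases b) auto
qed

lemma definable_disj: "definable U P \<Longrightarrow> definable U Q \<Longrightarrow> definable U (\<lambda>u D e. P u D e \<or> Q u D e)"
  unfolding disj_conj_distribL de_Morgan_conj[of "\<not> _" "\<not> _", unfolded not_not, symmetric]
  by (intro definable_not definable_conj)

lemma definable_imp: "definable U P \<Longrightarrow> definable U Q \<Longrightarrow> definable U (\<lambda>u D e. P u D e \<longrightarrow> Q u D e)"
  unfolding imp_conv_disj by (intro definable_disj definable_not)

lemma definable_iff: "definable U P \<Longrightarrow> definable U Q \<Longrightarrow> definable U (\<lambda>u D e. P u D e \<longleftrightarrow> Q u D e)"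
  unfolding iff_conv_conj_imp by (intro definable_conj definable_imp)

lemma definable_all:
  fixes P :: "'a list \<Rightarrow> (nat \<Rightarrow> nat list \<Rightarrow> bool) \<Rightarrow> (nat \<Rightarrow> nat) \<Rightarrow> nat \<Rightarrow> bool"
  assumes "definable U (\<lambda>u D e. P u D (\<lambda>i. e (Suc i)) (e 0))"
  shows "definable U (\<lambda>u D e. \<forall>y<length u. P u D e y)"
  using definable_not[OF definable_ex[OF definable_not[OF assms]]] by simp

lemma definable_Ball:
  assumes "finite A" "\<And>a. a \<in> A \<Longrightarrow> definable U (\<lambda>u D e. P u D e a)"
  shows "definable U (\<lambda>u D e. \<forall>a\<in>A. P u D e a)"
  using assms
proof (induction A rule: finite_induct)
  case (insert x F)
  then have "definable U (\<lambda>u D e. P u D e x \<and> (\<forall>a\<in>F. P u D e a))"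
    by (intro definable_conj) auto
  then show ?case by simp
qed (simp add: definable_const)

lemma definable_Bex:
  assumes "finite A" "\<And>a. a \<in> A \<Longrightarrow> definable U (\<lambda>u D e. P u D e a)"
  shows "definable U (\<lambda>u D e. \<exists>a\<in>A. P u D e a)"
  using definable_not[OF definable_Ball[OF assms(1) definable_not[OF assms(2)]]] by simp

text \<open>A table filled in lexicographic order satisfies any recursion whose calls decrease the first
  coordinate.\<close>

lemma dp_eq:
  assumes "0 < r"
    and step: "\<And>X vs. length vs = r \<Longrightarrow> set vs \<subseteq> {..<N} \<Longrightarrow>
      (\<And>ws. length ws = r \<Longrightarrow> set ws \<subseteq> {..<N} \<Longrightarrow> hd ws < hd vs \<Longrightarrow> X ws = P ws) \<Longrightarrow> B X vs = P vs"
    and ws: "length ws = r" "set ws \<subseteq> {..<N}"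
  shows "dp N r B ws = P ws"
proof -
  obtain s where r: "r = Suc s" using assms(1) by (cases r) auto
  define g where "g vs X = (if B X vs then X(vs := True) else X)" for vs X
  define blk where "blk v = map ((#) v) (tuples s N)" for v
  have set_blk: "set (blk v) = {vs. length vs = r \<and> set (tl vs) \<subseteq> {..<N} \<and> hd vs = v}" for v
    unfolding blk_def using set_tuples[of s N] by (force simp: r length_Suc_conv)
  \<comment> \<open>Tuples with first coordinate \<open>v\<close> are decided from entries with
    smaller first coordinate only, and those are final; so the order inside the block does not
    matter.\<close>
  have block: "fold g xs Y = (\<lambda>ws. Y ws \<or> ws \<in> set xs \<and> P ws)"
    if "\<And>ws. length ws = r \<Longrightarrow> set ws \<subseteq> {..<N} \<Longrightarrow> hd ws < v \<Longrightarrow> Y ws = P ws"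
      "\<And>vs. vs \<in> set xs \<Longrightarrow> length vs = r \<and> set vs \<subseteq> {..<N} \<and> hd vs = v" for xs Y v
    using that
  proof (induction xs arbitrary: Y)
    case (Cons vs xs)
    have B: "B Y vs = P vs" using Cons.prems by (intro step) auto
    have g: "g vs Y = (\<lambda>ws. Y ws \<or> ws = vs \<and> P ws)" using B by (auto simp: g_def fun_eq_iff)
    have "fold g xs (g vs Y) = (\<lambda>ws. g vs Y ws \<or> ws \<in> set xs \<and> P ws)"
    proof (rule Cons.IH)
      fix ws :: "nat list" assume "length ws = r" "set ws \<subseteq> {..<N}" "hd ws < v"
      then show "g vs Y ws = P ws" using Cons.prems(1)[of ws] Cons.prems(2)[of vs] by (auto simp: g)
    qed (use Cons.prems in auto)
    then show ?case by (auto simp: g fun_eq_iff)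
  qed auto
  have main: "fold (\<lambda>v. fold g (blk v)) [0..<v] (\<lambda>_. False) =
      (\<lambda>ws. length ws = r \<and> set ws \<subseteq> {..<N} \<and> hd ws < v \<and> P ws)" if "v \<le> N" for v
    using that
  proof (induction v)
    case (Suc v)
    let ?Y = "\<lambda>ws. length ws = r \<and> set ws \<subseteq> {..<N} \<and> hd ws < v \<and> P ws"
    have "fold g (blk v) ?Y = (\<lambda>ws. ?Y ws \<or> ws \<in> set (blk v) \<and> P ws)"
    proof (rule block)
      fix vs assume "vs \<in> set (blk v)"
      then have "length vs = r \<and> set (tl vs) \<subseteq> {..<N} \<and> hd vs = v" unfolding set_blk by simp
      then show "length vs = r \<and> set vs \<subseteq> {..<N} \<and> hd vs = v"
        using Suc.prems by (cases vs) (auto simp: r)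
    qed auto
    also have "\<dots> = (\<lambda>ws. length ws = r \<and> set ws \<subseteq> {..<N} \<and> hd ws < Suc v \<and> P ws)"
    proof
      fix ws
      show "(?Y ws \<or> ws \<in> set (blk v) \<and> P ws) = (length ws = r \<and> set ws \<subseteq> {..<N} \<and> hd ws < Suc v \<and> P ws)"
        using Suc.prems by (cases ws) (auto simp: set_blk r less_Suc_eq)
    qed
    finally show ?case using Suc by simp
  qed simp
  have "dp N r B = fold (\<lambda>v. fold g (blk v)) [0..<N] (\<lambda>_. False)"
    unfolding dp_def r tuples.simps g_def[abs_def] blk_def by (simp only: fold_concat_map)
  moreover have "hd ws < N" using ws r by (cases ws) auto
  ultimately show ?thesis using main[of N] ws by simp
qed

text \<open>\<open>P\<close> is the intended relation, with parameters in \<open>e\<close>, and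
  \<open>B\<close> is its recursion equation with the table as an argument. It is enough that
  \<open>B\<close> yields \<open>P\<close> from any table that is right at smaller first
  coordinates, whatever it contains elsewhere.\<close>

lemma definable_rec:
  assumes body: "definable U (\<lambda>u D e. B u (\<lambda>vs. D 0 vs) (\<lambda>i. e (i + r)) (map e [0..<r]))"
    and step: "\<And>u X e vs. u \<in> U \<Longrightarrow> \<forall>i. e i < length u \<Longrightarrow> length vs = r \<Longrightarrow> set vs \<subseteq> {..<length u} \<Longrightarrow>
      (\<And>ws. length ws = r \<Longrightarrow> set ws \<subseteq> {..<length u} \<Longrightarrow> hd ws < hd vs \<Longrightarrow> X ws = P u e ws) \<Longrightarrow>
      B u X e vs = P u e vs"
    and r: "0 < r" "length js = r"
  shows "definable U (\<lambda>u D e. P u e (map e js))"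
proof -
  obtain f where f: "\<And>u D e. u \<in> U \<Longrightarrow> \<forall>i. e i < length u \<Longrightarrow>
      eval u D e f = B u (D 0) (\<lambda>i. e (i + r)) (map e [0..<r])"
    using body unfolding definable_def by blast
  show ?thesis
  proof (rule definableI)
    fix u D and e :: "nat \<Rightarrow> nat" assume u: "u \<in> U" "\<forall>i. e i < length u"
    let ?e = "\<lambda>vs i. if i < r then vs ! i else e (i - r)"
    have ev: "eval u (case_nat X D) (?e vs) f = B u X e vs"
      if "length vs = r" "set vs \<subseteq> {..<length u}" for X vs
    proof -
      have "vs ! i < length u" if "i < r" for i
        using that \<open>length vs = r\<close> \<open>set vs \<subseteq> _\<close> nth_mem by blast
      moreover have "map (?e vs) [0..<r] = vs" using that by (intro nth_equalityI) auto
      ultimately show ?thesis using f[of u "?e vs" "case_nat X D"] u by simp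
    qed
    have "dp (length u) r (\<lambda>X vs. eval u (case_nat X D) (?e vs) f) (map e js) = P u e (map e js)"
    proof (rule dp_eq[OF r(1)])
      fix X vs
      assume vs: "length vs = r" "set vs \<subseteq> {..<length u}"
        and X: "\<And>ws. length ws = r \<Longrightarrow> set ws \<subseteq> {..<length u} \<Longrightarrow> hd ws < hd vs \<Longrightarrow> X ws = P u e ws"
      show "eval u (case_nat X D) (?e vs) f = P u e vs"
        unfolding ev[OF vs] by (rule step[OF u vs X])
    qed (use r u in auto)
    then show "eval u D e (Fix r f js) = P u e (map e js)" by simp
  qed
qed

lemma definable_rec1:
  assumes "definable U (\<lambda>u D e. B u (\<lambda>x. D 0 [x]) (\<lambda>i. e (Suc i)) (e 0))"
    and step: "\<And>u X e x. u \<in> U \<Longrightarrow> \<forall>i. e i < length u \<Longrightarrow> x < length u \<Longrightarrow>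
      (\<And>x'. x' < x \<Longrightarrow> X x' = P u e x') \<Longrightarrow> B u X e x = P u e x"
  shows "definable U (\<lambda>u D e. P u e (e i))"
proof -
  have "definable U (\<lambda>u D e. P u e ((map e [i]) ! 0))"
  proof (rule definable_rec[where r = 1 and B = "\<lambda>u X e vs. B u (\<lambda>x. X [x]) e (vs ! 0)"])
    fix u X and e :: "nat \<Rightarrow> nat" and vs :: "nat list"
    assume *: "u \<in> U" "\<forall>i. e i < length u" "length vs = 1" "set vs \<subseteq> {..<length u}"
      "\<And>ws. length ws = 1 \<Longrightarrow> set ws \<subseteq> {..<length u} \<Longrightarrow> hd ws < hd vs \<Longrightarrow> X ws = P u e (ws ! 0)"
    then obtain x where [simp]: "vs = [x]" by (cases vs) auto
    show "B u (\<lambda>x. X [x]) e (vs ! 0) = P u e (vs ! 0)"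
      unfolding \<open>vs = [x]\<close> nth_Cons_0
    proof (rule step)
      show "X [x'] = P u e x'" if "x' < x" for x'
        using *(5)[of "[x']"] that *(4) by simp
    qed (use * in auto)
  qed (use assms(1) in auto)
  then show ?thesis by simp
qed

lemma definable_rec2:
  assumes "definable U (\<lambda>u D e. B u (\<lambda>x y. D 0 [x, y]) (\<lambda>i. e (Suc (Suc i))) (e 0) (e 1))"
    and step: "\<And>u X e x y. u \<in> U \<Longrightarrow> \<forall>i. e i < length u \<Longrightarrow> x < length u \<Longrightarrow> y < length u \<Longrightarrow>
      (\<And>x' y'. x' < x \<Longrightarrow> y' < length u \<Longrightarrow> X x' y' = P u e x' y') \<Longrightarrow> B u X e x y = P u e x y"
  shows "definable U (\<lambda>u D e. P u e (e i) (e j))"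
proof -
  have "definable U (\<lambda>u D e. P u e ((map e [i, j]) ! 0) ((map e [i, j]) ! 1))"
  proof (rule definable_rec[where r = 2 and B = "\<lambda>u X e vs. B u (\<lambda>x y. X [x, y]) e (vs ! 0) (vs ! 1)"])
    fix u X and e :: "nat \<Rightarrow> nat" and vs :: "nat list"
    assume *: "u \<in> U" "\<forall>i. e i < length u" "length vs = 2" "set vs \<subseteq> {..<length u}"
      "\<And>ws. length ws = 2 \<Longrightarrow> set ws \<subseteq> {..<length u} \<Longrightarrow> hd ws < hd vs \<Longrightarrow> X ws = P u e (ws ! 0) (ws ! 1)"
    then obtain x y where vs: "vs = [x, y]" by (auto simp: numeral_2_eq_2 length_Suc_conv)
    have "B u (\<lambda>x y. X [x, y]) e x y = P u e x y"
    proof (rule step)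
      show "X [x', y'] = P u e x' y'" if "x' < x" "y' < length u" for x' y'
        using *(5)[of "[x', y']"] that *(4) vs by simp
    qed (use * vs in auto)
    then show "B u (\<lambda>x y. X [x, y]) e (vs ! 0) (vs ! 1) = P u e (vs ! 0) (vs ! 1)" by (simp add: vs)
  qed (use assms(1) in \<open>auto simp: numeral_2_eq_2\<close>)
  then show ?thesis by simp
qed

lemma definable_rec3:
  assumes "definable U (\<lambda>u D e. B u (\<lambda>x y z. D 0 [x, y, z]) (\<lambda>i. e (Suc (Suc (Suc i)))) (e 0) (e 1) (e 2))"
    and step: "\<And>u X e x y z. u \<in> U \<Longrightarrow> \<forall>i. e i < length u \<Longrightarrow> x < length u \<Longrightarrow> y < length u \<Longrightarrow> z < length u \<Longrightarrow>
      (\<And>x' y' z'. x' < x \<Longrightarrow> y' < length u \<Longrightarrow> z' < length u \<Longrightarrow> X x' y' z' = P u e x' y' z') \<Longrightarrow>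
      B u X e x y z = P u e x y z"
  shows "definable U (\<lambda>u D e. P u e (e i) (e j) (e k))"
proof -
  have "definable U (\<lambda>u D e. P u e ((map e [i, j, k]) ! 0) ((map e [i, j, k]) ! 1) ((map e [i, j, k]) ! 2))"
  proof (rule definable_rec[where r = 3 and
        B = "\<lambda>u X e vs. B u (\<lambda>x y z. X [x, y, z]) e (vs ! 0) (vs ! 1) (vs ! 2)"])
    fix u X and e :: "nat \<Rightarrow> nat" and vs :: "nat list"
    assume *: "u \<in> U" "\<forall>i. e i < length u" "length vs = 3" "set vs \<subseteq> {..<length u}"
      "\<And>ws. length ws = 3 \<Longrightarrow> set ws \<subseteq> {..<length u} \<Longrightarrow> hd ws < hd vs \<Longrightarrow>
        X ws = P u e (ws ! 0) (ws ! 1) (ws ! 2)"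
    then obtain x y z where vs: "vs = [x, y, z]" by (auto simp: numeral_3_eq_3 length_Suc_conv)
    have "B u (\<lambda>x y z. X [x, y, z]) e x y z = P u e x y z"
    proof (rule step)
      show "X [x', y', z'] = P u e x' y' z'" if "x' < x" "y' < length u" "z' < length u" for x' y' z'
        using *(5)[of "[x', y', z']"] that *(4) vs by simp
    qed (use * vs in auto)
    then show "B u (\<lambda>x y z. X [x, y, z]) e (vs ! 0) (vs ! 1) (vs ! 2) = P u e (vs ! 0) (vs ! 1) (vs ! 2)"
      by (simp add: vs)
  qed (use assms(1) in \<open>auto simp: numeral_3_eq_3 numeral_2_eq_2\<close>)
  then show ?thesis by simp
qed

lemma definable_Rel1: "definable U (\<lambda>u D e. D t [e i])"
  and definable_Rel2: "definable U (\<lambda>u D e. D t [e i, e j])"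
  and definable_Rel3: "definable U (\<lambda>u D e. D t [e i, e j, e k])"
  using definable_Rel[of U t "[i]"] definable_Rel[of U t "[i, j]"] definable_Rel[of U t "[i, j, k]"]
  by simp_all

lemma definable_eq: "definable U (\<lambda>u D e. e i = e j)"
  unfolding eq_iff by (intro definable_conj definable_le)

lemma definable_less: "definable U (\<lambda>u D e. e i < e j)"
  unfolding linorder_not_le[symmetric] by (intro definable_not definable_le)

lemmas definable_intros = definable_conj definable_disj definable_imp definable_iff definable_not
  definable_ex definable_all definable_const definable_Chk definable_le definable_less definable_eq
  definable_Rel1 definable_Rel2 definable_Rel3

section \<open>Arithmetic of positions\<close>

lemma definable_Suc: "definable U (\<lambda>u D e. e i = Suc (e j))"
proof (rule definable_cong)
  show "definable U (\<lambda>u D e. e j < e i \<and> (\<forall>y<length u. y \<le> e j \<or> e i \<le> y))"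
    by (intro definable_intros)
  fix u :: "'a list" and e :: "nat \<Rightarrow> nat" assume e: "\<forall>i. e i < length u"
  show "(e j < e i \<and> (\<forall>y<length u. y \<le> e j \<or> e i \<le> y)) = (e i = Suc (e j))"
  proof
    assume *: "e j < e i \<and> (\<forall>y<length u. y \<le> e j \<or> e i \<le> y)"
    then have "Suc (e j) < length u" using e by (metis Suc_lessI less_trans not_less_eq)
    then show "e i = Suc (e j)" using * by fastforce
  qed auto
qed

lemma definable_nat: "definable U (\<lambda>u D e. e i = c)"
proof (induction c arbitrary: i)
  case 0
  show ?case
  proof (rule definable_cong)
    show "definable U (\<lambda>u D e. \<forall>y<length u. e i \<le> y)" by (intro definable_intros)
  qed (metis bot_nat_0.extremum gr_zeroI less_nat_zero_code linorder_not_le)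
next
  case (Suc c)
  show ?case
  proof (rule definable_cong)
    show "definable U (\<lambda>u D e. \<exists>y<length u. y = c \<and> e i = Suc y)"
      by (intro definable_intros Suc definable_Suc)
  qed (metis Suc_lessD)
qed

lemma definable_add: "definable U (\<lambda>u D e. e i + e j = e k)"
proof (rule definable_rec3[where P = "\<lambda>u e x y z. x + y = z"])
  show "definable U (\<lambda>u D e. (e 0 = 0 \<and> e 1 = e 2) \<or>
      (\<exists>x<length u. \<exists>z<length u. e 0 = Suc x \<and> e 2 = Suc z \<and> D 0 [x, e 1, z]))"
    by (intro definable_intros definable_Suc definable_nat)
next
  fix u :: "'a list" and X and e :: "nat \<Rightarrow> nat" and x y z
  assume *: "x < length u" "y < length u" "z < length u"
    "\<And>x' y' z'. x' < x \<Longrightarrow> y' < length u \<Longrightarrow> z' < length u \<Longrightarrow> X x' y' z' = (x' + y' = z')"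
  show "(x = 0 \<and> y = z) \<or> (\<exists>x'<length u. \<exists>z'<length u. x = Suc x' \<and> z = Suc z' \<and> X x' y z') \<longleftrightarrow>
      x + y = z"
    using * by (cases x; cases z) auto
qed

text \<open>The common sum may lie outside the word. Comparing through the difference
  \<open>d\<close> of two summands keeps every intermediate value a position.\<close>

lemma definable_add4: "definable U (\<lambda>u D e. e i + e j = e k + e l)"
proof (rule definable_cong)
  show "definable U (\<lambda>u D e. \<exists>d<length u. (e k + d = e i \<and> e j + d = e l) \<or> (e i + d = e k \<and> e l + d = e j))"
    by (intro definable_intros definable_add)
  fix u :: "'a list" and e :: "nat \<Rightarrow> nat" assume e: "\<forall>i. e i < length u"
  show "(\<exists>d<length u. (e k + d = e i \<and> e j + d = e l) \<or> (e i + d = e k \<and> e l + d = e j)) =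
      (e i + e j = e k + e l)"
  proof
    assume *: "e i + e j = e k + e l"
    show "\<exists>d<length u. (e k + d = e i \<and> e j + d = e l) \<or> (e i + d = e k \<and> e l + d = e j)"
    proof (cases "e k \<le> e i")
      case True
      then show ?thesis using * e[rule_format, of i] by (intro exI[of _ "e i - e k"]) auto
    next
      case False
      then show ?thesis using * e[rule_format, of k] by (intro exI[of _ "e k - e i"]) auto
    qed
  qed auto
qed

lemma definable_same_symbol:
  fixes U :: "'a::finite list set"
  shows "definable U (\<lambda>u D e. u ! e i = u ! e j)"
proof (rule definable_cong)
  show "definable U (\<lambda>u D e. \<exists>a\<in>UNIV. u ! e i \<in> {a} \<and> u ! e j \<in> {a})"
    by (intro definable_Bex definable_intros) simp
qed auto

section \<open>Slices of a word and the languages they belong to\<close>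

definition slice :: "'a list \<Rightarrow> nat \<Rightarrow> nat \<Rightarrow> 'a list" where
  "slice u x y = take (y - x) (drop x u)"

lemma length_slice: "y \<le> length u \<Longrightarrow> length (slice u x y) = y - x"
  by (auto simp: slice_def)

lemma nth_slice: "i < y - x \<Longrightarrow> y \<le> length u \<Longrightarrow> slice u x y ! i = u ! (x + i)"
  by (simp add: slice_def)

lemma slice_same [simp]: "slice u x x = []"
  by (simp add: slice_def)

lemma slice_append: "x \<le> z \<Longrightarrow> z \<le> y \<Longrightarrow> slice u x z @ slice u z y = slice u x y"
proof -
  assume "x \<le> z" "z \<le> y"
  then have "y - x = (z - x) + (y - z)" "drop z u = drop (z - x) (drop x u)" by auto
  then show ?thesis unfolding slice_def by (simp only: take_add)
qed

text \<open>The disjunct \<open>z = x\<close> takes care of \<open>y < x\<close>: the slice is then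
  empty, and the only cut is the one into two empty words.\<close>

lemma slice_split:
  assumes "x < length u" "y < length u"
  shows "slice u x y = a @ b \<longleftrightarrow>
    (\<exists>z<length u. x \<le> z \<and> (z \<le> y \<or> z = x) \<and> a = slice u x z \<and> b = slice u z y)"
proof
  assume ab: "slice u x y = a @ b"
  show "\<exists>z<length u. x \<le> z \<and> (z \<le> y \<or> z = x) \<and> a = slice u x z \<and> b = slice u z y"
  proof (cases "x \<le> y")
    case True
    let ?z = "x + length a"
    have "length a \<le> y - x"
      using arg_cong[OF ab, of length] assms by (simp add: length_slice)
    then have z: "x \<le> ?z" "?z \<le> y" using True by auto
    have "slice u x ?z @ slice u ?z y = a @ b" using slice_append[OF z, of u] ab by simp
    moreover have "length (slice u x ?z) = length a" using z assms by (simp add: length_slice)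
    ultimately have "slice u x ?z = a" "slice u ?z y = b" by (metis append_eq_append_conv)+
    then show ?thesis using z assms by (intro exI[of _ ?z]) auto
  next
    case False
    then have "a = []" "b = []" using ab by (auto simp: slice_def)
    then show ?thesis using False assms by (intro exI[of _ x]) (auto simp: slice_def)
  qed
next
  assume "\<exists>z<length u. x \<le> z \<and> (z \<le> y \<or> z = x) \<and> a = slice u x z \<and> b = slice u z y"
  then obtain z where "x \<le> z" "z \<le> y \<or> z = x" "a = slice u x z" "b = slice u z y" by blast
  then show "slice u x y = a @ b" using slice_append[of x z y u] by auto
qed

text \<open>Splitting a slice amounts to choosing a position, and both pieces are slices again.
  Hence definitions by decomposition of words, nested at will, can be shown definable as they
  stand.\<close>

lemma definable_split:
  fixes P :: "'a list \<Rightarrow> (nat \<Rightarrow> nat list \<Rightarrow> bool) \<Rightarrow> (nat \<Rightarrow> nat) \<Rightarrow> 'a list \<Rightarrow> 'a list \<Rightarrow> bool"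
  assumes "definable U (\<lambda>u D e. P u D (\<lambda>i. e (Suc i)) (slice u (e (Suc i)) (e 0)) (slice u (e 0) (e (Suc j))))"
  shows "definable U (\<lambda>u D e. \<exists>a b. slice u (e i) (e j) = a @ b \<and> P u D e a b)"
proof (rule definable_cong)
  show "definable U (\<lambda>u D e. \<exists>z<length u. e i \<le> z \<and> (z \<le> e j \<or> z = e i) \<and>
      P u D e (slice u (e i) z) (slice u z (e j)))"
    by (intro definable_intros assms)
  fix u :: "'a list" and D and e :: "nat \<Rightarrow> nat" assume e: "\<forall>i. e i < length u"
  show "(\<exists>z<length u. e i \<le> z \<and> (z \<le> e j \<or> z = e i) \<and> P u D e (slice u (e i) z) (slice u z (e j))) =
     (\<exists>a b. slice u (e i) (e j) = a @ b \<and> P u D e a b)"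
    unfolding slice_split[OF e[rule_format] e[rule_format]] by blast
qed

lemma slice_eq_Nil: "x < length u \<Longrightarrow> slice u x y = [] \<longleftrightarrow> y \<le> x"
  by (simp add: slice_def)

text \<open>The languages that formulas can recognize between two variables. They contain the finite
  languages and are closed under union, concatenation and star, so all syntax checks on inputs are
  obtained from regular expressions.\<close>

definition segdef :: "'a list set \<Rightarrow> 'a list set \<Rightarrow> bool" where
  "segdef U L \<longleftrightarrow> (\<forall>i j. definable U (\<lambda>u D e. slice u (e i) (e j) \<in> L))"

definition conc :: "'a list set \<Rightarrow> 'a list set \<Rightarrow> 'a list set" (infixr "\<cdot>" 75) where
  "A \<cdot> B = {a @ b | a b. a \<in> A \<and> b \<in> B}"

definition kstar :: "'a list set \<Rightarrow> 'a list set" where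
  "kstar A = concat ` lists A"

lemma segdefD: "segdef U L \<Longrightarrow> definable U (\<lambda>u D e. slice u (e i) (e j) \<in> L)"
  by (simp add: segdef_def)

lemma segdef_Nil: "segdef U {[]}"
  unfolding segdef_def
proof (intro allI)
  fix i j
  show "definable U (\<lambda>u D e. slice u (e i) (e j) \<in> {[]})"
    by (rule definable_cong[OF definable_le[of U j i]]) (simp add: slice_eq_Nil)
qed

lemma segdef_sym: "segdef U {[a] | a. a \<in> A}"
  unfolding segdef_def
proof (intro allI)
  fix i j
  show "definable U (\<lambda>u D e. slice u (e i) (e j) \<in> {[a] | a. a \<in> A})"
  proof (rule definable_cong)
    show "definable U (\<lambda>u D e. e j = Suc (e i) \<and> u ! e i \<in> A)"
      by (intro definable_intros definable_Suc)
    fix u :: "'a list" and e :: "nat \<Rightarrow> nat" assume e: "\<forall>i. e i < length u"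
    have "e j = Suc (e i)" if "slice u (e i) (e j) = [a]" for a
      using arg_cong[OF that, of length] e[rule_format, of j] by (simp add: length_slice)
    moreover have "slice u (e i) (Suc (e i)) = [u ! e i]"
      using e[rule_format, of i] by (simp add: slice_def take_Suc_conv_app_nth hd_drop_conv_nth take_Suc)
    ultimately show "(e j = Suc (e i) \<and> u ! e i \<in> A) = (slice u (e i) (e j) \<in> {[a] | a. a \<in> A})"
      by auto
  qed
qed

lemma segdef_sym1: "segdef U {[a]}"
  using segdef_sym[of U "{a}"] by simp

lemma segdef_UNION:
  assumes "finite I" "\<And>x. x \<in> I \<Longrightarrow> segdef U (L x)"
  shows "segdef U (\<Union>x\<in>I. L x)"
  using assms unfolding segdef_def UN_iff by (intro allI definable_Bex) auto

lemma segdef_Un: "segdef U A \<Longrightarrow> segdef U B \<Longrightarrow> segdef U (A \<union> B)"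
  unfolding segdef_def Un_iff by (intro allI definable_disj) auto

lemma segdef_conc: "segdef U A \<Longrightarrow> segdef U B \<Longrightarrow> segdef U (A \<cdot> B)"
  unfolding segdef_def
proof (intro allI)
  fix i j assume AB: "\<forall>i j. definable U (\<lambda>u D e. slice u (e i) (e j) \<in> A)"
    "\<forall>i j. definable U (\<lambda>u D e. slice u (e i) (e j) \<in> B)"
  show "definable U (\<lambda>u D e. slice u (e i) (e j) \<in> A \<cdot> B)"
  proof (rule definable_cong)
    show "definable U (\<lambda>u D e. \<exists>a b. slice u (e i) (e j) = a @ b \<and> (a \<in> A \<and> b \<in> B))"
      by (rule definable_split, rule definable_conj) (use AB in auto)
  qed (auto simp: conc_def)
qed

lemma segdef_word: "segdef U {w}"
proof (induction w)
  case (Cons a w)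
  have "{a # w} = {[a]} \<cdot> {w}" by (auto simp: conc_def)
  then show ?case using segdef_conc[OF segdef_sym1 Cons] by metis
qed (rule segdef_Nil)

lemma kstar_Nil: "[] \<in> kstar A"
  unfolding kstar_def by (rule image_eqI[of _ _ "[]"]) auto

lemma kstar_snoc: "v \<in> kstar A \<Longrightarrow> w \<in> A \<Longrightarrow> v @ w \<in> kstar A"
  unfolding kstar_def by (auto intro!: image_eqI[of _ _ "_ @ [w]"])

text \<open>Discarding empty factors at the end gives a nonempty last factor, which makes the
  recursion for the star strictly decreasing.\<close>

lemma kstar_last:
  assumes "s \<in> kstar A" "s \<noteq> []"
  shows "\<exists>v w. s = v @ w \<and> v \<in> kstar A \<and> w \<in> A \<and> w \<noteq> []"
proof -
  obtain ws where ws: "set ws \<subseteq> A" "s = concat ws" using assms(1) by (auto simp: kstar_def)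
  from ws assms(2) show ?thesis
  proof (induction ws arbitrary: s rule: rev_induct)
    case (snoc w ws)
    show ?case
    proof (cases "w = []")
      case True
      then show ?thesis using snoc by simp
    next
      case False
      have "concat ws \<in> kstar A" using snoc.prems by (auto simp: kstar_def)
      then show ?thesis using False snoc.prems by auto
    qed
  qed simp
qed

text \<open>Recursion on the right end of the slice: its last nonempty factor begins at an earlier
  position, where the table already knows whether the rest belongs to the star.\<close>

lemma segdef_kstar:
  assumes L: "segdef U L"
  shows "segdef U (kstar L)"
  unfolding segdef_def
proof (intro allI)
  fix i j
  show "definable U (\<lambda>u D e. slice u (e i) (e j) \<in> kstar L)"
  proof (rule definable_rec1[where P = "\<lambda>u e y. slice u (e i) y \<in> kstar L"])
    show "definable U (\<lambda>u D e. e 0 \<le> e (Suc i) \<or>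
      (\<exists>z<length u. e (Suc i) \<le> z \<and> z < e 0 \<and> D 0 [z] \<and> slice u z (e 0) \<in> L))"
      by (intro definable_intros segdefD[OF L])
  next
    fix u :: "'a list" and X and e :: "nat \<Rightarrow> nat" and y
    assume *: "\<forall>i. e i < length u" "y < length u" "\<And>z. z < y \<Longrightarrow> X z = (slice u (e i) z \<in> kstar L)"
    show "(y \<le> e i \<or> (\<exists>z<length u. e i \<le> z \<and> z < y \<and> X z \<and> slice u z y \<in> L)) =
       (slice u (e i) y \<in> kstar L)"
    proof (cases "y \<le> e i")
      case True
      then show ?thesis by (simp add: slice_def kstar_Nil)
    next
      case False
      show ?thesis
      proof
        assume "y \<le> e i \<or> (\<exists>z<length u. e i \<le> z \<and> z < y \<and> X z \<and> slice u z y \<in> L)"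
        then obtain z where "e i \<le> z" "z < y" "slice u (e i) z \<in> kstar L" "slice u z y \<in> L"
          using False * by auto
        then show "slice u (e i) y \<in> kstar L"
          using kstar_snoc slice_append[of "e i" z y u] by fastforce
      next
        assume k: "slice u (e i) y \<in> kstar L"
        have "length (slice u (e i) y) > 0" using False * by (simp add: length_slice)
        then obtain v w where vw: "slice u (e i) y = v @ w" "v \<in> kstar L" "w \<in> L" "w \<noteq> []"
          using kstar_last[OF k] by auto
        then obtain z where z: "z < length u" "e i \<le> z" "z \<le> y \<or> z = e i" "v = slice u (e i) z" "w = slice u z y"
          using slice_split[of "e i" u y v w] * by auto
        moreover have "z < y" using vw(4) z(1,5) slice_eq_Nil[of z u y] by auto
        ultimately show "y \<le> e i \<or> (\<exists>z<length u. e i \<le> z \<and> z < y \<and> X z \<and> slice u z y \<in> L)"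
          using vw(2,3) *(3) by blast
      qed
    qed
  qed
qed

lemma definable_slice_eq:
  fixes U :: "'a::finite list set"
  shows "definable U (\<lambda>u D e. slice u (e i) (e j) = slice u (e k) (e l))"
proof (rule definable_cong)
  \<comment> \<open>Equal lengths and equal offsets are written as equations between sums of two
    positions, the form covered by \<open>definable_add4\<close>.\<close>
  show "definable U (\<lambda>u D e. (e j \<le> e i \<and> e l \<le> e k) \<or> (e i < e j \<and> e k < e l \<and> e j + e k = e l + e i \<and>
     (\<forall>p<length u. \<forall>q<length u. e i \<le> p \<and> p < e j \<and> e k \<le> q \<and> p + e k = q + e i \<longrightarrow> u ! p = u ! q)))"
    by (intro definable_intros definable_add4 definable_same_symbol)
  fix u :: "'a list" and e :: "nat \<Rightarrow> nat" assume "\<forall>i. e i < length u"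
  then have e: "e i < length u" "e j < length u" "e k < length u" "e l < length u" by auto
  show "((e j \<le> e i \<and> e l \<le> e k) \<or> (e i < e j \<and> e k < e l \<and> e j + e k = e l + e i \<and>
     (\<forall>p<length u. \<forall>q<length u. e i \<le> p \<and> p < e j \<and> e k \<le> q \<and> p + e k = q + e i \<longrightarrow> u ! p = u ! q))) =
     (slice u (e i) (e j) = slice u (e k) (e l))" (is "(?A \<or> ?B) = ?C")
  proof
    assume "?A \<or> ?B"
    then show ?C
    proof
      assume ?B
      then have B: "e j - e i = e l - e k" "\<And>t. t < e j - e i \<Longrightarrow> u ! (e i + t) = u ! (e k + t)"
        using e by (auto simp: less_diff_conv add.commute)
      show ?C
        by (rule nth_equalityI) (use B e in \<open>auto simp: length_slice nth_slice\<close>)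
    qed (auto simp: slice_def)
  next
    assume C: ?C
    have len: "e j - e i = e l - e k" using arg_cong[OF C, of length] e by (simp add: length_slice)
    have *: "u ! (e i + t) = u ! (e k + t)" if "t < e j - e i" for t
      using arg_cong[OF C, of "\<lambda>s. s ! t"] that len e by (simp add: nth_slice)
    have "u ! p = u ! q" if "e i \<le> p" "p < e j" "e k \<le> q" "p + e k = q + e i" for p q
    proof -
      have "p = e i + (p - e i)" "q = e k + (p - e i)" "p - e i < e j - e i" using that by auto
      then show ?thesis using *[of "p - e i"] by metis
    qed
    then show "?A \<or> ?B" using len by (cases "e i < e j") auto
  qed
qed

section \<open>Equality of encoded rationals\<close>

text \<open>The carry into column \<open>k\<close> when a number is given by column totals
  \<open>f\<close>, as in long multiplication. Totals and carries may exceed 1.\<close>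

fun carry :: "nat \<Rightarrow> (nat \<Rightarrow> nat) \<Rightarrow> nat \<Rightarrow> nat" where
  "carry c f 0 = c"
| "carry c f (Suc k) = (carry c f k + f k) div 2"

lemma carry_shift: "carry c f (Suc k) = carry ((c + f 0) div 2) (\<lambda>i. f (Suc i)) k"
  by (induction k) simp_all

text \<open>Column totals of a binary product are the coefficients of the product of the digit
  polynomials, and evaluation at 2 yields the product itself. Splitting off the constant coefficient
  is one column of the addition with carries.\<close>

lemma carry_poly:
  "odd (carry c (coeff p) k + coeff p k) \<longleftrightarrow> odd ((c + poly p 2) div 2 ^ k)" for p :: "nat poly"
proof (induction k arbitrary: c p)
  case 0
  obtain a q where "p = pCons a q" by (cases p)
  then show ?case by simp
next
  case (Suc k)
  obtain a q where p: "p = pCons a q" by (cases p)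
  have "(c + poly p 2) div 2 ^ Suc k = ((c + a) div 2 + poly q 2) div 2 ^ k"
    unfolding p by (simp add: div_mult2_eq add.assoc[symmetric] add.commute)
  moreover have "carry c (coeff p) (Suc k) = carry ((c + a) div 2) (coeff q) k"
    unfolding carry_shift by (simp add: p)
  ultimately show ?case using Suc[of "(c + a) div 2" q] by (simp add: p)
qed

text \<open>Half of a sum of two numbers up to \<open>L\<close> is again at most \<open>L\<close>.
  So carries remain positions of the word and can be stored as table coordinates.\<close>

lemma carry_le: "(\<And>i. f i \<le> L) \<Longrightarrow> carry 0 f k \<le> L"
proof (induction k)
  case (Suc k)
  then have "carry 0 f k + f k \<le> 2 * L" by (metis add_mono mult_2)
  then show ?case by simp
qed simp

definition has_bit :: "sym list \<Rightarrow> nat \<Rightarrow> bool" where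
  "has_bit s i \<longleftrightarrow> i < length s \<and> s ! i = Bit True"

text \<open>Total on words: every symbol other than \<open>Bit True\<close> counts as the digit 0.
  On words of bits it is \<open>bits_val\<close>.\<close>

definition word_val :: "sym list \<Rightarrow> nat" where
  "word_val s = bits_val (map (\<lambda>a. a = Bit True) s)"

definition word_poly :: "sym list \<Rightarrow> nat poly" where
  "word_poly s = Poly (map (\<lambda>a. of_bool (a = Bit True)) s)"

text \<open>A partial total of column \<open>k\<close>, restricted to digits of \<open>s\<close>
  below \<open>i\<close>, so that a table can accumulate it by recursion on \<open>i\<close>;
  \<open>i = Suc k\<close> gives the whole column.\<close>

definition hits :: "sym list \<Rightarrow> sym list \<Rightarrow> nat \<Rightarrow> nat \<Rightarrow> nat" where
  "hits s t k i = (\<Sum>j<i. of_bool (has_bit s j \<and> j \<le> k \<and> has_bit t (k - j)))"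

lemma word_val_map_Bit [simp]: "word_val (map Bit bs) = bits_val bs"
proof -
  have "map ((\<lambda>a. a = Bit True) \<circ> Bit) bs = bs" by (induction bs) simp_all
  then show ?thesis by (simp add: word_val_def)
qed

lemma coeff_word_poly: "coeff (word_poly s) i = of_bool (has_bit s i)"
  by (simp add: word_poly_def coeff_Poly_eq nth_default_def has_bit_def)

lemma poly_word_poly: "poly (word_poly s) 2 = word_val s"
  unfolding word_poly_def word_val_def bits_val_def by (induction s) simp_all

lemma hits_coeff: "hits s t k (Suc k) = coeff (word_poly s * word_poly t) k"
  unfolding hits_def coeff_mult coeff_word_poly lessThan_Suc_atMost
  by (intro sum.cong) (auto simp: of_bool_conj)

lemma bits_val_less: "bits_val bs < 2 ^ length bs"
  unfolding bits_val_def by (induction bs) (auto simp: of_bool_def)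

lemma word_val_less: "word_val s < 2 ^ length s"
  unfolding word_val_def using bits_val_less[of "map (\<lambda>a. a = Bit True) s"] by simp

lemma hits_le: "hits s t k i \<le> length s"
proof -
  have "hits s t k i \<le> (\<Sum>j<i. of_bool (j < length s))"
    unfolding hits_def by (intro sum_mono) (auto simp: has_bit_def)
  also have "\<dots> = (\<Sum>j\<in>{..<i} \<inter> {..<length s}. 1)"
    by (simp add: of_bool_def sum.If_cases Int_def)
  also have "\<dots> \<le> (\<Sum>j\<in>{..<length s}. 1 :: nat)" by (intro sum_mono2) auto
  finally show ?thesis by simp
qed

definition col :: "sym list \<Rightarrow> sym list \<Rightarrow> nat \<Rightarrow> nat" where
  "col s t k = hits s t k (Suc k)"

lemma product_bit: "odd (carry 0 (col s t) k + col s t k) \<longleftrightarrow> odd ((word_val s * word_val t) div 2 ^ k)"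
proof -
  have "col s t = coeff (word_poly s * word_poly t)" by (simp add: fun_eq_iff col_def hits_coeff)
  then show ?thesis using carry_poly[of 0 "word_poly s * word_poly t" k] by (simp add: poly_word_poly)
qed

lemma definable_has_bit: "definable U (\<lambda>u D e. has_bit (slice u (e i) (e j)) (e k))"
proof (rule definable_cong)
  show "definable U (\<lambda>u D e. \<exists>p<length u. e i + e k = p \<and> p < e j \<and> u ! p \<in> {Bit True})"
    by (intro definable_intros definable_add)
  fix u :: "sym list" and e :: "nat \<Rightarrow> nat" assume e: "\<forall>i. e i < length u"
  have ej: "e j < length u" using e by blast
  then show "(\<exists>p<length u. e i + e k = p \<and> p < e j \<and> u ! p \<in> {Bit True}) = has_bit (slice u (e i) (e j)) (e k)"
    by (auto simp: has_bit_def length_slice nth_slice less_diff_conv add.commute)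
qed

lemma definable_hits:
  "definable U (\<lambda>u D e. hits (slice u (e a) (e b)) (slice u (e c) (e d)) (e k) (e i) = e j)"
proof (rule definable_rec2[where P = "\<lambda>u e x y. hits (slice u (e a) (e b)) (slice u (e c) (e d)) (e k) x = y"])
  let ?S = "\<lambda>i. Suc (Suc i)"
  show "definable U (\<lambda>u D e. (e 0 = 0 \<and> e 1 = 0) \<or> (\<exists>x<length u. e 0 = Suc x \<and>
    (let h = (has_bit (slice u (e (?S a)) (e (?S b))) x \<and>
         (\<exists>m<length u. m + x = e (?S k) \<and> has_bit (slice u (e (?S c)) (e (?S d))) m)) in
     (h \<and> (\<exists>y<length u. e 1 = Suc y \<and> D 0 [x, y])) \<or> (\<not> h \<and> D 0 [x, e 1]))))"
    unfolding Let_def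
    by (intro definable_intros definable_nat definable_Suc definable_add definable_has_bit)
next
  fix u :: "sym list" and X and e :: "nat \<Rightarrow> nat" and x y
  assume *: "\<forall>i. e i < length u" "x < length u" "y < length u"
    "\<And>x' y'. x' < x \<Longrightarrow> y' < length u \<Longrightarrow> X x' y' =
       (hits (slice u (e a) (e b)) (slice u (e c) (e d)) (e k) x' = y')"
  let ?s = "slice u (e a) (e b)" and ?t = "slice u (e c) (e d)"
  have h: "(has_bit ?s x' \<and> (\<exists>m<length u. m + x' = e k \<and> has_bit ?t m)) =
      (has_bit ?s x' \<and> x' \<le> e k \<and> has_bit ?t (e k - x'))" for x'
  proof -
    have "(\<exists>m<length u. m + x' = e k \<and> has_bit ?t m) = (x' \<le> e k \<and> has_bit ?t (e k - x'))"
    proof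
      assume "\<exists>m<length u. m + x' = e k \<and> has_bit ?t m"
      then obtain m where "m + x' = e k" "has_bit ?t m" by blast
      moreover from this have "m = e k - x'" "x' \<le> e k" by simp_all
      ultimately show "x' \<le> e k \<and> has_bit ?t (e k - x')" by simp
    next
      assume "x' \<le> e k \<and> has_bit ?t (e k - x')"
      then show "\<exists>m<length u. m + x' = e k \<and> has_bit ?t m"
        using *(1) by (intro exI[of _ "e k - x'"]) (simp add: less_imp_diff_less)
    qed
    then show ?thesis by simp
  qed
  show "((x = 0 \<and> y = 0) \<or> (\<exists>x'<length u. x = Suc x' \<and>
    (let h = (has_bit ?s x' \<and> (\<exists>m<length u. m + x' = e k \<and> has_bit ?t m)) in
     (h \<and> (\<exists>y'<length u. y = Suc y' \<and> X x' y')) \<or> (\<not> h \<and> X x' y)))) = (hits ?s ?t (e k) x = y)"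
  proof (cases x)
    case 0
    then show ?thesis by (auto simp: hits_def)
  next
    case (Suc x')
    then have "X x' y' = (hits ?s ?t (e k) x' = y')" if "y' < length u" for y' using *(4) that by simp
    moreover have "hits ?s ?t (e k) x = hits ?s ?t (e k) x' +
        of_bool (has_bit ?s x' \<and> x' \<le> e k \<and> has_bit ?t (e k - x'))"
      unfolding Suc hits_def by simp
    ultimately show ?thesis using *(2,3) Suc unfolding h Let_def
      by (cases "has_bit ?s x' \<and> x' \<le> e k \<and> has_bit ?t (e k - x')"; cases y) auto
  qed
qed

lemma definable_carry:
  "definable U (\<lambda>u D e. carry 0 (col (slice u (e a) (e b)) (slice u (e c) (e d))) (e i) = e j)"
proof (rule definable_rec2[where P = "\<lambda>u e x y. carry 0 (col (slice u (e a) (e b)) (slice u (e c) (e d))) x = y"])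
  let ?S = "\<lambda>i. Suc (Suc i)"
  show "definable U (\<lambda>u D e. (e 0 = 0 \<and> e 1 = 0) \<or> (\<exists>x<length u. e 0 = Suc x \<and>
    (\<exists>y<length u. \<exists>s<length u. D 0 [x, y] \<and>
      hits (slice u (e (?S a)) (e (?S b))) (slice u (e (?S c)) (e (?S d))) x (e 0) = s \<and>
      (y + s = e 1 + e 1 \<or> (\<exists>t<length u. t = Suc (e 1) \<and> y + s = e 1 + t)))))"
    by (intro definable_intros definable_nat definable_Suc definable_add4 definable_hits)
next
  fix u :: "sym list" and X and e :: "nat \<Rightarrow> nat" and x y
  assume *: "\<forall>i. e i < length u" "x < length u" "y < length u"
    "\<And>x' y'. x' < x \<Longrightarrow> y' < length u \<Longrightarrow> X x' y' =
       (carry 0 (col (slice u (e a) (e b)) (slice u (e c) (e d))) x' = y')"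
  let ?s = "slice u (e a) (e b)" and ?t = "slice u (e c) (e d)"
  have L: "length ?s < length u" using *(1) by (simp add: length_slice less_imp_le less_imp_diff_less)
  have bnd: "hits ?s ?t k i < length u" "carry 0 (col ?s ?t) k < length u" for k i
    using hits_le[of ?s ?t k i] carry_le[of "col ?s ?t" "length ?s" k] hits_le[of ?s ?t] L
    by (auto simp: col_def intro: le_less_trans)
  show "((x = 0 \<and> y = 0) \<or> (\<exists>x'<length u. x = Suc x' \<and> (\<exists>y'<length u. \<exists>s<length u. X x' y' \<and>
      hits ?s ?t x' x = s \<and> (y' + s = y + y \<or> (\<exists>t<length u. t = Suc y \<and> y' + s = y + t))))) =
      (carry 0 (col ?s ?t) x = y)"
  proof (cases x)
    case 0
    then show ?thesis by auto
  next
    case (Suc x')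
    define c h where "c = carry 0 (col ?s ?t) x'" and "h = hits ?s ?t x' x"
    have ch: "c < length u" "h < length u" unfolding c_def h_def using bnd by auto
    have X: "X x' y' = (c = y')" if "y' < length u" for y' using *(4) that Suc unfolding c_def by simp
    have "(\<exists>y'<length u. \<exists>s<length u. X x' y' \<and> h = s \<and>
        (y' + s = y + y \<or> (\<exists>t<length u. t = Suc y \<and> y' + s = y + t))) =
        (c + h = y + y \<or> (Suc y < length u \<and> c + h = y + Suc y))"
      using X ch by auto
    \<comment> \<open>If \<open>Suc y\<close> is not a position, then \<open>y\<close> is the last
      one and \<open>c + h\<close> is at most \<open>y + y\<close>, so the odd case cannot be
      missed.\<close>
    also have "\<dots> = ((c + h) div 2 = y)" using ch by auto
    also have "\<dots> = (carry 0 (col ?s ?t) x = y)" by (simp add: Suc c_def h_def col_def)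
    finally show ?thesis using *(2) Suc unfolding h_def by auto
  qed
qed

text \<open>The restriction to \<open>Suc k < N\<close> comes from the total of column
  \<open>k\<close>, which is \<open>hits\<close> taken at \<open>Suc k\<close>; that number has to
  be a position of a word of length \<open>N\<close>.\<close>

definition bit_eq :: "nat \<Rightarrow> nat \<Rightarrow> nat \<Rightarrow> bool" where
  "bit_eq N x y \<longleftrightarrow> (\<forall>k. Suc k < N \<longrightarrow> odd (x div 2 ^ k) = odd (y div 2 ^ k))"

lemma bit_eq_iff_eq:
  assumes "x < 2 ^ M" "y < 2 ^ M" "M < N"
  shows "bit_eq N x y \<longleftrightarrow> x = y"
proof
  assume b: "bit_eq N x y"
  show "x = y"
  proof (rule bit_eqI)
    fix n
    show "bit x n = bit y n"
    proof (cases "n < M")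
      case True
      then show ?thesis using b assms(3) unfolding bit_eq_def bit_iff_odd by auto
    next
      case False
      then have "(2::nat) ^ M \<le> 2 ^ n" by (intro power_increasing) auto
      then have "x < 2 ^ n" "y < 2 ^ n" using assms(1,2) by linarith+
      then have "x div 2 ^ n = 0" "y div 2 ^ n = 0" by (simp_all only: div_less)
      then show ?thesis unfolding bit_iff_odd by simp
    qed
  qed
qed (simp add: bit_eq_def)

lemma definable_product_bit:
  "definable U (\<lambda>u D e. Suc (e k) < length u \<longrightarrow>
     (odd ((word_val (slice u (e a) (e b)) * word_val (slice u (e c) (e d))) div 2 ^ e k) \<longleftrightarrow>
      odd ((word_val (slice u (e a') (e b')) * word_val (slice u (e c') (e d'))) div 2 ^ e k)))"
proof -
  have *: "definable U (\<lambda>u D e. Suc (e k) < length u \<longrightarrow>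
     odd ((word_val (slice u (e a) (e b)) * word_val (slice u (e c) (e d))) div 2 ^ e k))" for a b c d k
  proof (rule definable_cong)
    show "definable U (\<lambda>u D e. \<forall>k'<length u. k' = Suc (e k) \<longrightarrow>
      (\<exists>x<length u. \<exists>y<length u. \<exists>h<length u. \<exists>h'<length u.
        carry 0 (col (slice u (e a) (e b)) (slice u (e c) (e d))) (e k) = x \<and>
        hits (slice u (e a) (e b)) (slice u (e c) (e d)) (e k) k' = y \<and> h' = Suc h \<and> x + y = h + h'))"
      by (intro definable_intros definable_Suc definable_add4 definable_hits definable_carry)
    fix u :: "sym list" and e :: "nat \<Rightarrow> nat" assume e: "\<forall>i. e i < length u"
    let ?s = "slice u (e a) (e b)" and ?t = "slice u (e c) (e d)"
    have L: "length ?s < length u" using e by (simp add: length_slice less_imp_le less_imp_diff_less)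
    define x y where "x = carry 0 (col ?s ?t) (e k)" and "y = hits ?s ?t (e k) (Suc (e k))"
    have xy: "x < length u" "y < length u"
      using hits_le[of ?s ?t] carry_le[of "col ?s ?t" "length ?s" "e k"] L
      unfolding x_def y_def by (auto simp: col_def intro: le_less_trans)
    have "(\<exists>h<length u. \<exists>h'<length u. h' = Suc h \<and> x + y = h + h') = odd (x + y)"
    proof
      assume "odd (x + y)"
      then obtain h where "x + y = 2 * h + 1" by (rule oddE)
      then show "\<exists>h<length u. \<exists>h'<length u. h' = Suc h \<and> x + y = h + h'"
        using xy by (intro exI[of _ h]) auto
    next
      assume "\<exists>h<length u. \<exists>h'<length u. h' = Suc h \<and> x + y = h + h'"
      then obtain h where "x + y = h + Suc h" by auto
      then show "odd (x + y)" by simp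
    qed
    moreover have "odd (x + y) = odd ((word_val ?s * word_val ?t) div 2 ^ e k)"
      using product_bit[of ?s ?t "e k"] by (simp add: x_def y_def col_def)
    ultimately show "(\<forall>k'<length u. k' = Suc (e k) \<longrightarrow> (\<exists>x<length u. \<exists>y<length u. \<exists>h<length u. \<exists>h'<length u.
        carry 0 (col ?s ?t) (e k) = x \<and> hits ?s ?t (e k) k' = y \<and> h' = Suc h \<and> x + y = h + h')) =
      (Suc (e k) < length u \<longrightarrow> odd ((word_val ?s * word_val ?t) div 2 ^ e k))"
      using xy unfolding x_def y_def by auto
  qed
  show ?thesis
    by (rule definable_cong[OF definable_iff[OF *[of k a b c d] *[of k a' b' c' d']]]) auto
qed

lemma definable_product_eq:
  "definable U (\<lambda>u D e. bit_eq (length u)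
     (word_val (slice u (e a) (e b)) * word_val (slice u (e c) (e d)))
     (word_val (slice u (e a') (e b')) * word_val (slice u (e c') (e d'))))"
proof (rule definable_cong)
  show "definable U (\<lambda>u D e. \<forall>k<length u. Suc k < length u \<longrightarrow>
     (odd ((word_val (slice u (e a) (e b)) * word_val (slice u (e c) (e d))) div 2 ^ k) \<longleftrightarrow>
      odd ((word_val (slice u (e a') (e b')) * word_val (slice u (e c') (e d'))) div 2 ^ k)))"
    by (intro definable_all definable_product_bit)
qed (auto simp: bit_eq_def)

section \<open>Words of rational numbers\<close>

definition bit_words :: "sym list set" where
  "bit_words = range (map Bit)"

lemma bit_words_eq: "bit_words = lists (range Bit)"
  unfolding bit_words_def by (simp add: lists_image)

lemma kstar_singletons: "kstar {[a] | a. a \<in> A} = lists A"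
proof (intro set_eqI iffI)
  fix w assume "w \<in> lists A"
  then have "map (\<lambda>a. [a]) w \<in> lists {[a] | a. a \<in> A}" "w = concat (map (\<lambda>a. [a]) w)" by auto
  then show "w \<in> kstar {[a] | a. a \<in> A}" unfolding kstar_def by blast
next
  fix w assume "w \<in> kstar {[a] | a. a \<in> A}"
  then obtain ws where ws: "set ws \<subseteq> {[a] | a. a \<in> A}" "w = concat ws" by (auto simp: kstar_def)
  then have "set v \<subseteq> A" if "v \<in> set ws" for v using that by auto
  then have "set w \<subseteq> A" unfolding ws(2) set_concat by blast
  then show "w \<in> lists A" by auto
qed

lemma segdef_bit_words: "segdef U bit_words"
  unfolding bit_words_eq kstar_singletons[symmetric] by (intro segdef_kstar segdef_sym)

lemma bit_words_iff: "w \<in> bit_words \<longleftrightarrow> (\<forall>a\<in>set w. \<exists>b. a = Bit b)"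
  unfolding bit_words_eq lists_eq_set by auto

lemma word_val_eq_0: "word_val s = 0 \<longleftrightarrow> Bit True \<notin> set s"
proof -
  have "bits_val bs = 0 \<longleftrightarrow> True \<notin> set bs" for bs
    unfolding bits_val_def by (induction bs) auto
  then show ?thesis by (auto simp: word_val_def)
qed

lemma definable_word_val_eq_0: "definable U (\<lambda>u D e. word_val (slice u (e i) (e j)) = 0)"
proof (rule definable_cong)
  show "definable U (\<lambda>u D e. \<forall>k<length u. \<not> has_bit (slice u (e i) (e j)) k)"
    by (intro definable_intros definable_has_bit)
  fix u :: "sym list" and e :: "nat \<Rightarrow> nat" assume "\<forall>i. e i < length u"
  then have "length (slice u (e i) (e j)) < length u" by (simp add: length_slice less_imp_le less_imp_diff_less)
  then show "(\<forall>k<length u. \<not> has_bit (slice u (e i) (e j)) k) = (word_val (slice u (e i) (e j)) = 0)"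
    unfolding word_val_eq_0 has_bit_def in_set_conv_nth by auto
qed

text \<open>Values of opposite sign agree only when both are zero; the disjunct \<open>n = 0\<close>
  identifies the two signed zeros, which both occur as codes.\<close>

lemma frac_eq:
  fixes n d n' d' :: nat
  assumes "d \<noteq> 0" "d' \<noteq> 0"
  shows "(if s then -1 else 1) * (of_nat n / of_nat d) = (if s' then -1 else 1) * (of_nat n' / of_nat d' :: rat)
    \<longleftrightarrow> n * d' = n' * d \<and> (s = s' \<or> n = 0)"
proof -
  have 1: "(of_nat n / of_nat d = (of_nat n' / of_nat d' :: rat)) = (n * d' = n' * d)"
    using assms by (simp add: frac_eq_eq flip: of_nat_mult)
  have 2: "(of_nat n / of_nat d = - (of_nat n' / of_nat d' :: rat)) = (n = 0 \<and> n' = 0)"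
  proof
    assume *: "of_nat n / of_nat d = - (of_nat n' / of_nat d' :: rat)"
    have "0 \<le> of_nat n / (of_nat d :: rat)" "0 \<le> of_nat n' / (of_nat d' :: rat)" by auto
    then have "of_nat n / (of_nat d :: rat) = 0" "of_nat n' / (of_nat d' :: rat) = 0" using * by linarith+
    then show "n = 0 \<and> n' = 0" using assms by simp
  qed simp
  have 3: "n = 0 \<and> n' = 0 \<longleftrightarrow> n * d' = n' * d \<and> n = 0" using assms by auto
  define X Y where "X = of_nat n / (of_nat d :: rat)" and "Y = of_nat n' / (of_nat d' :: rat)"
  have "(X = Y) = (n * d' = n' * d)" "(X = - Y) = (n * d' = n' * d \<and> n = 0)"
    using 1 2 3 by (simp_all only: X_def Y_def)
  moreover have "(- 1 * X = - 1 * Y) = (X = Y)" "(- 1 * X = 1 * Y) = (X = - Y)" "(1 * X = - 1 * Y) = (X = - Y)"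
    by auto
  ultimately show ?thesis unfolding X_def[symmetric] Y_def[symmetric] by (cases s; cases s') auto
qed

definition num_split :: "sym list \<Rightarrow> sym list \<Rightarrow> sym list \<Rightarrow> sym list \<Rightarrow> bool" where
  "num_split a h n d \<longleftrightarrow> a = h @ n @ [Slash] @ d \<and> h \<in> {[NumTag], [NumTag, Minus]} \<and>
     n \<in> bit_words \<and> d \<in> bit_words \<and> word_val d \<noteq> 0"

lemma encodes_num_iff:
  "encodes_const cn a (Num q) \<longleftrightarrow> (\<exists>h n d. num_split a h n d \<and>
     q = (if h = [NumTag, Minus] then -1 else 1) * (of_nat (word_val n) / of_nat (word_val d)))"
proof
  assume "encodes_const cn a (Num q)"
  then obtain neg n d where *: "bits_val d \<noteq> 0"
    "a = NumTag # (if neg then [Minus] else []) @ map Bit n @ [Slash] @ map Bit d"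
    "q = (if neg then -1 else 1) * (of_nat (bits_val n) / of_nat (bits_val d))"
    unfolding encodes_const.simps encodes_rat_def by blast
  show "\<exists>h n d. num_split a h n d \<and>
     q = (if h = [NumTag, Minus] then -1 else 1) * (of_nat (word_val n) / of_nat (word_val d))"
    by (rule exI[of _ "NumTag # (if neg then [Minus] else [])"], rule exI[of _ "map Bit n"],
        rule exI[of _ "map Bit d"]) (use * in \<open>simp add: num_split_def bit_words_def\<close>)
next
  assume "\<exists>h n d. num_split a h n d \<and>
     q = (if h = [NumTag, Minus] then -1 else 1) * (of_nat (word_val n) / of_nat (word_val d))"
  then obtain h n' d' where s: "num_split a h n' d'"
    "q = (if h = [NumTag, Minus] then -1 else 1) * (of_nat (word_val n') / of_nat (word_val d'))" by blast
  then obtain n d where nd: "n' = map Bit n" "d' = map Bit d" unfolding num_split_def bit_words_def by blast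
  have *: "a = h @ map Bit n @ [Slash] @ map Bit d" "h \<in> {[NumTag], [NumTag, Minus]}"
    "bits_val d \<noteq> 0" "q = (if h = [NumTag, Minus] then -1 else 1) * (of_nat (bits_val n) / of_nat (bits_val d))"
    using s unfolding num_split_def nd by simp_all
  then have "encodes_rat (tl h @ map Bit n @ [Slash] @ map Bit d) q"
    unfolding encodes_rat_def
    by (intro exI[of _ "h = [NumTag, Minus]"] exI[of _ n] exI[of _ d]) auto
  moreover have "a = NumTag # (tl h @ map Bit n @ [Slash] @ map Bit d)" using *(1,2) by auto
  ultimately show "encodes_const cn a (Num q)" by (simp only: encodes_const.simps) blast
qed

definition same_num :: "nat \<Rightarrow> sym list \<Rightarrow> sym list \<Rightarrow> bool" where
  "same_num N a b \<longleftrightarrow> (\<exists>h n d h' n' d'. num_split a h n d \<and> num_split b h' n' d' \<and>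
     (h = h' \<or> word_val n = 0) \<and> bit_eq N (word_val n * word_val d') (word_val n' * word_val d))"

lemma definable_same_num:
  "definable U (\<lambda>u D e. same_num (length u) (slice u (e i) (e j)) (slice u (e k) (e l)))"
proof (rule definable_cong)
  have heads: "segdef U {[NumTag], [NumTag, Minus]}"
    using segdef_Un[OF segdef_word[of U "[NumTag]"] segdef_word[of U "[NumTag, Minus]"]]
    by (simp add: insert_commute)
  show "definable U (\<lambda>u D e. \<exists>h r. slice u (e i) (e j) = h @ r \<and> (\<exists>n r2. r = n @ r2 \<and> (\<exists>m d. r2 = m @ d \<and>
     (\<exists>h' r'. slice u (e k) (e l) = h' @ r' \<and> (\<exists>n' r2'. r' = n' @ r2' \<and> (\<exists>m' d'. r2' = m' @ d' \<and>
       (h \<in> {[NumTag], [NumTag, Minus]} \<and> h' \<in> {[NumTag], [NumTag, Minus]} \<and>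
        n \<in> bit_words \<and> d \<in> bit_words \<and> n' \<in> bit_words \<and> d' \<in> bit_words \<and> m \<in> {[Slash]} \<and> m' \<in> {[Slash]} \<and>
        \<not> word_val d = 0 \<and> \<not> word_val d' = 0 \<and> (h = h' \<or> word_val n = 0) \<and>
        bit_eq (length u) (word_val n * word_val d') (word_val n' * word_val d))))))))"
    by (intro definable_split definable_conj definable_disj definable_not segdefD segdef_bit_words heads
        segdef_word definable_word_val_eq_0 definable_slice_eq definable_product_eq)
  fix u :: "sym list" and e :: "nat \<Rightarrow> nat"
  let ?a = "slice u (e i) (e j)" and ?b = "slice u (e k) (e l)" and ?H = "{[NumTag], [NumTag, Minus]}"
  show "(\<exists>h r. ?a = h @ r \<and> (\<exists>n r2. r = n @ r2 \<and> (\<exists>m d. r2 = m @ d \<and>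
     (\<exists>h' r'. ?b = h' @ r' \<and> (\<exists>n' r2'. r' = n' @ r2' \<and> (\<exists>m' d'. r2' = m' @ d' \<and>
       (h \<in> ?H \<and> h' \<in> ?H \<and>
        n \<in> bit_words \<and> d \<in> bit_words \<and> n' \<in> bit_words \<and> d' \<in> bit_words \<and> m \<in> {[Slash]} \<and> m' \<in> {[Slash]} \<and>
        \<not> word_val d = 0 \<and> \<not> word_val d' = 0 \<and> (h = h' \<or> word_val n = 0) \<and>
        bit_eq (length u) (word_val n * word_val d') (word_val n' * word_val d)))))))) =
     same_num (length u) ?a ?b" (is "?L = ?R")
  proof
    assume ?L
    then obtain h r n r2 m d h' r' n' r2' m' d' where
      "?a = h @ r" "r = n @ r2" "r2 = m @ d" "?b = h' @ r'" "r' = n' @ r2'" "r2' = m' @ d'"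
      "h \<in> ?H" "h' \<in> ?H" "n \<in> bit_words" "d \<in> bit_words" "n' \<in> bit_words" "d' \<in> bit_words"
      "m \<in> {[Slash]}" "m' \<in> {[Slash]}" "\<not> word_val d = 0" "\<not> word_val d' = 0"
      "h = h' \<or> word_val n = 0" "bit_eq (length u) (word_val n * word_val d') (word_val n' * word_val d)"
      by (elim exE conjE) (rule that)
    then have "num_split ?a h n d" "num_split ?b h' n' d'" "h = h' \<or> word_val n = 0"
      "bit_eq (length u) (word_val n * word_val d') (word_val n' * word_val d)"
      by (simp_all add: num_split_def)
    then show ?R unfolding same_num_def by (intro exI conjI)
  next
    assume ?R
    then obtain h n d h' n' d' where
      s: "num_split ?a h n d" "num_split ?b h' n' d'" "h = h' \<or> word_val n = 0"
      "bit_eq (length u) (word_val n * word_val d') (word_val n' * word_val d)"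
      unfolding same_num_def by (elim exE conjE) (rule that)
    then have ab: "?a = h @ n @ [Slash] @ d" "?b = h' @ n' @ [Slash] @ d'" by (simp_all add: num_split_def)
    show ?L
      by (rule exI[of _ h], rule exI[of _ "n @ [Slash] @ d"], rule conjI[OF ab(1)],
          rule exI[of _ n], rule exI[of _ "[Slash] @ d"], rule conjI[OF refl],
          rule exI[of _ "[Slash]"], rule exI[of _ d], rule conjI[OF refl],
          rule exI[of _ h'], rule exI[of _ "n' @ [Slash] @ d'"], rule conjI[OF ab(2)],
          rule exI[of _ n'], rule exI[of _ "[Slash] @ d'"], rule conjI[OF refl],
          rule exI[of _ "[Slash]"], rule exI[of _ d'], rule conjI[OF refl])
        (use s in \<open>simp add: num_split_def\<close>)
  qed
qed

lemma num_split_tags: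
  assumes "num_split s h n d"
  shows "2 \<le> length s" "s ! 0 = NumTag" "\<And>i. 0 < i \<Longrightarrow> i < length s \<Longrightarrow> s ! i \<noteq> NumTag"
    "length n + 2 \<le> length s" "length d + 2 \<le> length s"
    "takeWhile (\<lambda>a. a \<noteq> Slash) (s @ t) = h @ n" "h \<noteq> []" "length s = length (h @ n) + Suc (length d)"
proof -
  have s: "s = h @ n @ [Slash] @ d" "h \<in> {[NumTag], [NumTag, Minus]}" "n \<in> bit_words" "d \<in> bit_words"
    using assms by (auto simp: num_split_def)
  have tl: "NumTag \<notin> set (tl s)" using s by (auto simp: bit_words_iff)
  show "2 \<le> length s" "s ! 0 = NumTag" "length n + 2 \<le> length s" "length d + 2 \<le> length s"
    "h \<noteq> []" "length s = length (h @ n) + Suc (length d)" using s by auto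
  show "s ! i \<noteq> NumTag" if "0 < i" "i < length s" for i
    using tl that by (metis Suc_pred in_set_conv_nth length_tl nth_tl less_diff_conv Suc_eq_plus1)
  have "\<forall>a\<in>set (h @ n). a \<noteq> Slash" using s by (auto simp: bit_words_iff)
  then show "takeWhile (\<lambda>a. a \<noteq> Slash) (s @ t) = h @ n"
    unfolding s(1) append_assoc by (simp only: append_Cons takeWhile_append2 append_assoc[symmetric]) simp
qed

text \<open>Two number words in a word are disjoint or start at the same position; so the factors of the cross
  products together are shorter than the word.\<close>

lemma num_split_length:
  assumes s: "num_split (slice u x y) h n d" "num_split (slice u x' y') h' n' d'"
    and u: "x < length u" "y < length u" "x' < length u" "y' < length u"
  shows "length n + length d' < length u - 1"
proof -
  have len: "length (slice u x y) = y - x" "length (slice u x' y') = y' - x'" using u by (simp_all add: length_slice)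
  note 1 = num_split_tags[OF s(1), unfolded len] and 2 = num_split_tags[OF s(2), unfolded len]
  have u1: "u ! x = NumTag" "\<And>i. x < i \<Longrightarrow> i < y \<Longrightarrow> u ! i \<noteq> NumTag"
  proof -
    show "u ! x = NumTag" using 1(1,2) u nth_slice[of 0 y x u] by simp
    show "u ! i \<noteq> NumTag" if "x < i" "i < y" for i
      using 1(3)[of "i - x"] that u nth_slice[of "i - x" y x u] by simp
  qed
  have u2: "u ! x' = NumTag" "\<And>i. x' < i \<Longrightarrow> i < y' \<Longrightarrow> u ! i \<noteq> NumTag"
  proof -
    show "u ! x' = NumTag" using 2(1,2) u nth_slice[of 0 y' x' u] by simp
    show "u ! i \<noteq> NumTag" if "x' < i" "i < y'" for i
      using 2(3)[of "i - x'"] that u nth_slice[of "i - x'" y' x' u] by simp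
  qed
  consider "x = x'" | "x < x'" | "x' < x" by linarith
  then show ?thesis
  proof cases
    case 1
    \<comment> \<open>Words starting at the same position agree up to the first
      \<open>Slash\<close>. Hence \<open>n\<close> is no longer than what precedes the
      \<open>Slash\<close> of the second word, while \<open>d'\<close> follows it there.\<close>
    have "h @ n = h' @ n'"
    proof (cases "y \<le> y'")
      case True
      have "slice u x y @ slice u y y' = slice u x' y'"
        using slice_append[of x y y' u] True 1 num_split_tags(1)[OF s(1)] len by simp
      then show ?thesis
        using num_split_tags(6)[OF s(1), of "slice u y y'"] num_split_tags(6)[OF s(2), of "[]"] by simp
    next
      case False
      have "slice u x' y' @ slice u y' y = slice u x y"
        using slice_append[of x' y' y u] False 1 num_split_tags(1)[OF s(2)] len by simp
      then show ?thesis
        using num_split_tags(6)[OF s(2), of "slice u y' y"] num_split_tags(6)[OF s(1), of "[]"] by simp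
    qed
    then have "length n \<le> length (h' @ n')" by (metis length_append le_add2)
    then show ?thesis using 2(8) u by linarith
  next
    case 2
    then have "y \<le> x'" using u1(2)[of x'] u2(1) by force
    then show ?thesis using \<open>length n + 2 \<le> y - x\<close> \<open>length d' + 2 \<le> y' - x'\<close> u by linarith
  next
    case 3
    then have "y' \<le> x" using u2(2)[of x] u1(1) by force
    then show ?thesis using \<open>length n + 2 \<le> y - x\<close> \<open>length d' + 2 \<le> y' - x'\<close> u by linarith
  qed
qed

lemma word_val_mult_less: "length s + length t < N - 1 \<Longrightarrow> word_val s * word_val t < 2 ^ (N - 1)"
proof -
  assume "length s + length t < N - 1"
  then have "(2::nat) ^ (length s + length t) \<le> 2 ^ (N - 1)" by (intro power_increasing) auto
  moreover have "word_val s * word_val t < 2 ^ length s * 2 ^ length t"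
    using word_val_less[of s] word_val_less[of t] by (intro mult_strict_mono) auto
  ultimately show ?thesis by (simp add: power_add)
qed

text \<open>Inside one word of length \<open>N\<close> both cross products are below
  \<open>2 ^ (N - 1)\<close>, and the bits compared by \<open>bit_eq\<close> are exactly the
  \<open>N - 1\<close> lowest. So the bitwise test decides equality of the fractions.\<close>

lemma same_num_slices:
  assumes u: "x < length u" "y < length u" "x' < length u" "y' < length u"
  shows "same_num (length u) (slice u x y) (slice u x' y') \<longleftrightarrow>
    (\<exists>q. encodes_const cn (slice u x y) (Num q) \<and> encodes_const cn (slice u x' y') (Num q))"
proof -
  have "((h = h' \<or> word_val n = 0) \<and> bit_eq (length u) (word_val n * word_val d') (word_val n' * word_val d)) \<longleftrightarrow>
     (if h = [NumTag, Minus] then -1 else 1) * (of_nat (word_val n) / of_nat (word_val d)) =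
     (if h' = [NumTag, Minus] then -1 else 1) * (of_nat (word_val n') / of_nat (word_val d') :: rat)"
    if s: "num_split (slice u x y) h n d" "num_split (slice u x' y') h' n' d'" for h n d h' n' d'
  proof -
    have "bit_eq (length u) (word_val n * word_val d') (word_val n' * word_val d) \<longleftrightarrow>
        word_val n * word_val d' = word_val n' * word_val d"
    proof (rule bit_eq_iff_eq)
      show "word_val n * word_val d' < 2 ^ (length u - 1)" "word_val n' * word_val d < 2 ^ (length u - 1)"
        using num_split_length[OF s u] num_split_length[OF s(2,1) u(3,4,1,2)] word_val_mult_less by blast+
    qed (use u in auto)
    moreover have "(h = h') = ((h = [NumTag, Minus]) = (h' = [NumTag, Minus]))"
      "word_val d \<noteq> 0" "word_val d' \<noteq> 0" using s by (auto simp: num_split_def)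
    ultimately show ?thesis using frac_eq[of "word_val d" "word_val d'"] by auto
  qed
  then show ?thesis unfolding same_num_def encodes_num_iff by metis
qed

lemma concI: "a \<in> A \<Longrightarrow> b \<in> B \<Longrightarrow> a @ b \<in> A \<cdot> B"
  by (auto simp: conc_def)

lemma concE:
  assumes "w \<in> A \<cdot> B" obtains a b where "w = a @ b" "a \<in> A" "b \<in> B"
  using assms by (auto simp: conc_def)

section \<open>Words of constants\<close>

definition const_words :: "('d \<Rightarrow> bool list) \<Rightarrow> sort \<Rightarrow> sym list set" where
  "const_words cn s = {w. \<exists>c. has_sort c s \<and> encodes_const cn w c}"

lemma const_words_NumSort:
  "const_words cn NumSort = {[NumTag], [NumTag, Minus]} \<cdot> bit_words \<cdot> {[Slash]} \<cdot> {d \<in> bit_words. word_val d \<noteq> 0}"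
proof -
  have "w \<in> const_words cn NumSort \<longleftrightarrow> (\<exists>q. encodes_const cn w (Num q))" for w
    unfolding const_words_def mem_Collect_eq by (metis const.exhaust has_sort.simps sort.distinct(1))
  then have "const_words cn NumSort = {w. \<exists>h n d. num_split w h n d}"
    unfolding encodes_num_iff by blast
  also have "\<dots> = {[NumTag], [NumTag, Minus]} \<cdot> bit_words \<cdot> {[Slash]} \<cdot> {d \<in> bit_words. word_val d \<noteq> 0}"
  proof (intro set_eqI iffI)
    fix w assume "w \<in> {w. \<exists>h n d. num_split w h n d}"
    then obtain h n d where "num_split w h n d" by blast
    then show "w \<in> {[NumTag], [NumTag, Minus]} \<cdot> bit_words \<cdot> {[Slash]} \<cdot> {d \<in> bit_words. word_val d \<noteq> 0}"
      unfolding num_split_def by (elim conjE) (simp only:, intro concI, simp_all)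
  next
    fix w assume "w \<in> {[NumTag], [NumTag, Minus]} \<cdot> bit_words \<cdot> {[Slash]} \<cdot> {d \<in> bit_words. word_val d \<noteq> 0}"
    then obtain h n m d where "w = h @ n @ m @ d" "h \<in> {[NumTag], [NumTag, Minus]}" "n \<in> bit_words"
      "m \<in> {[Slash]}" "d \<in> {d \<in> bit_words. word_val d \<noteq> 0}"
      by (elim concE) simp
    then have "num_split w h n d" unfolding num_split_def by simp
    then show "w \<in> {w. \<exists>h n d. num_split w h n d}" by blast
  qed
  finally show ?thesis .
qed

text \<open>Surjectivity of \<open>cn\<close> enters here: every bit string names some constant, so
  valid names form a regular language however complicated \<open>cn\<close> is.\<close>

lemma const_words_NameSort:
  assumes "bij cn" shows "const_words cn NameSort = {[NameTag]} \<cdot> bit_words"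
proof -
  have 1: "w \<in> const_words cn NameSort \<longleftrightarrow> (\<exists>c. w = NameTag # map Bit (cn c))" for w
    unfolding const_words_def mem_Collect_eq
    by (metis const.exhaust has_sort.simps sort.distinct(1) encodes_const.simps(2))
  have 2: "(\<exists>c. w = NameTag # map Bit (cn c)) \<longleftrightarrow> (\<exists>b. w = NameTag # map Bit b)" for w
    using assms by (metis bij_pointE)
  have 3: "w \<in> {[NameTag]} \<cdot> bit_words \<longleftrightarrow> (\<exists>b. w = NameTag # map Bit b)" for w
    unfolding conc_def bit_words_def by auto
  show ?thesis by (rule set_eqI) (simp only: 1 2 3)
qed

lemma segdef_const_words:
  assumes "bij cn" shows "segdef U (const_words cn s)"
proof (cases s)
  case NumSort
  have heads: "segdef U {[NumTag], [NumTag, Minus]}"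
    using segdef_Un[OF segdef_word[of U "[NumTag]"] segdef_word[of U "[NumTag, Minus]"]]
    by (simp add: insert_commute)
  have "segdef U {d \<in> bit_words. word_val d \<noteq> 0}"
    unfolding segdef_def mem_Collect_eq
    by (intro allI definable_conj definable_not definable_word_val_eq_0 segdefD segdef_bit_words)
  then show ?thesis unfolding NumSort const_words_NumSort
    by (intro segdef_conc heads segdef_bit_words segdef_word)
next
  case NameSort
  show ?thesis unfolding NameSort const_words_NameSort[OF assms]
    by (intro segdef_conc segdef_word segdef_bit_words)
qed

definition same_const :: "('d \<Rightarrow> bool list) \<Rightarrow> sym list \<Rightarrow> sym list \<Rightarrow> bool" where
  "same_const cn a b \<longleftrightarrow> (\<exists>c. encodes_const cn a c \<and> encodes_const cn b c)"

lemma definable_same_const: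
  assumes cn: "bij cn"
  shows "definable U (\<lambda>u D e. same_const cn (slice u (e i) (e j)) (slice u (e k) (e l)))"
proof (rule definable_cong)
  show "definable U (\<lambda>u D e. (slice u (e i) (e j) \<in> const_words cn NameSort \<and>
      slice u (e i) (e j) = slice u (e k) (e l)) \<or> same_num (length u) (slice u (e i) (e j)) (slice u (e k) (e l)))"
    by (intro definable_conj definable_disj segdefD segdef_const_words[OF cn] definable_slice_eq definable_same_num)
  fix u :: "sym list" and e :: "nat \<Rightarrow> nat" assume e: "\<forall>i. e i < length u"
  have name: "(a \<in> const_words cn NameSort \<and> a = b) \<longleftrightarrow> (\<exists>c. encodes_const cn a (Name c) \<and> encodes_const cn b (Name c))" for a b
  proof -
    have "a \<in> const_words cn NameSort \<longleftrightarrow> (\<exists>c. encodes_const cn a (Name c))"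
      unfolding const_words_def mem_Collect_eq by (metis const.exhaust has_sort.simps sort.distinct(1))
    then show ?thesis by auto
  qed
  have sc: "same_const cn a b \<longleftrightarrow> (\<exists>c. encodes_const cn a (Name c) \<and> encodes_const cn b (Name c)) \<or>
     (\<exists>q. encodes_const cn a (Num q) \<and> encodes_const cn b (Num q))" for a b
    unfolding same_const_def by (metis const.exhaust)
  show "((slice u (e i) (e j) \<in> const_words cn NameSort \<and> slice u (e i) (e j) = slice u (e k) (e l)) \<or>
      same_num (length u) (slice u (e i) (e j)) (slice u (e k) (e l))) =
      same_const cn (slice u (e i) (e j)) (slice u (e k) (e l))"
    unfolding name same_num_slices[where cn = cn, OF e[rule_format] e[rule_format] e[rule_format] e[rule_format]]
    by (rule sc[symmetric])
qed

lemma encodes_const_inj: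
  assumes cn: "bij cn" and "encodes_const cn w c" "encodes_const cn w c'"
  shows "c = c'"
proof (cases c; cases c')
  fix q q' assume c: "c = Num q" "c' = Num q'"
  obtain h n d h' n' d' where *: "num_split w h n d" "num_split w h' n' d'"
    "q = (if h = [NumTag, Minus] then -1 else 1) * (of_nat (word_val n) / of_nat (word_val d))"
    "q' = (if h' = [NumTag, Minus] then -1 else 1) * (of_nat (word_val n') / of_nat (word_val d'))"
    using assms(2,3) unfolding c encodes_num_iff by blast
  have hn: "h @ n = h' @ n'"
    using num_split_tags(6)[OF *(1), of "[]"] num_split_tags(6)[OF *(2), of "[]"] by simp
  moreover have "Minus \<notin> set n" "Minus \<notin> set n'" using * by (auto simp: num_split_def bit_words_iff)
  ultimately have "h = h'" using *(1,2) by (auto simp: num_split_def)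
  then have "n = n'" "d = d'" using hn * by (auto simp: num_split_def)
  then show ?thesis using * \<open>h = h'\<close> c by simp
next
  fix a b assume c: "c = Name a" "c' = Name b"
  then have "map Bit (cn a) = map Bit (cn b)" using assms(2,3) by simp
  then have "cn a = cn b" by (simp add: inj_on_def inj_map_eq_map)
  then show ?thesis using c cn by (simp add: bij_def inj_eq)
qed (use assms(2,3) in \<open>auto\<close>)

section \<open>Encoded facts\<close>

lemma takeWhile_no_tag:
  "\<forall>a\<in>set p. \<not> tg a \<Longrightarrow> c = [] \<or> tg (hd c) \<Longrightarrow> takeWhile (\<lambda>a. \<not> tg a) (p @ c) = p"
  by (induction p) (cases c; auto)+

text \<open>A tag stands at the front of each factor and nowhere else. The first factor therefore
  ends just before the next tag, and \<open>takeWhile\<close> recovers it from either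
  factorization.\<close>

lemma concat_tagged_unique:
  assumes "\<forall>v\<in>set vs \<union> set ws. v \<noteq> [] \<and> tg (hd v) \<and> (\<forall>a\<in>set (tl v). \<not> tg a)"
    and "concat vs = concat ws"
  shows "vs = ws"
  using assms
proof (induction vs arbitrary: ws)
  case Nil
  then show ?case by (cases ws) auto
next
  case (Cons v vs)
  have tg: "concat xs = [] \<or> tg (hd (concat xs))" if "set xs \<subseteq> set (v # vs) \<union> set ws" for xs
    using that Cons.prems(1) by (cases xs) auto
  have "concat ws \<noteq> []" using Cons.prems by auto
  then obtain w ws' where ws: "ws = w # ws'" by (cases ws) auto
  obtain a b c d where v: "v = a # b" and w: "w = c # d"
    using Cons.prems(1) ws by (cases v; cases w) auto
  have b: "takeWhile (\<lambda>a. \<not> tg a) (b @ concat vs) = b"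
    using Cons.prems(1) v tg[of vs] by (intro takeWhile_no_tag) auto
  have d: "takeWhile (\<lambda>a. \<not> tg a) (d @ concat ws') = d"
    using Cons.prems(1) w ws tg[of ws'] by (intro takeWhile_no_tag) auto
  have eq: "a = c" "b @ concat vs = d @ concat ws'" using Cons.prems(2) v w ws by auto
  then have "b = d" using b d by metis
  moreover from this eq have "vs = ws'" using Cons.prems(1) ws by (intro Cons.IH) auto
  ultimately show ?case using v w ws eq by simp
qed

lemma prefix_concat_tagged_unique:
  assumes "\<forall>v\<in>set vs \<union> set ws. v \<noteq> [] \<and> tg (hd v) \<and> (\<forall>a\<in>set (tl v). \<not> tg a)"
    and "\<forall>a\<in>set p \<union> set q. \<not> tg a" and "p @ concat vs = q @ concat ws"
  shows "p = q \<and> vs = ws"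
proof -
  have tg: "concat xs = [] \<or> tg (hd (concat xs))" if "set xs \<subseteq> set vs \<union> set ws" for xs
    using that assms(1) by (cases xs) auto
  have "takeWhile (\<lambda>a. \<not> tg a) (p @ concat vs) = p" "takeWhile (\<lambda>a. \<not> tg a) (q @ concat ws) = q"
    using assms(2) tg by (intro takeWhile_no_tag; simp)+
  then have "p = q" using assms(3) by metis
  then show ?thesis using concat_tagged_unique[OF assms(1)] assms(3) by simp
qed

lemma list_all2_ex: "list_all2 P vs ss \<Longrightarrow> v \<in> set vs \<Longrightarrow> \<exists>s. P v s"
  by (metis in_set_conv_nth list_all2_conv_all_nth)

lemma encodes_const_shape:
  assumes "encodes_const cn w c"
  shows "w \<noteq> []" "hd w \<in> {NumTag, NameTag}" "\<forall>a\<in>set (tl w). a \<in> range Bit \<union> {Minus, Slash}"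
  using assms by (cases c; auto simp: encodes_rat_def split: if_splits)+

locale schema_code =
  fixes S :: "'r schema" and F :: "'r fd set" and rn :: "'r \<Rightarrow> bool list" and cn :: "'d \<Rightarrow> bool list"
  assumes wf_S: "wf_schema S" and wf_F: "\<forall>d\<in>F. wf_fd S d" and inj_F: "inj_on fd_rel F"
    and inj_rn: "inj_on rn (dom S)" and bij_cn: "bij cn"
begin

lemma finite_dom: "finite (dom S)"
  using wf_S by (simp add: wf_schema_def)

fun consts_words :: "sort list \<Rightarrow> sym list set" where
  "consts_words [] = {[]}"
| "consts_words (s # ss) = const_words cn s \<cdot> consts_words ss"

lemma segdef_consts_words: "segdef U (consts_words ss)"
  by (induction ss) (auto intro: segdef_Nil segdef_conc segdef_const_words bij_cn)

lemma consts_words_iff: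
  "w \<in> consts_words ss \<longleftrightarrow> (\<exists>ws. list_all2 (\<lambda>v s. v \<in> const_words cn s) ws ss \<and> w = concat ws)"
proof (induction ss arbitrary: w)
  case (Cons s ss)
  show ?case
  proof
    assume "w \<in> consts_words (s # ss)"
    then obtain a b where "w = a @ b" "a \<in> const_words cn s" "b \<in> consts_words ss"
      by (auto elim: concE)
    moreover from this obtain ws where "list_all2 (\<lambda>v s. v \<in> const_words cn s) ws ss" "b = concat ws"
      using Cons by blast
    ultimately show "\<exists>ws. list_all2 (\<lambda>v s. v \<in> const_words cn s) ws (s # ss) \<and> w = concat ws"
      by (intro exI[of _ "a # ws"]) simp
  next
    assume "\<exists>ws. list_all2 (\<lambda>v s. v \<in> const_words cn s) ws (s # ss) \<and> w = concat ws"
    then obtain a ws where "a \<in> const_words cn s" "list_all2 (\<lambda>v s. v \<in> const_words cn s) ws ss" "w = a @ concat ws"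
      by (auto simp: list_all2_Cons2)
    then show "w \<in> consts_words (s # ss)" using Cons by (auto intro: concI)
  qed
qed simp

definition rel_words :: "'r \<Rightarrow> sym list set" where
  "rel_words r = {FactTag # map Bit (rn r)} \<cdot> consts_words (the (S r))"

definition fact_words :: "sym list set" where
  "fact_words = (\<Union>r\<in>dom S. rel_words r)"

lemma segdef_rel_words: "segdef U (rel_words r)"
  unfolding rel_words_def by (intro segdef_conc segdef_word segdef_consts_words)

lemma segdef_fact_words: "segdef U fact_words"
  unfolding fact_words_def by (intro segdef_UNION finite_dom segdef_rel_words)

definition args_word :: "sym list \<Rightarrow> 'r \<Rightarrow> sym list list \<Rightarrow> bool" where
  "args_word w r vs \<longleftrightarrow> r \<in> dom S \<and> list_all2 (\<lambda>v s. v \<in> const_words cn s) vs (the (S r)) \<and>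
     w = FactTag # map Bit (rn r) @ concat vs"

lemma rel_words_iff: "r \<in> dom S \<Longrightarrow> w \<in> rel_words r \<longleftrightarrow> (\<exists>vs. args_word w r vs)"
  unfolding rel_words_def args_word_def conc_def using consts_words_iff by auto

lemma const_words_shape:
  assumes "w \<in> const_words cn s"
  shows "w \<noteq> []" "hd w \<in> {NumTag, NameTag}" "\<forall>a\<in>set (tl w). a \<in> range Bit \<union> {Minus, Slash}"
  using assms encodes_const_shape unfolding const_words_def by blast+

lemma const_words_tagged:
  assumes "list_all2 (\<lambda>v s. v \<in> const_words cn s) vs ss" "v \<in> set vs"
  shows "v \<noteq> [] \<and> hd v \<in> {NumTag, NameTag} \<and> (\<forall>a\<in>set (tl v). a \<notin> {NumTag, NameTag})"
proof -
  obtain s where "v \<in> const_words cn s" using list_all2_ex[OF assms] by blast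
  from const_words_shape[OF this] show ?thesis by blast
qed

lemma const_words_no_tags:
  assumes "list_all2 (\<lambda>v s. v \<in> const_words cn s) vs ss"
  shows "FactTag \<notin> set (concat vs)" "PairTag \<notin> set (concat vs)"
proof -
  have "a \<noteq> FactTag \<and> a \<noteq> PairTag" if av: "a \<in> set v" "v \<in> set vs" for a v
  proof -
    obtain s where "v \<in> const_words cn s" using list_all2_ex[OF assms av(2)] by blast
    from const_words_shape[OF this] show ?thesis using av(1) by (cases v) auto
  qed
  then show "FactTag \<notin> set (concat vs)" "PairTag \<notin> set (concat vs)" by auto
qed

text \<open>The bits of the relation name stop at the first \<open>NumTag\<close> or
  \<open>NameTag\<close>, or at the end of the word; from there on the same tags separate the
  arguments.\<close>

lemma args_word_unique:
  assumes "args_word w r vs" "args_word w r' vs'"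
  shows "r = r' \<and> vs = vs'"
proof -
  have "map Bit (rn r) = map Bit (rn r') \<and> vs = vs'"
  proof (rule prefix_concat_tagged_unique[where tg = "\<lambda>a. a \<in> {NumTag, NameTag}"])
    show "\<forall>v\<in>set vs \<union> set vs'. v \<noteq> [] \<and> hd v \<in> {NumTag, NameTag} \<and> (\<forall>a\<in>set (tl v). a \<notin> {NumTag, NameTag})"
      using assms const_words_tagged unfolding args_word_def by blast
    show "map Bit (rn r) @ concat vs = map Bit (rn r') @ concat vs'" using assms unfolding args_word_def by simp
  qed auto
  moreover from this have "rn r = rn r'" by (simp add: inj_on_def inj_map_eq_map)
  ultimately show ?thesis using inj_rn assms unfolding args_word_def inj_on_def by simp
qed

lemma encodes_fact_args:
  assumes "wf_fact S f"
  shows "encodes_fact rn cn w f \<longleftrightarrow> (\<exists>vs. args_word w (rel f) vs \<and> list_all2 (encodes_const cn) vs (args f))"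
proof -
  obtain r cs where f: "f = Fact r cs" by (cases f)
  obtain ss where ss: "S r = Some ss" "list_all2 has_sort cs ss" using assms f by (auto simp: wf_fact_def)
  have "list_all2 (\<lambda>v s. v \<in> const_words cn s) vs ss" if "list_all2 (encodes_const cn) vs cs" for vs
    using that ss(2) unfolding list_all2_conv_all_nth const_words_def by auto blast
  then show ?thesis using ss unfolding f by (auto simp: args_word_def encodes_list_def)
qed

lemma fact_words_iff: "w \<in> fact_words \<longleftrightarrow> (\<exists>f. wf_fact S f \<and> encodes_fact rn cn w f)"
proof
  assume "w \<in> fact_words"
  then obtain r where r: "r \<in> dom S" "w \<in> rel_words r" unfolding fact_words_def by blast
  then obtain vs where vs: "args_word w r vs" using rel_words_iff by blast
  then have "\<forall>v s. (v, s) \<in> set (zip vs (the (S r))) \<longrightarrow> (\<exists>c. has_sort c s \<and> encodes_const cn v c)"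
    unfolding args_word_def list_all2_iff const_words_def by fastforce
  then obtain g where g: "\<And>v s. (v, s) \<in> set (zip vs (the (S r))) \<Longrightarrow> has_sort (g v s) s \<and> encodes_const cn v (g v s)"
    by metis
  let ?cs = "map2 g vs (the (S r))"
  have len: "length vs = length (the (S r))" using vs unfolding args_word_def by (auto dest: list_all2_lengthD)
  have "list_all2 has_sort ?cs (the (S r))" "list_all2 (encodes_const cn) vs ?cs"
    using g len by (auto simp: list_all2_conv_all_nth in_set_zip)
  then have wf: "wf_fact S (Fact r ?cs)" and "list_all2 (encodes_const cn) vs (args (Fact r ?cs))"
    using r by (auto simp: wf_fact_def)
  then have "encodes_fact rn cn w (Fact r ?cs)"
    unfolding encodes_fact_args[OF wf] using vs by auto
  then show "\<exists>f. wf_fact S f \<and> encodes_fact rn cn w f" using wf by blast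
next
  assume "\<exists>f. wf_fact S f \<and> encodes_fact rn cn w f"
  then obtain f where f: "wf_fact S f" "encodes_fact rn cn w f" by blast
  then obtain vs where "args_word w (rel f) vs" using encodes_fact_args[OF f(1)] by auto
  then have "rel f \<in> dom S" "w \<in> rel_words (rel f)" using rel_words_iff unfolding args_word_def by auto
  then show "w \<in> fact_words" unfolding fact_words_def by blast
qed

lemma encodes_fact_inj:
  assumes "wf_fact S f" "wf_fact S g" "encodes_fact rn cn w f" "encodes_fact rn cn w g"
  shows "f = g"
proof -
  obtain vs where vs: "args_word w (rel f) vs" "list_all2 (encodes_const cn) vs (args f)"
    using assms encodes_fact_args by blast
  obtain ws where ws: "args_word w (rel g) ws" "list_all2 (encodes_const cn) ws (args g)"
    using assms encodes_fact_args by blast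
  have eq: "rel f = rel g" "vs = ws" using args_word_unique[OF vs(1) ws(1)] by auto
  have "args f = args g"
    using vs(2) ws(2) encodes_const_inj[OF bij_cn] unfolding eq list_all2_conv_all_nth
    by (intro nth_equalityI) auto
  then show ?thesis using eq(1) by (cases f; cases g) simp
qed

definition dec :: "sym list \<Rightarrow> ('r, 'd) fact" where
  "dec w = (THE f. wf_fact S f \<and> encodes_fact rn cn w f)"

lemma dec_eq: "wf_fact S f \<Longrightarrow> encodes_fact rn cn w f \<Longrightarrow> dec w = f"
  unfolding dec_def using encodes_fact_inj by blast

lemma dec: "w \<in> fact_words \<Longrightarrow> wf_fact S (dec w) \<and> encodes_fact rn cn w (dec w)"
  using dec_eq fact_words_iff by metis

lemma fact_words_shape:
  assumes "w \<in> fact_words"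
  shows "w \<noteq> []" "hd w = FactTag" "\<forall>a\<in>set (tl w). a \<notin> {FactTag, PairTag}"
proof -
  obtain r vs where "args_word w r vs" using assms rel_words_iff unfolding fact_words_def by blast
  then show "w \<noteq> []" "hd w = FactTag" "\<forall>a\<in>set (tl w). a \<notin> {FactTag, PairTag}"
    using const_words_no_tags unfolding args_word_def by auto
qed

lemma dec_args:
  assumes "w \<in> fact_words"
  obtains vs where "args_word w (rel (dec w)) vs" "list_all2 (encodes_const cn) vs (args (dec w))"
  using dec[OF assms] encodes_fact_args by blast

lemma rel_dec: "w \<in> fact_words \<Longrightarrow> r \<in> dom S \<Longrightarrow> rel (dec w) = r \<longleftrightarrow> w \<in> rel_words r"
  using dec_args rel_words_iff args_word_unique by metis

text \<open>The argument is located by typing: words for the earlier sorts must precede it and words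
  for the later sorts must follow. Since a fact word has only one decomposition, this finds just one
  place, and the condition is a split into definable languages.\<close>

definition attr_word :: "'r \<Rightarrow> nat \<Rightarrow> sym list \<Rightarrow> sym list \<Rightarrow> bool" where
  "attr_word r i w p \<longleftrightarrow> (\<exists>a b. w = a @ p @ b \<and> a \<in> {FactTag # map Bit (rn r)} \<cdot> consts_words (take i (the (S r))) \<and>
     p \<in> const_words cn (the (S r) ! i) \<and> b \<in> consts_words (drop (Suc i) (the (S r))))"

lemma attr_word_iff:
  assumes "args_word w r vs" "i < length (the (S r))"
  shows "attr_word r i w p \<longleftrightarrow> p = vs ! i"
proof
  let ?ss = "the (S r)" let ?P = "\<lambda>v s. v \<in> const_words cn s"
  have len: "length vs = length ?ss" using assms unfolding args_word_def by (auto dest: list_all2_lengthD)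
  {
    assume "attr_word r i w p"
    then obtain a b where w: "w = (FactTag # map Bit (rn r)) @ a @ p @ b" and
      a: "a \<in> consts_words (take i ?ss)" "p \<in> const_words cn (?ss ! i)" "b \<in> consts_words (drop (Suc i) ?ss)"
      unfolding attr_word_def conc_def by auto
    then obtain va vb where v: "list_all2 ?P va (take i ?ss)" "a = concat va" "list_all2 ?P vb (drop (Suc i) ?ss)" "b = concat vb"
      unfolding consts_words_iff by blast
    have "list_all2 ?P (va @ p # vb) (take i ?ss @ ?ss ! i # drop (Suc i) ?ss)"
      using v a by (intro list_all2_appendI) auto
    then have "args_word w r (va @ p # vb)"
      using w v assms id_take_nth_drop[OF assms(2)] unfolding args_word_def by simp
    then have "vs = va @ p # vb" using args_word_unique assms(1) by blast
    moreover have "length va = i" using list_all2_lengthD[OF v(1)] assms(2) by simp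
    ultimately show "p = vs ! i" by auto
  }
  {
    assume p: "p = vs ! i"
    have l: "list_all2 ?P vs ?ss" using assms unfolding args_word_def by blast
    have "list_all2 ?P (take i vs) (take i ?ss)" "list_all2 ?P (drop (Suc i) vs) (drop (Suc i) ?ss)" "?P (vs ! i) (?ss ! i)"
      using l assms(2) len by (auto simp: list_all2_conv_all_nth)
    then have c: "concat (take i vs) \<in> consts_words (take i ?ss)" "vs ! i \<in> const_words cn (?ss ! i)"
      "concat (drop (Suc i) vs) \<in> consts_words (drop (Suc i) ?ss)"
      unfolding consts_words_iff by blast+
    have "concat vs = concat (take i vs) @ vs ! i @ concat (drop (Suc i) vs)"
      using id_take_nth_drop[of i vs] assms(2) len by (metis concat.simps(2) concat_append)
    then have "w = ((FactTag # map Bit (rn r)) @ concat (take i vs)) @ p @ concat (drop (Suc i) vs)"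
      using assms(1) p unfolding args_word_def by simp
    then show "attr_word r i w p"
      unfolding attr_word_def using c p concI[OF singletonI c(1)] by blast
  }
qed

definition same_attr :: "'r \<Rightarrow> nat \<Rightarrow> sym list \<Rightarrow> sym list \<Rightarrow> bool" where
  "same_attr r i v w \<longleftrightarrow> (\<exists>p q. attr_word r i v p \<and> attr_word r i w q \<and> same_const cn p q)"

lemma definable_same_attr:
  "definable U (\<lambda>u D e. same_attr r i (slice u (e a) (e b)) (slice u (e c) (e d)))"
proof (rule definable_cong)
  let ?A = "{FactTag # map Bit (rn r)} \<cdot> consts_words (take i (the (S r)))"
  let ?C = "const_words cn (the (S r) ! i)" and ?B = "consts_words (drop (Suc i) (the (S r)))"
  show "definable U (\<lambda>u D e. \<exists>a1 r1. slice u (e a) (e b) = a1 @ r1 \<and> (\<exists>p b1. r1 = p @ b1 \<and>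
     (\<exists>a2 r2. slice u (e c) (e d) = a2 @ r2 \<and> (\<exists>q b2. r2 = q @ b2 \<and>
       (a1 \<in> ?A \<and> a2 \<in> ?A \<and> p \<in> ?C \<and> q \<in> ?C \<and> b1 \<in> ?B \<and> b2 \<in> ?B \<and> same_const cn p q)))))"
    by (intro definable_split definable_conj segdefD segdef_conc segdef_word segdef_consts_words
        segdef_const_words definable_same_const bij_cn)
  fix u :: "sym list" and e :: "nat \<Rightarrow> nat"
  let ?v = "slice u (e a) (e b)" and ?w = "slice u (e c) (e d)"
  show "(\<exists>a1 r1. ?v = a1 @ r1 \<and> (\<exists>p b1. r1 = p @ b1 \<and>
     (\<exists>a2 r2. ?w = a2 @ r2 \<and> (\<exists>q b2. r2 = q @ b2 \<and>
       (a1 \<in> ?A \<and> a2 \<in> ?A \<and> p \<in> ?C \<and> q \<in> ?C \<and> b1 \<in> ?B \<and> b2 \<in> ?B \<and> same_const cn p q))))) =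
     same_attr r i ?v ?w" (is "?L = ?R")
  proof
    assume ?L
    then obtain a1 r1 p b1 a2 r2 q b2 where "?v = a1 @ r1" "r1 = p @ b1" "?w = a2 @ r2" "r2 = q @ b2"
      "a1 \<in> ?A" "a2 \<in> ?A" "p \<in> ?C" "q \<in> ?C" "b1 \<in> ?B" "b2 \<in> ?B" "same_const cn p q"
      by (elim exE conjE) (rule that)
    then have "attr_word r i ?v p" "attr_word r i ?w q" "same_const cn p q"
      unfolding attr_word_def by auto
    then show ?R unfolding same_attr_def by (intro exI conjI)
  next
    assume ?R
    then obtain p q a1 b1 a2 b2 where s: "?v = a1 @ p @ b1" "?w = a2 @ q @ b2"
      "a1 \<in> ?A" "a2 \<in> ?A" "p \<in> ?C" "q \<in> ?C" "b1 \<in> ?B" "b2 \<in> ?B" "same_const cn p q"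
      unfolding same_attr_def attr_word_def by (elim exE conjE) (rule that)
    show ?L
      by (rule exI[of _ a1], rule exI[of _ "p @ b1"], rule conjI[OF s(1)], rule exI[of _ p], rule exI[of _ b1],
          rule conjI[OF refl], rule exI[of _ a2], rule exI[of _ "q @ b2"], rule conjI[OF s(2)],
          rule exI[of _ q], rule exI[of _ b2], rule conjI[OF refl], intro conjI s(3-))
  qed
qed

lemma same_attr_iff:
  assumes "v \<in> rel_words r" "w \<in> rel_words r" "S r = Some ss" "i < length ss"
  shows "same_attr r i v w \<longleftrightarrow> args (dec v) ! i = args (dec w) ! i"
proof -
  have r: "r \<in> dom S" using assms by auto
  have f: "v \<in> fact_words" "w \<in> fact_words" using assms r unfolding fact_words_def by blast+
  then have rel: "rel (dec v) = r" "rel (dec w) = r" using rel_dec r assms by blast+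
  obtain vs where vs: "args_word v r vs" "list_all2 (encodes_const cn) vs (args (dec v))"
    using dec_args[OF f(1)] rel by metis
  obtain ws where ws: "args_word w r ws" "list_all2 (encodes_const cn) ws (args (dec w))"
    using dec_args[OF f(2)] rel by metis
  have i: "i < length (the (S r))" using assms by simp
  have len: "length vs = length ss" "length ws = length ss"
    using vs(1) ws(1) assms unfolding args_word_def by (auto simp: list_all2_lengthD)
  have "encodes_const cn (vs ! i) (args (dec v) ! i)" "encodes_const cn (ws ! i) (args (dec w) ! i)"
    using vs(2) ws(2) len assms(4) by (auto simp: list_all2_conv_all_nth)
  then have "same_const cn (vs ! i) (ws ! i) \<longleftrightarrow> args (dec v) ! i = args (dec w) ! i"
    unfolding same_const_def using encodes_const_inj[OF bij_cn] by metis
  then show ?thesis unfolding same_attr_def attr_word_iff[OF vs(1) i] attr_word_iff[OF ws(1) i] by simp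
qed

text \<open>A fact has many codes, so a relation between facts is handled through a relation between
  words that is definable on slices and depends only on the decoded facts.\<close>

definition word_rel :: "(('r, 'd) fact \<Rightarrow> ('r, 'd) fact \<Rightarrow> bool) \<Rightarrow> (sym list \<Rightarrow> sym list \<Rightarrow> bool) \<Rightarrow> bool" where
  "word_rel R W \<longleftrightarrow> (\<forall>U i j k l. definable U (\<lambda>u D e. W (slice u (e i) (e j)) (slice u (e k) (e l)))) \<and>
     (\<forall>v\<in>fact_words. \<forall>w\<in>fact_words. W v w = R (dec v) (dec w))"

text \<open>Clusters, parts and equality of facts all have this form: the attribute set is the
  left-hand side of the dependency, both of its sides, or everything.\<close>

definition same_on :: "('r \<Rightarrow> nat set) \<Rightarrow> ('r, 'd) fact \<Rightarrow> ('r, 'd) fact \<Rightarrow> bool" where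
  "same_on A f g \<longleftrightarrow> rel f = rel g \<and> agree_on (A (rel f)) f g"

text \<open>Cutting \<open>A r\<close> down to actual attribute positions makes it visibly finite,
  as needed for a finite conjunction of formulas.\<close>

definition same_on_word :: "('r \<Rightarrow> nat set) \<Rightarrow> sym list \<Rightarrow> sym list \<Rightarrow> bool" where
  "same_on_word A v w \<longleftrightarrow> (\<exists>r\<in>dom S. v \<in> rel_words r \<and> w \<in> rel_words r \<and> (\<forall>i\<in>A r \<inter> {..<length (the (S r))}. same_attr r i v w))"

lemma word_rel_same_on:
  assumes "\<And>r ss. S r = Some ss \<Longrightarrow> A r \<subseteq> {..<length ss}"
  shows "word_rel (same_on A) (same_on_word A)"
  unfolding word_rel_def
proof (intro conjI allI ballI)
  fix U i j k l
  show "definable U (\<lambda>u D e. same_on_word A (slice u (e i) (e j)) (slice u (e k) (e l)))"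
    unfolding same_on_word_def
    by (intro definable_Bex definable_Ball definable_conj finite_dom segdefD segdef_rel_words definable_same_attr) simp
next
  fix v w assume vw: "v \<in> fact_words" "w \<in> fact_words"
  show "same_on_word A v w = same_on A (dec v) (dec w)"
  proof (cases "rel (dec v) = rel (dec w)")
    case True
    obtain ss where ss: "S (rel (dec v)) = Some ss" using dec[OF vw(1)] by (auto simp: wf_fact_def)
    let ?r = "rel (dec v)"
    have r: "v \<in> rel_words ?r" "w \<in> rel_words ?r" using rel_dec vw ss True by (metis domI)+
    have "same_on_word A v w \<longleftrightarrow> (\<forall>i\<in>A ?r. same_attr ?r i v w)"
    proof -
      have "r' = ?r" if "r' \<in> dom S" "v \<in> rel_words r'" for r' using rel_dec[OF vw(1) that(1)] that by simp
      moreover have "A ?r \<inter> {..<length (the (S ?r))} = A ?r" using assms[OF ss] ss by auto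
      ultimately show ?thesis unfolding same_on_word_def using ss r by (metis domI)
    qed
    also have "\<dots> \<longleftrightarrow> agree_on (A ?r) (dec v) (dec w)"
      using same_attr_iff[OF r ss] assms[OF ss] unfolding agree_on_def by (metis lessThan_iff subset_iff)
    finally show ?thesis using True by (simp add: same_on_def)
  next
    case False
    have "\<not> same_on_word A v w"
      using False rel_dec[OF vw(1)] rel_dec[OF vw(2)] unfolding same_on_word_def by metis
    then show ?thesis using False by (simp add: same_on_def)
  qed
qed

end

section \<open>Encoded inputs\<close>

context schema_code
begin

definition pair_words :: "sym list set" where
  "pair_words = {[PairTag]} \<cdot> fact_words \<cdot> fact_words"

definition pair_word :: "sym list \<times> sym list \<Rightarrow> sym list" where
  "pair_word = (\<lambda>(s, t). PairTag # s @ t)"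

definition inputs :: "sym list set" where
  "inputs = kstar fact_words \<cdot> kstar pair_words"

definition facts_of :: "sym list \<Rightarrow> sym list set" where
  "facts_of w = {s. \<exists>a b. w = a @ s @ b \<and> a \<in> kstar fact_words \<and> s \<in> fact_words \<and> b \<in> inputs}"

definition pairs_of :: "sym list \<Rightarrow> (sym list \<times> sym list) set" where
  "pairs_of w = {(s, t). \<exists>a b. w = a @ pair_word (s, t) @ b \<and> a \<in> inputs \<and> s \<in> fact_words \<and> t \<in> fact_words \<and>
     b \<in> kstar pair_words}"

lemma kstar_pair_words: "b \<in> kstar pair_words \<longleftrightarrow> (\<exists>vs. set vs \<subseteq> fact_words \<times> fact_words \<and> b = concat (map pair_word vs))"
proof -
  have "pair_words = pair_word ` (fact_words \<times> fact_words)"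
    by (auto simp: pair_words_def pair_word_def conc_def image_iff)
  then have "lists pair_words = map pair_word ` lists (fact_words \<times> fact_words)" by (simp add: lists_image)
  then show ?thesis by (auto simp: kstar_def lists_eq_set image_iff)
qed

lemma kstar_fact_words: "a \<in> kstar fact_words \<longleftrightarrow> (\<exists>ws. set ws \<subseteq> fact_words \<and> a = concat ws)"
  by (auto simp: kstar_def lists_eq_set image_iff)

text \<open>\<open>PairTag\<close> is made a block of its own. An input then factors into blocks
  that carry one of \<open>FactTag\<close> and \<open>PairTag\<close> at the front and nowhere else,
  and unique factorization applies.\<close>

definition pair_blocks :: "sym list \<times> sym list \<Rightarrow> sym list list" where
  "pair_blocks = (\<lambda>(s, t). [[PairTag], s, t])"

lemma concat_pair_blocks: "concat (concat (map pair_blocks vs)) = concat (map pair_word vs)"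
  by (induction vs) (auto simp: pair_blocks_def pair_word_def)

lemma blocks_unique:
  assumes "set ws \<subseteq> fact_words" "set ws' \<subseteq> fact_words"
    and "ws @ concat (map pair_blocks vs) = ws' @ concat (map pair_blocks vs')"
  shows "ws = ws' \<and> vs = vs'"
  using assms
proof (induction ws arbitrary: ws')
  case Nil
  have np: "[PairTag] \<notin> fact_words" using fact_words_shape(2) by fastforce
  have "ws' = []"
  proof (cases ws')
    case (Cons w ws'')
    then have "w = [PairTag]" using Nil.prems(3) by (cases vs) (auto simp: pair_blocks_def)
    then show ?thesis using Nil.prems(2) Cons np by simp
  qed
  moreover have "concat (map pair_blocks vs) = concat (map pair_blocks vs') \<Longrightarrow> vs = vs'" for vs'
  proof (induction vs arbitrary: vs')
    case Nil
    then show ?case by (cases vs') (auto simp: pair_blocks_def)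
  next
    case (Cons v vs)
    then show ?case by (cases vs') (auto simp: pair_blocks_def split: prod.splits)
  qed
  ultimately show ?case using Nil.prems(3) by simp
next
  case (Cons w ws)
  have np: "[PairTag] \<notin> fact_words" using fact_words_shape(2) by fastforce
  show ?case
  proof (cases ws')
    case Nil
    then have "w = [PairTag]" using Cons.prems(3) by (cases vs') (auto simp: pair_blocks_def)
    then show ?thesis using Cons.prems(1) np by simp
  next
    case (Cons w' ws'')
    then show ?thesis using Cons.prems Cons.IH[of ws''] by simp
  qed
qed

lemma input_unique:
  assumes ws: "set ws \<subseteq> fact_words" "set ws' \<subseteq> fact_words"
    and vs: "set vs \<subseteq> fact_words \<times> fact_words" "set vs' \<subseteq> fact_words \<times> fact_words"
    and eq: "concat ws @ concat (map pair_word vs) = concat ws' @ concat (map pair_word vs')"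
  shows "ws = ws' \<and> vs = vs'"
proof (rule blocks_unique[OF ws])
  have sets: "set (concat (map pair_blocks vs)) \<subseteq> insert [PairTag] fact_words"
    if "set vs \<subseteq> fact_words \<times> fact_words" for vs
    using that by (auto simp: pair_blocks_def)
  show "ws @ concat (map pair_blocks vs) = ws' @ concat (map pair_blocks vs')"
  proof (rule concat_tagged_unique[where tg = "\<lambda>a. a \<in> {FactTag, PairTag}"])
    show "\<forall>v\<in>set (ws @ concat (map pair_blocks vs)) \<union> set (ws' @ concat (map pair_blocks vs')).
       v \<noteq> [] \<and> hd v \<in> {FactTag, PairTag} \<and> (\<forall>a\<in>set (tl v). a \<notin> {FactTag, PairTag})"
    proof
      fix v assume "v \<in> set (ws @ concat (map pair_blocks vs)) \<union> set (ws' @ concat (map pair_blocks vs'))"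
      then have "v \<in> insert [PairTag] fact_words" using ws sets[OF vs(1)] sets[OF vs(2)] by auto
      then show "v \<noteq> [] \<and> hd v \<in> {FactTag, PairTag} \<and> (\<forall>a\<in>set (tl v). a \<notin> {FactTag, PairTag})"
        using fact_words_shape[of v] by auto
    qed
  qed (simp add: concat_pair_blocks eq)
qed

lemma facts_pairs_of:
  assumes ws: "set ws \<subseteq> fact_words" and vs: "set vs \<subseteq> fact_words \<times> fact_words"
    and w: "w = concat ws @ concat (map pair_word vs)"
  shows "facts_of w = set ws" "pairs_of w = set vs"
proof -
  show "facts_of w = set ws"
  proof (intro set_eqI iffI)
    fix s assume "s \<in> facts_of w"
    then obtain a b c d where "w = a @ s @ c @ d" "a \<in> kstar fact_words" "s \<in> fact_words"
      "c \<in> kstar fact_words" "d \<in> kstar pair_words" unfolding facts_of_def inputs_def by (auto elim: concE)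
    moreover from this obtain wa wc vd where "set wa \<subseteq> fact_words" "a = concat wa" "set wc \<subseteq> fact_words" "c = concat wc"
      "set vd \<subseteq> fact_words \<times> fact_words" "d = concat (map pair_word vd)"
      unfolding kstar_fact_words kstar_pair_words by blast
    ultimately have "ws = wa @ s # wc" using input_unique[of ws "wa @ s # wc" vs vd] ws vs w by simp
    then show "s \<in> set ws" by simp
  next
    fix s assume "s \<in> set ws"
    then obtain wa wc where ws': "ws = wa @ s # wc" by (meson split_list)
    then have "w = concat wa @ s @ (concat wc @ concat (map pair_word vs))" using w by simp
    moreover have "concat wc @ concat (map pair_word vs) \<in> inputs"
      unfolding inputs_def by (rule concI) (use ws vs ws' kstar_fact_words kstar_pair_words in auto)
    moreover have "concat wa \<in> kstar fact_words" using ws ws' kstar_fact_words by auto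
    ultimately show "s \<in> facts_of w" using ws ws' unfolding facts_of_def by auto
  qed
  show "pairs_of w = set vs"
  proof (intro set_eqI iffI)
    fix p assume "p \<in> pairs_of w"
    then obtain a b s t c where p: "p = (s, t)" and "w = a @ b @ pair_word (s, t) @ c" "a \<in> kstar fact_words" "b \<in> kstar pair_words"
      "s \<in> fact_words" "t \<in> fact_words" "c \<in> kstar pair_words" unfolding pairs_of_def inputs_def by (auto elim: concE)
    moreover from this obtain wa vb vc where "set wa \<subseteq> fact_words" "a = concat wa" "set vb \<subseteq> fact_words \<times> fact_words"
      "b = concat (map pair_word vb)" "set vc \<subseteq> fact_words \<times> fact_words" "c = concat (map pair_word vc)"
      unfolding kstar_fact_words kstar_pair_words by blast
    ultimately have "vs = vb @ (s, t) # vc" using input_unique[of ws wa vs "vb @ (s, t) # vc"] ws vs w by simp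
    then show "p \<in> set vs" using p by simp
  next
    fix p assume p: "p \<in> set vs"
    then obtain vb vc where vs': "vs = vb @ p # vc" by (meson split_list)
    obtain s t where st: "p = (s, t)" by (cases p)
    have "w = (concat ws @ concat (map pair_word vb)) @ pair_word (s, t) @ concat (map pair_word vc)" using w vs' st by simp
    moreover have "concat ws @ concat (map pair_word vb) \<in> inputs"
      unfolding inputs_def by (rule concI) (use ws vs vs' kstar_fact_words kstar_pair_words in auto)
    moreover have "concat (map pair_word vc) \<in> kstar pair_words" using vs vs' kstar_pair_words by auto
    moreover have "s \<in> fact_words" "t \<in> fact_words" using vs p st by auto
    ultimately show "p \<in> pairs_of w" unfolding pairs_of_def st by blast
  qed
qed

lemma inputsE:
  assumes "w \<in> inputs"
  obtains ws vs where "set ws \<subseteq> fact_words" "set vs \<subseteq> fact_words \<times> fact_words" "w = concat ws @ concat (map pair_word vs)"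
proof -
  obtain a b where "w = a @ b" "a \<in> kstar fact_words" "b \<in> kstar pair_words"
    using assms unfolding inputs_def by (rule concE)
  then show thesis using that unfolding kstar_fact_words kstar_pair_words by blast
qed

definition Inst :: "sym list \<Rightarrow> ('r, 'd) fact set" where
  "Inst w = dec ` facts_of w"

definition Prio :: "sym list \<Rightarrow> ('r, 'd) prio" where
  "Prio w = (\<lambda>(s, t). (dec s, dec t)) ` pairs_of w"

lemma encodes_facts:
  assumes "list_all2 (encodes_fact rn cn) ws fs" "\<forall>f\<in>set fs. wf_fact S f"
  shows "set ws \<subseteq> fact_words \<and> map dec ws = fs"
  using assms
proof (induction rule: list_all2_induct)
  case (Cons w ws f fs)
  then show ?case using fact_words_iff dec_eq by auto
qed simp

lemma encodes_pairs:
  assumes "list_all2 (encodes_pair rn cn) vs ps" "\<forall>(x, y)\<in>set ps. wf_fact S x \<and> wf_fact S y"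
  shows "\<exists>ab. vs = map pair_word ab \<and> set ab \<subseteq> fact_words \<times> fact_words \<and> map (\<lambda>(s, t). (dec s, dec t)) ab = ps"
  using assms
proof (induction rule: list_all2_induct)
  case (Cons v vs p ps)
  obtain x y where p: "p = (x, y)" by (cases p)
  then obtain s t where st: "encodes_fact rn cn s x" "encodes_fact rn cn t y" "v = PairTag # s @ t" using Cons.hyps by auto
  have wf: "wf_fact S x" "wf_fact S y" using Cons.prems p by auto
  obtain ab where "vs = map pair_word ab" "set ab \<subseteq> fact_words \<times> fact_words" "map (\<lambda>(s, t). (dec s, dec t)) ab = ps"
    using Cons.IH Cons.prems by auto
  then show ?case using st wf p fact_words_iff dec_eq
    by (intro exI[of _ "(s, t) # ab"]) (auto simp: pair_word_def)
qed simp

lemma encodes_input_decode: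
  assumes "encodes_input rn cn w (I, P)" "db_instance S I" "P \<subseteq> I \<times> I"
  shows "w \<in> inputs \<and> Inst w = I \<and> Prio w = P"
proof -
  obtain fs ps ws vs where *: "set fs = I" "set ps = P" "list_all2 (encodes_fact rn cn) ws fs"
    "list_all2 (encodes_pair rn cn) vs ps" "w = concat ws @ concat vs"
    using assms(1) by (auto simp: encodes_list_def)
  have wf: "\<forall>f\<in>set fs. wf_fact S f" "\<forall>(x, y)\<in>set ps. wf_fact S x \<and> wf_fact S y"
    using assms(2,3) * by (auto simp: db_instance_def)
  have ws: "set ws \<subseteq> fact_words" "map dec ws = fs" using encodes_facts[OF *(3) wf(1)] by auto
  obtain ab where ab: "vs = map pair_word ab" "set ab \<subseteq> fact_words \<times> fact_words" "map (\<lambda>(s, t). (dec s, dec t)) ab = ps"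
    using encodes_pairs[OF *(4) wf(2)] by blast
  have w: "w = concat ws @ concat (map pair_word ab)" using * ab by simp
  have "w \<in> inputs" unfolding inputs_def w
    by (rule concI) (use ws ab kstar_fact_words kstar_pair_words in auto)
  moreover have "Inst w = I" unfolding Inst_def facts_pairs_of(1)[OF ws(1) ab(2) w] using ws(2) *(1) by (metis set_map)
  moreover have "Prio w = P" unfolding Prio_def facts_pairs_of(2)[OF ws(1) ab(2) w] using ab(3) *(2) by (metis set_map)
  ultimately show ?thesis by blast
qed

lemma finite_facts_of: "w \<in> inputs \<Longrightarrow> finite (facts_of w)"
  by (metis List.finite_set facts_pairs_of(1) inputsE)

lemma card_pairs_of: "w \<in> inputs \<Longrightarrow> finite (pairs_of w) \<and> card (pairs_of w) \<le> length w"
proof -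
  assume "w \<in> inputs"
  then obtain ws vs where *: "set ws \<subseteq> fact_words" "set vs \<subseteq> fact_words \<times> fact_words" "w = concat ws @ concat (map pair_word vs)"
    by (rule inputsE)
  have "length vs \<le> length (concat (map pair_word vs))"
    by (induction vs) (auto simp: pair_word_def split: prod.splits)
  then show ?thesis unfolding facts_pairs_of(2)[OF *] using * card_length[of vs] by simp
qed

lemma db_instance_Inst: "w \<in> inputs \<Longrightarrow> db_instance S (Inst w)"
  unfolding db_instance_def Inst_def using finite_facts_of dec by (auto simp: facts_of_def)

lemma finite_Prio: "w \<in> inputs \<Longrightarrow> finite (Prio w) \<and> card (Prio w) \<le> length w"
  using card_pairs_of[of w] card_image_le[of "pairs_of w" "\<lambda>(s, t). (dec s, dec t)"]
  unfolding Prio_def by simp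

lemma encodes_input_Inst:
  assumes "w \<in> inputs" shows "encodes_input rn cn w (Inst w, Prio w)"
proof -
  obtain ws vs where *: "set ws \<subseteq> fact_words" "set vs \<subseteq> fact_words \<times> fact_words" "w = concat ws @ concat (map pair_word vs)"
    using assms by (rule inputsE)
  have "list_all2 (encodes_fact rn cn) ws (map dec ws)" using *(1)
    by (induction ws) (use dec in auto)
  moreover have "list_all2 (encodes_pair rn cn) (map pair_word vs) (map (\<lambda>(s, t). (dec s, dec t)) vs)"
    using *(2)
  proof (induction vs)
    case (Cons p vs)
    then show ?case using dec by (cases p) (auto simp: pair_word_def)
  qed simp
  ultimately have "encodes_list (encodes_fact rn cn) (concat ws) (map dec ws)"
    "encodes_list (encodes_pair rn cn) (concat (map pair_word vs)) (map (\<lambda>(s, t). (dec s, dec t)) vs)"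
    unfolding encodes_list_def by blast+
  moreover have "set (map dec ws) = Inst w" "set (map (\<lambda>(s, t). (dec s, dec t)) vs) = Prio w"
    by (simp_all add: Inst_def Prio_def facts_pairs_of[OF *])
  ultimately show ?thesis unfolding encodes_input.simps using *(3) by blast
qed

text \<open>A word determines its input, so the existential over encoded inputs disappears in favour
  of the decoded instance and priority. The facts inside pairs are well-formed because a priority
  lives on the instance.\<close>

lemma language_iff:
  "w \<in> language_of rn cn (preferred_consistent_answers S F Q X) \<longleftrightarrow>
    w \<in> inputs \<and> priority (Inst w) F (Prio w) \<and> (\<forall>J\<in>X (Inst w) F (Prio w). J \<Turnstile> Q)"
proof
  assume "w \<in> language_of rn cn (preferred_consistent_answers S F Q X)"
  then obtain I P where *: "db_instance S I" "priority I F P" "\<forall>J\<in>X I F P. J \<Turnstile> Q" "encodes_input rn cn w (I, P)"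
    unfolding language_of_def preferred_consistent_answers_def by blast
  moreover have "w \<in> inputs \<and> Inst w = I \<and> Prio w = P"
    using encodes_input_decode[OF *(4,1)] *(2) unfolding priority_def by blast
  ultimately show "w \<in> inputs \<and> priority (Inst w) F (Prio w) \<and> (\<forall>J\<in>X (Inst w) F (Prio w). J \<Turnstile> Q)" by simp
next
  assume "w \<in> inputs \<and> priority (Inst w) F (Prio w) \<and> (\<forall>J\<in>X (Inst w) F (Prio w). J \<Turnstile> Q)"
  then show "w \<in> language_of rn cn (preferred_consistent_answers S F Q X)"
    using encodes_input_Inst db_instance_Inst unfolding language_of_def preferred_consistent_answers_def by blast
qed

end

section \<open>Inputs inside padded words\<close>

locale coded_input = schema_code S F rn cn
  for S :: "'r schema" and F :: "'r fd set" and rn :: "'r \<Rightarrow> bool list" and cn :: "'d \<Rightarrow> bool list" +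
  fixes pre :: "sym list"
begin

text \<open>Both ends of a slice have to be positions of the word. The trailing \<open>Minus\<close>
  provides one for the end of the input, and \<open>pre\<close> supplies occurrences of the facts of
  the query.\<close>

definition U :: "sym list set" where
  "U = {pre @ w @ [Minus] | w. True}"

definition input :: "sym list \<Rightarrow> sym list" where
  "input u = slice u (length pre) (length u - 1)"

lemma input_simp: "input (pre @ w @ [Minus]) = w"
  by (simp add: input_def slice_def)

lemma U_cases: "u \<in> U \<Longrightarrow> u = pre @ input u @ [Minus]"
  unfolding U_def using input_simp by auto

lemma U_bounds: "u \<in> U \<Longrightarrow> length pre \<le> length u - 1 \<and> length u - 1 < length u \<and> length (input u) < length u"
  using U_cases[of u] by (metis add_diff_cancel_right' le_add1 length_append length_append_singleton
      less_add_Suc1 add.commute diff_Suc_1 lessI add_Suc_right le_imp_less_Suc le_add2)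

lemma infix_slice:
  assumes "u = a @ s @ c" "c \<noteq> []"
  shows "\<exists>x<length u. \<exists>y<length u. s = slice u x y"
proof -
  have "s = slice u (length a) (length a + length s)" using assms by (simp add: slice_def)
  moreover have "length a + length s < length u" using assms by (cases c) auto
  ultimately show ?thesis by (metis add_lessD1)
qed

lemma input_infix_slice:
  assumes "u \<in> U" "input u = a @ s @ c"
  shows "\<exists>x<length u. \<exists>y<length u. s = slice u x y"
  using infix_slice[of u "pre @ a" s "c @ [Minus]"] U_cases[OF assms(1)] assms(2) by simp

lemma definable_last: "definable U (\<lambda>u D e. e i = length u - 1)"
proof (rule definable_cong)
  show "definable U (\<lambda>u D e. \<forall>y<length u. y \<le> e i)" by (intro definable_intros)
  fix u :: "sym list" and e :: "nat \<Rightarrow> nat" assume "\<forall>i. e i < length u"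
  then have "e i < length u" by blast
  then show "(\<forall>y<length u. y \<le> e i) = (e i = length u - 1)"
    by (metis One_nat_def Suc_pred diff_less le_antisym less_Suc_eq_le less_nat_zero_code gr0I zero_less_one)
qed

lemma definable_input:
  fixes P :: "sym list \<Rightarrow> (nat \<Rightarrow> nat list \<Rightarrow> bool) \<Rightarrow> (nat \<Rightarrow> nat) \<Rightarrow> sym list \<Rightarrow> bool"
  assumes "definable U (\<lambda>u D e. P u D (\<lambda>i. e (Suc (Suc i))) (slice u (e (Suc 0)) (e 0)))"
  shows "definable U (\<lambda>u D e. P u D e (input u))"
proof (rule definable_cong)
  show "definable U (\<lambda>u D e. \<exists>s<length u. \<exists>t<length u. s = length pre \<and> t = length u - 1 \<and> P u D e (slice u s t))"
    by (intro definable_intros definable_nat definable_last assms)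
  fix u D and e :: "nat \<Rightarrow> nat" assume "u \<in> U"
  then show "(\<exists>s<length u. \<exists>t<length u. s = length pre \<and> t = length u - 1 \<and> P u D e (slice u s t)) = P u D e (input u)"
    using U_bounds[of u] unfolding input_def by auto
qed

lemma segdef_inputs: "segdef U inputs"
  unfolding inputs_def pair_words_def
  by (intro segdef_conc segdef_kstar segdef_fact_words segdef_word)

lemma segdef_kstar_pair_words: "segdef U (kstar pair_words)"
  unfolding pair_words_def by (intro segdef_conc segdef_kstar segdef_fact_words segdef_word)

definition is_fact_at :: "sym list \<Rightarrow> nat \<Rightarrow> nat \<Rightarrow> bool" where
  "is_fact_at u x y \<longleftrightarrow> (\<exists>s<length u. \<exists>t<length u. s = length pre \<and> t = length u - 1 \<and> s \<le> x \<and> y \<le> t \<and>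
     slice u s x \<in> kstar fact_words \<and> slice u x y \<in> fact_words \<and> slice u y t \<in> inputs)"

lemma definable_is_fact_at: "definable U (\<lambda>u D e. is_fact_at u (e i) (e j))"
  unfolding is_fact_at_def
  by (intro definable_intros definable_nat definable_last segdefD segdef_kstar segdef_fact_words segdef_inputs)

lemma facts_of_input:
  assumes "u \<in> U"
  shows "s \<in> facts_of (input u) \<longleftrightarrow> (\<exists>x<length u. \<exists>y<length u. is_fact_at u x y \<and> s = slice u x y)"
proof
  note b = U_bounds[OF assms]
  assume "s \<in> facts_of (input u)"
  then obtain a c where *: "input u = a @ s @ c" "a \<in> kstar fact_words" "s \<in> fact_words" "c \<in> inputs"
    unfolding facts_of_def by blast
  obtain x where x: "x < length u" "length pre \<le> x" "x \<le> length u - 1" "a = slice u (length pre) x" "s @ c = slice u x (length u - 1)"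
    using *(1) slice_split[of "length pre" u "length u - 1" a "s @ c"] b unfolding input_def by auto
  obtain y where y: "y < length u" "x \<le> y" "y \<le> length u - 1" "s = slice u x y" "c = slice u y (length u - 1)"
    using x slice_split[of x u "length u - 1" s c] b by auto
  have "is_fact_at u x y" unfolding is_fact_at_def using x y * b by auto
  then show "\<exists>x<length u. \<exists>y<length u. is_fact_at u x y \<and> s = slice u x y" using x y by blast
next
  assume "\<exists>x<length u. \<exists>y<length u. is_fact_at u x y \<and> s = slice u x y"
  then obtain x y where *: "x < length u" "y < length u" "length pre \<le> x" "y \<le> length u - 1"
    "slice u (length pre) x \<in> kstar fact_words" "slice u x y \<in> fact_words" "slice u y (length u - 1) \<in> inputs" "s = slice u x y"
    unfolding is_fact_at_def by auto
  have "slice u x y \<noteq> []" using *(6) fact_words_shape(1) by blast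
  then have "x < y" using slice_eq_Nil[OF *(1)] by auto
  then have "input u = slice u (length pre) x @ slice u x y @ slice u y (length u - 1)"
    unfolding input_def using slice_append[of x y "length u - 1" u] slice_append[of "length pre" x "length u - 1" u] * by simp
  then show "s \<in> facts_of (input u)" unfolding facts_of_def using * by blast
qed

definition eq_word :: "sym list \<Rightarrow> sym list \<Rightarrow> bool" where
  "eq_word = same_on_word (\<lambda>r. {..<length (the (S r))})"

lemma same_on_eq:
  assumes "wf_fact S f" "wf_fact S g"
  shows "same_on (\<lambda>r. {..<length (the (S r))}) f g \<longleftrightarrow> f = g"
proof
  assume *: "same_on (\<lambda>r. {..<length (the (S r))}) f g"
  then have "length (args f) = length (the (S (rel f)))" "length (args g) = length (the (S (rel f)))"
    using assms unfolding same_on_def wf_fact_def by (auto dest: list_all2_lengthD)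
  then have "args f = args g" using * unfolding same_on_def agree_on_def by (intro nth_equalityI) auto
  then show "f = g" using * unfolding same_on_def by (cases f; cases g) auto
qed (simp add: same_on_def agree_on_def)

lemma word_rel_eq: "word_rel (=) eq_word"
proof -
  have "word_rel (same_on (\<lambda>r. {..<length (the (S r))})) eq_word"
    unfolding eq_word_def by (rule word_rel_same_on) auto
  note * = this[unfolded word_rel_def]
  show ?thesis unfolding word_rel_def
  proof (rule conjI[OF conjunct1[OF *]], intro ballI)
    fix v w assume "v \<in> fact_words" "w \<in> fact_words"
    then show "eq_word v w = (dec v = dec w)"
      using conjunct2[OF *] same_on_eq[of "dec v" "dec w"] dec by simp
  qed
qed

lemma word_rel_definable: "word_rel R W \<Longrightarrow> definable V (\<lambda>u D e. W (slice u (e i) (e j)) (slice u (e k) (e l)))"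
  unfolding word_rel_def by blast

lemma word_rel_iff: "word_rel R W \<Longrightarrow> v \<in> fact_words \<Longrightarrow> w \<in> fact_words \<Longrightarrow> W v w = R (dec v) (dec w)"
  unfolding word_rel_def by blast

text \<open>The nesting of existentials is the one produced by \<open>definable_split\<close>. The
  search is for any encoded fact that decodes to the same fact as \<open>s\<close>, not for the word
  \<open>s\<close> itself.\<close>

definition fact_at :: "sym list \<Rightarrow> sym list \<Rightarrow> bool" where
  "fact_at w s \<longleftrightarrow> (\<exists>a b. w = a @ b \<and> (\<exists>t c. b = t @ c \<and> (a \<in> kstar fact_words \<and> t \<in> fact_words \<and> c \<in> inputs \<and> eq_word t s)))"

definition pair_at :: "sym list \<Rightarrow> (sym list \<Rightarrow> sym list \<Rightarrow> bool) \<Rightarrow> bool" where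
  "pair_at w R \<longleftrightarrow> (\<exists>a b. w = a @ b \<and> (\<exists>c d. b = c @ d \<and> (\<exists>s g. d = s @ g \<and> (\<exists>t h. g = t @ h \<and>
     (a \<in> inputs \<and> c \<in> {[PairTag]} \<and> s \<in> fact_words \<and> t \<in> fact_words \<and> h \<in> kstar pair_words \<and> R s t)))))"

lemma fact_at_iff:
  assumes s: "s \<in> fact_words" shows "fact_at w s \<longleftrightarrow> dec s \<in> Inst w"
proof
  assume "fact_at w s"
  then obtain a b t c where *: "w = a @ b" "b = t @ c" "a \<in> kstar fact_words" "t \<in> fact_words" "c \<in> inputs" "eq_word t s"
    unfolding fact_at_def by (elim exE conjE) (rule that)
  then have "t \<in> facts_of w" unfolding facts_of_def by blast
  moreover have "dec t = dec s" using word_rel_iff[OF word_rel_eq *(4) s] *(6) by simp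
  ultimately show "dec s \<in> Inst w" unfolding Inst_def by (metis imageI)
next
  assume "dec s \<in> Inst w"
  then obtain t where t: "t \<in> facts_of w" "dec s = dec t" unfolding Inst_def by (elim imageE)
  then obtain a c where *: "w = a @ t @ c" "a \<in> kstar fact_words" "t \<in> fact_words" "c \<in> inputs"
    unfolding facts_of_def by blast
  have e: "eq_word t s" using word_rel_iff[OF word_rel_eq *(3) s] t(2) by simp
  show "fact_at w s" unfolding fact_at_def
    by (rule exI[of _ a], rule exI[of _ "t @ c"], rule conjI[OF *(1)], rule exI[of _ t], rule exI[of _ c],
        rule conjI[OF refl], intro conjI * e)
qed

lemma pair_at_iff: "pair_at w R \<longleftrightarrow> (\<exists>(s, t)\<in>pairs_of w. R s t)"
proof
  assume "pair_at w R"
  then obtain a b c d s g t h where "w = a @ b" "b = c @ d" "d = s @ g" "g = t @ h"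
    and *: "a \<in> inputs" "c \<in> {[PairTag]}" "s \<in> fact_words" "t \<in> fact_words"
    "h \<in> kstar pair_words" "R s t" unfolding pair_at_def by (elim exE conjE) (rule that)
  then have "w = a @ pair_word (s, t) @ h" by (simp add: pair_word_def)
  then have "(s, t) \<in> pairs_of w" unfolding pairs_of_def using * by blast
  then show "\<exists>(s, t)\<in>pairs_of w. R s t" using *(6) by blast
next
  assume "\<exists>(s, t)\<in>pairs_of w. R s t"
  then obtain s t a h where *: "w = a @ [PairTag] @ s @ t @ h" "a \<in> inputs" "s \<in> fact_words" "t \<in> fact_words"
    "h \<in> kstar pair_words" "R s t" unfolding pairs_of_def pair_word_def by auto
  show "pair_at w R" unfolding pair_at_def
    by (rule exI[of _ a], rule exI[of _ "[PairTag] @ s @ t @ h"], rule conjI[OF *(1)], rule exI[of _ "[PairTag]"],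
        rule exI[of _ "s @ t @ h"], rule conjI[OF refl], rule exI[of _ s], rule exI[of _ "t @ h"], rule conjI[OF refl],
        rule exI[of _ t], rule exI[of _ h], rule conjI[OF refl], intro conjI singletonI *)
qed

definition pair_rel :: "sym list \<Rightarrow> sym list \<Rightarrow> sym list \<Rightarrow> bool" where
  "pair_rel w v v' \<longleftrightarrow> v \<in> fact_words \<and> v' \<in> fact_words \<and> pair_at w (\<lambda>s t. eq_word s v \<and> eq_word t v')"

lemma pair_rel_iff: "pair_rel w v v' \<longleftrightarrow> v \<in> fact_words \<and> v' \<in> fact_words \<and> (dec v, dec v') \<in> Prio w"
proof (cases "v \<in> fact_words \<and> v' \<in> fact_words")
  case True
  have "eq_word s v \<and> eq_word t v' \<longleftrightarrow> dec s = dec v \<and> dec t = dec v'" if "(s, t) \<in> pairs_of w" for s t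
  proof -
    have "s \<in> fact_words" "t \<in> fact_words" using that unfolding pairs_of_def by blast+
    then show ?thesis using word_rel_iff[OF word_rel_eq] True by simp
  qed
  then have "(\<exists>(s, t)\<in>pairs_of w. eq_word s v \<and> eq_word t v') \<longleftrightarrow> (\<exists>(s, t)\<in>pairs_of w. dec s = dec v \<and> dec t = dec v')"
    by (intro bex_cong) auto
  also have "\<dots> \<longleftrightarrow> (dec v, dec v') \<in> Prio w" unfolding Prio_def image_iff
    by (rule bex_cong) auto
  finally show ?thesis unfolding pair_rel_def pair_at_iff using True by simp
qed (auto simp: pair_rel_def)

lemma definable_fact_at: "definable U (\<lambda>u D e. fact_at (input u) (slice u (e i) (e j)))"
proof (rule definable_input[where P = "\<lambda>u D e w. fact_at w (slice u (e i) (e j))"])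
  show "definable U (\<lambda>u D e. fact_at (slice u (e (Suc 0)) (e 0)) (slice u (e (Suc (Suc i))) (e (Suc (Suc j)))))"
    unfolding fact_at_def
    by (intro definable_split definable_conj segdefD segdef_kstar segdef_fact_words segdef_inputs
        word_rel_definable[OF word_rel_eq])
qed

text \<open>The shift by 6 counts the positions bound on the way to \<open>R\<close>: the two end
  points of the input and the four cuts around the tag and the two facts.\<close>

lemma definable_pair_at:
  fixes R :: "sym list \<Rightarrow> (nat \<Rightarrow> nat) \<Rightarrow> sym list \<Rightarrow> sym list \<Rightarrow> bool"
  assumes "\<And>i j k l. definable U (\<lambda>u D e. R u (\<lambda>i. e (i + 6)) (slice u (e i) (e j)) (slice u (e k) (e l)))"
  shows "definable U (\<lambda>u D e. pair_at (input u) (R u e))"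
proof (rule definable_input[where P = "\<lambda>u D e w. pair_at w (R u e)"])
  show "definable U (\<lambda>u D e. pair_at (slice u (e (Suc 0)) (e 0)) (R u (\<lambda>i. e (Suc (Suc i)))))"
    unfolding pair_at_def
    by (rule definable_split, rule definable_split, rule definable_split, rule definable_split,
        intro definable_conj segdefD segdef_kstar_pair_words segdef_fact_words segdef_inputs segdef_word)
      (use assms in \<open>simp add: numeral_eq_Suc\<close>)
qed

lemma definable_pair_rel: "definable U (\<lambda>u D e. pair_rel (input u) (slice u (e i) (e j)) (slice u (e k) (e l)))"
  unfolding pair_rel_def
  by (intro definable_conj segdefD segdef_fact_words
      definable_pair_at[where R = "\<lambda>u e s t. eq_word s (slice u (e i) (e j)) \<and> eq_word t (slice u (e k) (e l))"]
      word_rel_definable[OF word_rel_eq])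

lemma pairs_of_slice:
  assumes "u \<in> U" "(s, t) \<in> pairs_of (input u)"
  shows "\<exists>x<length u. \<exists>y<length u. s = slice u x y"
proof -
  obtain a b where "input u = (a @ [PairTag]) @ s @ (t @ b)"
    using assms(2) unfolding pairs_of_def pair_word_def by auto
  then show ?thesis using input_infix_slice[OF assms(1)] by blast
qed

text \<open>Recursion on the number of steps, with the end point of the path as the remaining
  coordinates. An intermediate fact is the first component of some pair of the priority, hence has a
  code among the slices of the word.\<close>

lemma definable_relpow:
  "definable U (\<lambda>u D e. slice u (e a) (e b) \<in> fact_words \<and> slice u (e i) (e j) \<in> fact_words \<and>
     (dec (slice u (e a) (e b)), dec (slice u (e i) (e j))) \<in> Prio (input u) ^^ e n)"
proof (rule definable_rec3[where P = "\<lambda>u e n x y. slice u (e a) (e b) \<in> fact_words \<and> slice u x y \<in> fact_words \<and>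
     (dec (slice u (e a) (e b)), dec (slice u x y)) \<in> Prio (input u) ^^ n"])
  let ?S = "\<lambda>i. Suc (Suc (Suc i))"
  show "definable U (\<lambda>u D e. (e 0 = 0 \<and> slice u (e (?S a)) (e (?S b)) \<in> fact_words \<and> slice u (e 1) (e 2) \<in> fact_words \<and>
       eq_word (slice u (e (?S a)) (e (?S b))) (slice u (e 1) (e 2))) \<or>
     (\<exists>m<length u. e 0 = Suc m \<and> (\<exists>x<length u. \<exists>y<length u. D 0 [m, x, y] \<and>
       pair_rel (input u) (slice u x y) (slice u (e 1) (e 2)))))"
    by (intro definable_intros definable_nat definable_Suc segdefD segdef_fact_words
        word_rel_definable[OF word_rel_eq] definable_pair_rel)
next
  fix u X and e :: "nat \<Rightarrow> nat" and n x y
  assume u: "u \<in> U" and n: "n < length u" and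
    X: "\<And>m x y. m < n \<Longrightarrow> x < length u \<Longrightarrow> y < length u \<Longrightarrow> X m x y =
      (slice u (e a) (e b) \<in> fact_words \<and> slice u x y \<in> fact_words \<and>
       (dec (slice u (e a) (e b)), dec (slice u x y)) \<in> Prio (input u) ^^ m)"
  let ?v = "slice u (e a) (e b)" and ?w = "slice u x y" and ?P = "Prio (input u)"
  show "((n = 0 \<and> ?v \<in> fact_words \<and> ?w \<in> fact_words \<and> eq_word ?v ?w) \<or>
     (\<exists>m<length u. n = Suc m \<and> (\<exists>x<length u. \<exists>y<length u. X m x y \<and> pair_rel (input u) (slice u x y) ?w))) =
     (?v \<in> fact_words \<and> ?w \<in> fact_words \<and> (dec ?v, dec ?w) \<in> ?P ^^ n)" (is "?L = ?R")
  proof (cases n)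
    case 0
    then show ?thesis using word_rel_iff[OF word_rel_eq, of ?v ?w] by auto
  next
    case (Suc m)
    have m: "m < n" "m < length u" using Suc n by auto
    show ?thesis
    proof
      assume ?L
      then obtain x' y' where "x' < length u" "y' < length u" "X m x' y'" "pair_rel (input u) (slice u x' y') ?w"
        using Suc by auto
      then show ?R using X[OF m(1)] unfolding Suc pair_rel_iff by auto
    next
      assume R: ?R
      then obtain h where h: "(dec ?v, h) \<in> ?P ^^ m" "(h, dec ?w) \<in> ?P" unfolding Suc by auto
      then obtain s t where st: "(s, t) \<in> pairs_of (input u)" "h = dec s" unfolding Prio_def by auto
      obtain x' y' where xy: "x' < length u" "y' < length u" "s = slice u x' y'" using pairs_of_slice[OF u st(1)] by blast
      have "s \<in> fact_words" using st(1) unfolding pairs_of_def by blast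
      then have "X m x' y'" "pair_rel (input u) (slice u x' y') ?w"
        using X[OF m(1) xy(1,2)] R h st xy unfolding pair_rel_iff by auto
      then show ?L using Suc m xy by blast
    qed
  qed
qed

text \<open>A cycle may be taken to have at most \<open>card P\<close> steps, and each pair occupies
  part of the word; so the number of steps is a position and can be quantified over.\<close>

lemma definable_acyclic:
  "\<exists>Q. definable U Q \<and> (\<forall>u\<in>U. \<forall>D e. input u \<in> inputs \<longrightarrow> Q u D e = acyclic (Prio (input u)))"
proof (intro exI conjI ballI allI impI)
  show "definable U (\<lambda>u D e. \<forall>n<length u. \<forall>x<length u. \<forall>y<length u. \<not> n = 0 \<longrightarrow>
     \<not> (slice u x y \<in> fact_words \<and> slice u x y \<in> fact_words \<and> (dec (slice u x y), dec (slice u x y)) \<in> Prio (input u) ^^ n))"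
    by (intro definable_all definable_imp definable_not definable_nat definable_relpow)
  fix u D and e :: "nat \<Rightarrow> nat" assume u: "u \<in> U" "input u \<in> inputs"
  let ?P = "Prio (input u)"
  have fin: "finite ?P" "card ?P < length u" using finite_Prio[OF u(2)] U_bounds[OF u(1)] by auto
  show "(\<forall>n<length u. \<forall>x<length u. \<forall>y<length u. \<not> n = 0 \<longrightarrow>
     \<not> (slice u x y \<in> fact_words \<and> slice u x y \<in> fact_words \<and> (dec (slice u x y), dec (slice u x y)) \<in> ?P ^^ n)) = acyclic ?P"
    (is "?L = ?R")
  proof
    assume L: ?L
    show ?R unfolding acyclic_def
    proof (intro allI notI)
      fix f assume "(f, f) \<in> ?P\<^sup>+"
      then obtain n where n: "0 < n" "n \<le> card ?P" "(f, f) \<in> ?P ^^ n"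
        using trancl_finite_eq_relpow[OF fin(1)] by auto
      then obtain g where "(f, g) \<in> ?P" by (metis relpow_E2 gr_implies_not0)
      then obtain s t where st: "(s, t) \<in> pairs_of (input u)" "f = dec s" unfolding Prio_def by auto
      obtain x y where "x < length u" "y < length u" "s = slice u x y" using pairs_of_slice[OF u(1) st(1)] by blast
      moreover have "s \<in> fact_words" using st(1) unfolding pairs_of_def by blast
      ultimately show False using L n fin(2) st(2) by auto
    qed
  next
    assume R: ?R
    have "(f, f) \<notin> ?P ^^ n" if "n \<noteq> 0" for f n
    proof
      assume "(f, f) \<in> ?P ^^ n"
      then have "(f, f) \<in> ?P\<^sup>+" unfolding trancl_power using that by blast
      then show False using R unfolding acyclic_def by blast
    qed
    then show ?L by blast
  qed
qed

end

section \<open>Preferred repairs for one dependency per relation name\<close>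

fun query_facts :: "('r, 'd) query \<Rightarrow> ('r, 'd) fact set" where
  "query_facts (QFact f) = {f}"
| "query_facts (QRat _ _ _) = {}"
| "query_facts (QName _ _ _) = {}"
| "query_facts (QNot q) = query_facts q"
| "query_facts (QAnd q r) = query_facts q \<union> query_facts r"
| "query_facts (QOr q r) = query_facts q \<union> query_facts r"

lemma finite_query_facts: "finite (query_facts Q)"
  by (induction Q) auto

lemma satisfies_Int: "query_facts Q \<subseteq> A \<Longrightarrow> J \<inter> A \<Turnstile> Q \<longleftrightarrow> J \<Turnstile> Q"
  by (induction Q) auto

lemma wf_query_facts: "wf_query S Q \<Longrightarrow> f \<in> query_facts Q \<Longrightarrow> wf_fact S f"
  by (induction Q) auto

lemma finite_acyclic_minimal:
  assumes "acyclic P" "finite P" "A \<noteq> {}"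
  shows "\<exists>m\<in>A. \<forall>y\<in>A. (y, m) \<notin> P"
proof -
  have "wf P" using assms finite_acyclic_wf by blast
  moreover obtain x where "x \<in> A" using assms(3) by blast
  ultimately obtain m where "m \<in> A" "\<And>y. (y, m) \<in> P \<Longrightarrow> y \<notin> A" by (rule wfE_min) blast
  then show ?thesis by blast
qed

context schema_code
begin

text \<open>With one dependency per relation name, a fact conflicts with exactly the facts of its cluster that
  lie outside its part.\<close>

definition lhs_of :: "'r \<Rightarrow> nat set" where
  "lhs_of r = (\<Union>d\<in>{d \<in> F. fd_rel d = r}. fd_lhs d)"

text \<open>For a relation name without a dependency this set and \<open>lhs_of\<close> are both
  empty: all its facts form one part of one cluster, in accordance with the absence of
  conflicts.\<close>

definition attrs_of :: "'r \<Rightarrow> nat set" where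
  "attrs_of r = (\<Union>d\<in>{d \<in> F. fd_rel d = r}. fd_lhs d \<union> fd_rhs d)"

abbreviation clus :: "('r, 'd) fact \<Rightarrow> ('r, 'd) fact \<Rightarrow> bool" where
  "clus \<equiv> same_on lhs_of"

abbreviation part :: "('r, 'd) fact \<Rightarrow> ('r, 'd) fact \<Rightarrow> bool" where
  "part \<equiv> same_on attrs_of"

lemma same_on_refl: "same_on A f f"
  and same_on_sym: "same_on A f g \<Longrightarrow> same_on A g f"
  and same_on_trans: "same_on A f g \<Longrightarrow> same_on A g h \<Longrightarrow> same_on A f h"
  by (auto simp: same_on_def agree_on_def)

lemma part_clus: "part f g \<Longrightarrow> clus f g"
  by (auto simp: same_on_def agree_on_def lhs_of_def attrs_of_def)

lemma fd_holds_iff: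
  assumes d: "d \<in> F"
  shows "fd_holds J d \<longleftrightarrow> (\<forall>f\<in>J. \<forall>g\<in>J. rel f = fd_rel d \<longrightarrow> clus f g \<longrightarrow> part f g)"
proof -
  \<comment> \<open>The restriction to at most one dependency per relation name enters here.\<close>
  have "{d' \<in> F. fd_rel d' = fd_rel d} = {d}" using d inj_F by (auto simp: inj_on_def)
  then have "lhs_of (fd_rel d) = fd_lhs d" "attrs_of (fd_rel d) = fd_lhs d \<union> fd_rhs d"
    by (simp_all add: lhs_of_def attrs_of_def)
  then have "rel f = fd_rel d \<Longrightarrow> (clus f g \<longleftrightarrow> rel g = fd_rel d \<and> agree_on (fd_lhs d) f g) \<and>
      (part f g \<longleftrightarrow> rel g = fd_rel d \<and> agree_on (fd_lhs d) f g \<and> agree_on (fd_rhs d) f g)" for f g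
    by (auto simp: same_on_def agree_on_def)
  then show ?thesis unfolding fd_holds_def by blast
qed

lemma consistent_iff: "consistent F J \<longleftrightarrow> (\<forall>f\<in>J. \<forall>g\<in>J. clus f g \<longrightarrow> part f g)"
proof
  assume "consistent F J"
  then have c: "\<And>d. d \<in> F \<Longrightarrow> \<forall>f\<in>J. \<forall>g\<in>J. rel f = fd_rel d \<longrightarrow> clus f g \<longrightarrow> part f g"
    unfolding consistent_def using fd_holds_iff by blast
  show "\<forall>f\<in>J. \<forall>g\<in>J. clus f g \<longrightarrow> part f g"
  proof (intro ballI impI)
    fix f g assume fg: "f \<in> J" "g \<in> J" "clus f g"
    show "part f g"
    proof (cases "\<exists>d\<in>F. fd_rel d = rel f")
      case True
      then obtain d where "d \<in> F" "rel f = fd_rel d" by metis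
      then show ?thesis using c fg by blast
    next
      case False
      then have "attrs_of (rel f) = {}" unfolding attrs_of_def by blast
      then show ?thesis using fg(3) by (simp add: same_on_def agree_on_def)
    qed
  qed
qed (auto simp: consistent_def fd_holds_iff)

lemma neighbors_iff: "neighbors I F f g \<longleftrightarrow> f \<in> I \<and> g \<in> I \<and> clus f g \<and> \<not> part f g"
proof -
  have "(\<exists>d\<in>F. \<not> fd_holds {f, g} d) \<longleftrightarrow> \<not> consistent F {f, g}" by (simp add: consistent_def)
  also have "\<dots> \<longleftrightarrow> clus f g \<and> \<not> part f g"
    unfolding consistent_iff using same_on_sym same_on_refl by blast
  finally show ?thesis unfolding neighbors_def by simp
qed

text \<open>Maximality splits in two: a fact whose cluster is not yet represented, and a missing
  fact of a chosen part, could each be added without creating a conflict. Conversely, any added fact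
  would share its cluster with a chosen part and so belong to that part.\<close>

lemma repair_iff:
  "repair I F J \<longleftrightarrow> J \<subseteq> I \<and> (\<forall>f\<in>J. \<forall>g\<in>J. clus f g \<longrightarrow> part f g) \<and> (\<forall>f\<in>I. \<exists>g\<in>J. clus f g) \<and>
     (\<forall>f\<in>J. \<forall>g\<in>I. part f g \<longrightarrow> g \<in> J)"
proof
  assume r: "repair I F J"
  then have J: "J \<subseteq> I" "\<forall>f\<in>J. \<forall>g\<in>J. clus f g \<longrightarrow> part f g"
    and max: "\<And>K. J \<subseteq> K \<Longrightarrow> K \<subseteq> I \<Longrightarrow> \<forall>f\<in>K. \<forall>g\<in>K. clus f g \<longrightarrow> part f g \<Longrightarrow> K = J"
    unfolding repair_def consistent_iff by blast+
  have "\<exists>g\<in>J. clus f g" if f: "f \<in> I" for f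
  proof (rule ccontr)
    assume n: "\<not> (\<exists>g\<in>J. clus f g)"
    have "insert f J = J"
      by (rule max) (use n f J same_on_sym same_on_refl in blast)+
    then show False using n same_on_refl by blast
  qed
  moreover have "g \<in> J" if fg: "f \<in> J" "g \<in> I" "part f g" for f g
  proof -
    have *: "part g h" if "h \<in> J" "clus g h" for h
    proof -
      have "clus f h" using fg(3) part_clus that(2) same_on_trans by blast
      then have "part f h" using J fg(1) that(1) by blast
      then show ?thesis using fg(3) same_on_sym same_on_trans by blast
    qed
    have "insert g J = J"
    proof (rule max)
      show "\<forall>f\<in>insert g J. \<forall>h\<in>insert g J. clus f h \<longrightarrow> part f h"
        using * J(2) same_on_sym same_on_refl by blast
    qed (use fg J in auto)
    then show ?thesis by blast
  qed
  ultimately show "J \<subseteq> I \<and> (\<forall>f\<in>J. \<forall>g\<in>J. clus f g \<longrightarrow> part f g) \<and> (\<forall>f\<in>I. \<exists>g\<in>J. clus f g) \<and>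
     (\<forall>f\<in>J. \<forall>g\<in>I. part f g \<longrightarrow> g \<in> J)" using J by blast
next
  assume J: "J \<subseteq> I \<and> (\<forall>f\<in>J. \<forall>g\<in>J. clus f g \<longrightarrow> part f g) \<and> (\<forall>f\<in>I. \<exists>g\<in>J. clus f g) \<and>
     (\<forall>f\<in>J. \<forall>g\<in>I. part f g \<longrightarrow> g \<in> J)"
  have max: "K = J" if K: "J \<subseteq> K" "K \<subseteq> I" "\<forall>f\<in>K. \<forall>g\<in>K. clus f g \<longrightarrow> part f g" for K
  proof -
    have "k \<in> J" if k: "k \<in> K" for k
    proof -
      obtain g where g: "g \<in> J" "clus k g" using J K k by blast
      then have "part k g" using K k by blast
      then have "part g k" by (rule same_on_sym)
      then show ?thesis using J K k g by blast
    qed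
    then show ?thesis using K by blast
  qed
  show "repair I F J" unfolding repair_def consistent_iff
  proof (intro conjI allI impI)
    show "J \<subseteq> I" "\<forall>f\<in>J. \<forall>g\<in>J. clus f g \<longrightarrow> part f g" using J by blast+
  qed (elim conjE, rule max)
qed

lemma priorityD:
  assumes "priority I F P" "(x, y) \<in> P"
  shows "x \<in> I" "y \<in> I" "clus x y" "\<not> part x y"
  using assms unfolding priority_def neighbors_iff by auto

section \<open>Good parts and the three notions of optimality\<close>

definition good_P :: "('r, 'd) fact set \<Rightarrow> ('r, 'd) prio \<Rightarrow> ('r, 'd) fact \<Rightarrow> bool" where
  "good_P I P f \<longleftrightarrow> \<not> (\<exists>y\<in>I. \<forall>x\<in>I. part f x \<longrightarrow> (y, x) \<in> P)"

text \<open>Nothing needs to force \<open>z\<close> into the cluster of \<open>f\<close>: for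
  \<open>f\<close> in the instance, \<open>x = f\<close> yields a fact of the part of
  \<open>z\<close> that is in conflict with \<open>f\<close>. So \<open>z\<close> represents another
  part of the same cluster.\<close>

definition good_G :: "('r, 'd) fact set \<Rightarrow> ('r, 'd) prio \<Rightarrow> ('r, 'd) fact \<Rightarrow> bool" where
  "good_G I P f \<longleftrightarrow> \<not> (\<exists>z\<in>I. \<forall>x\<in>I. part f x \<longrightarrow> (\<exists>y\<in>I. part z y \<and> (y, x) \<in> P))"

definition good_C :: "('r, 'd) fact set \<Rightarrow> ('r, 'd) prio \<Rightarrow> ('r, 'd) fact \<Rightarrow> bool" where
  "good_C I P f \<longleftrightarrow> (\<exists>m\<in>I. part f m \<and> (\<forall>y\<in>I. (y, m) \<notin> P))"

lemma part_cong: "part f g \<Longrightarrow> part f x \<longleftrightarrow> part g x"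
  using same_on_sym same_on_trans by blast

lemma good_cong:
  assumes "part f g"
  shows "good_P I P f = good_P I P g" "good_G I P f = good_G I P g" "good_C I P f = good_C I P g"
  unfolding good_P_def good_G_def good_C_def part_cong[OF assms] by blast+

text \<open>All facts of the repair in the cluster of \<open>f\<close> belong to the part of
  \<open>f\<close>. Once this part is removed, nothing remains that could conflict with
  \<open>Y\<close>.\<close>

lemma exchange_consistent:
  assumes J: "repair I F J" and f: "f \<in> J" and Y: "\<And>y. y \<in> Y \<Longrightarrow> clus f y" "\<And>y y'. y \<in> Y \<Longrightarrow> y' \<in> Y \<Longrightarrow> part y y'"
  shows "consistent F ((J - {x \<in> I. part f x}) \<union> Y)"
proof -
  have c: "\<not> clus y h" if "h \<in> J - {x \<in> I. part f x}" "y \<in> Y" for h y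
  proof
    assume "clus y h"
    then have "clus f h" using Y(1)[OF that(2)] same_on_trans by blast
    then have "part f h" "h \<in> I" using J f that(1) unfolding repair_iff by blast+
    then show False using that(1) by blast
  qed
  show ?thesis unfolding consistent_iff
  proof (intro ballI impI)
    fix g h assume gh: "g \<in> (J - {x \<in> I. part f x}) \<union> Y" "h \<in> (J - {x \<in> I. part f x}) \<union> Y" "clus g h"
    have "clus h g" using gh(3) by (rule same_on_sym)
    then consider "g \<in> J \<and> h \<in> J" | "g \<in> Y \<and> h \<in> Y" using c gh by blast
    then show "part g h"
    proof cases
      case 1
      then show ?thesis using J gh(3) unfolding repair_iff by blast
    qed (use Y in blast)
  qed
qed

text \<open>Each fact in the part of \<open>x0\<close> conflicts with \<open>y0\<close>. An
  improvement that brings in \<open>y0\<close> must therefore remove the whole part, which is why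
  optimality can be tested part by part.\<close>

lemma exchanged_part:
  assumes J: "repair I F J" and X: "X \<subseteq> J" and c: "consistent F ((J - X) \<union> Y)" and x: "x0 \<in> X" "y0 \<in> Y"
    and y0: "clus y0 x0" "\<not> part y0 x0" and "x \<in> I" "part x0 x"
  shows "x \<in> X" "clus y0 x"
proof -
  have xJ: "x \<in> J" using J X x(1) assms(8,9) unfolding repair_iff by blast
  show cl: "clus y0 x" using y0(1) part_clus[OF assms(9)] by (rule same_on_trans)
  have "\<not> part y0 x" using y0(2) same_on_trans same_on_sym[OF assms(9)] by blast
  then show "x \<in> X" using c cl xJ x(2) unfolding consistent_iff by blast
qed

lemma not_pareto_optimal:
  assumes "X \<noteq> {}" "X \<subseteq> J" "Y \<noteq> {}" "Y \<subseteq> I - J" "consistent F ((J - X) \<union> Y)" "\<forall>x\<in>X. \<forall>y\<in>Y. (y, x) \<in> P"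
  shows "\<not> pareto_optimal I F P J"
  unfolding pareto_optimal_def de_Morgan_conj not_not
  by (rule disjI2, rule exI[of _ X], rule exI[of _ Y], intro conjI assms)

lemma not_globally_optimal:
  assumes "X \<noteq> {}" "X \<subseteq> J" "Y \<noteq> {}" "Y \<subseteq> I - J" "consistent F ((J - X) \<union> Y)" "\<forall>x\<in>X. \<exists>y\<in>Y. (y, x) \<in> P"
  shows "\<not> globally_optimal I F P J"
  unfolding globally_optimal_def de_Morgan_conj not_not
  by (rule disjI2, rule exI[of _ X], rule exI[of _ Y], intro conjI assms)

lemma pareto_optimal_iff:
  assumes J: "repair I F J" and P: "priority I F P"
  shows "pareto_optimal I F P J \<longleftrightarrow> (\<forall>f\<in>J. good_P I P f)"
proof
  assume opt: "pareto_optimal I F P J"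
  show "\<forall>f\<in>J. good_P I P f"
  proof (rule ccontr)
    assume "\<not> (\<forall>f\<in>J. good_P I P f)"
    then obtain f y where f: "f \<in> J" and y: "y \<in> I" "\<forall>x\<in>I. part f x \<longrightarrow> (y, x) \<in> P"
      unfolding good_P_def by blast
    have fI: "f \<in> I" using J f unfolding repair_iff by blast
    have yf: "(y, f) \<in> P" using y(2) fI same_on_refl by blast
    note d = priorityD[OF P yf]
    have yJ: "y \<notin> J" using J d f unfolding repair_iff by blast
    let ?X = "{x \<in> I. part f x}"
    have "consistent F ((J - ?X) \<union> {y})"
      by (rule exchange_consistent[OF J f]) (use d same_on_sym same_on_refl in auto)
    moreover have "?X \<noteq> {}" using fI same_on_refl by blast
    moreover have "?X \<subseteq> J" using J f unfolding repair_iff by blast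
    moreover have "{y} \<subseteq> I - J" "{y} \<noteq> {}" "\<forall>x\<in>?X. \<forall>y'\<in>{y}. (y', x) \<in> P" using y yJ by auto
    ultimately show False using opt not_pareto_optimal[of ?X J "{y}" I P] by simp
  qed
next
  assume good: "\<forall>f\<in>J. good_P I P f"
  show "pareto_optimal I F P J"
    unfolding pareto_optimal_def
  proof (intro conjI notI)
    show "J \<subseteq> I" using J unfolding repair_iff by blast
    assume "\<exists>X Y. X \<noteq> {} \<and> X \<subseteq> J \<and> Y \<noteq> {} \<and> Y \<subseteq> I - J \<and> consistent F ((J - X) \<union> Y) \<and> (\<forall>x\<in>X. \<forall>y\<in>Y. (y, x) \<in> P)"
    then obtain X Y where XY: "X \<noteq> {}" "X \<subseteq> J" "Y \<noteq> {}" "Y \<subseteq> I - J" "consistent F ((J - X) \<union> Y)"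
      "\<forall>x\<in>X. \<forall>y\<in>Y. (y, x) \<in> P" by (elim exE conjE) (rule that)
    then obtain x0 y0 where xy: "x0 \<in> X" "y0 \<in> Y" by blast
    then have yx: "(y0, x0) \<in> P" using XY by blast
    have "(y0, x) \<in> P" if "x \<in> I" "part x0 x" for x
      using exchanged_part(1)[OF J XY(2,5) xy priorityD(3,4)[OF P yx] that] XY(6) xy by blast
    then have "\<not> good_P I P x0" unfolding good_P_def using XY xy by blast
    then show False using good XY xy by blast
  qed
qed

lemma globally_optimal_iff:
  assumes J: "repair I F J" and P: "priority I F P"
  shows "globally_optimal I F P J \<longleftrightarrow> (\<forall>f\<in>J. good_G I P f)"
proof
  assume opt: "globally_optimal I F P J"
  show "\<forall>f\<in>J. good_G I P f"
  proof (rule ccontr)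
    assume "\<not> (\<forall>f\<in>J. good_G I P f)"
    then obtain f z where f: "f \<in> J" and z: "z \<in> I" "\<forall>x\<in>I. part f x \<longrightarrow> (\<exists>y\<in>I. part z y \<and> (y, x) \<in> P)"
      unfolding good_G_def by blast
    have fI: "f \<in> I" using J f unfolding repair_iff by blast
    obtain y where y: "y \<in> I" "part z y" "(y, f) \<in> P" using z(2) fI same_on_refl by blast
    note d = priorityD[OF P y(3)]
    let ?X = "{x \<in> I. part f x}" and ?Y = "{y \<in> I. part z y}"
    have Y: "part y' y''" if "y' \<in> ?Y" "y'' \<in> ?Y" for y' y'' using that same_on_sym same_on_trans by blast
    have cY: "clus f y'" if "y' \<in> ?Y" for y'
    proof -
      have "clus y y'" using Y[of y y'] y that part_clus by blast
      then show ?thesis using same_on_sym[OF d(3)] same_on_trans by blast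
    qed
    have "y' \<notin> J" if "y' \<in> ?Y" for y'
    proof
      assume "y' \<in> J"
      then have "part f y'" using J f cY[OF that] unfolding repair_iff by blast
      then have "part y f" using Y[of y y'] y that same_on_sym same_on_trans by blast
      then show False using d(4) by blast
    qed
    then have "?Y \<subseteq> I - J" by blast
    moreover have "consistent F ((J - ?X) \<union> ?Y)"
      by (rule exchange_consistent[OF J f cY Y])
    moreover have "?X \<noteq> {}" "?Y \<noteq> {}" using fI y same_on_refl by blast+
    moreover have "?X \<subseteq> J" using J f unfolding repair_iff by blast
    moreover have "\<forall>x\<in>?X. \<exists>y\<in>?Y. (y, x) \<in> P" using z(2) by blast
    ultimately show False using opt not_globally_optimal[of ?X J ?Y I P] by simp
  qed
next
  assume good: "\<forall>f\<in>J. good_G I P f"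
  show "globally_optimal I F P J"
    unfolding globally_optimal_def
  proof (intro conjI notI)
    show "J \<subseteq> I" using J unfolding repair_iff by blast
    assume "\<exists>X Y. X \<noteq> {} \<and> X \<subseteq> J \<and> Y \<noteq> {} \<and> Y \<subseteq> I - J \<and> consistent F ((J - X) \<union> Y) \<and> (\<forall>x\<in>X. \<exists>y\<in>Y. (y, x) \<in> P)"
    then obtain X Y where XY: "X \<noteq> {}" "X \<subseteq> J" "Y \<noteq> {}" "Y \<subseteq> I - J" "consistent F ((J - X) \<union> Y)"
      "\<forall>x\<in>X. \<exists>y\<in>Y. (y, x) \<in> P" by (elim exE conjE) (rule that)
    then obtain x0 y0 where xy: "x0 \<in> X" "y0 \<in> Y" and yx: "(y0, x0) \<in> P" by blast
    have "\<exists>y\<in>I. part y0 y \<and> (y, x) \<in> P" if x: "x \<in> I" "part x0 x" for x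
    proof -
      note e = exchanged_part[OF J XY(2,5) xy priorityD(3,4)[OF P yx] x]
      obtain y where y: "y \<in> Y" "(y, x) \<in> P" using XY(6) e(1) by blast
      \<comment> \<open>\<open>y0\<close> and \<open>y\<close> are both in the cluster of
        \<open>x\<close>, and the new set is consistent, so all dominating facts come from the
        single part of \<open>y0\<close>.\<close>
      have "clus y0 y" using e(2) same_on_sym[OF priorityD(3)[OF P y(2)]] by (rule same_on_trans)
      then have "part y0 y" using XY(5) xy y unfolding consistent_iff by blast
      then show ?thesis using y XY(4) by blast
    qed
    then have "\<not> good_G I P x0" unfolding good_G_def using XY xy by blast
    then show False using good XY xy by blast
  qed
qed

text \<open>If neither direction is present, maximality means that adding either one would close a
  cycle. The two paths responsible for this join to a cycle of the priority itself.\<close>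

lemma total_priority_compares:
  fixes P :: "('r, 'd) prio"
  assumes t: "total_priority I F P" and n: "neighbors I F x y"
  shows "(x, y) \<in> P \<or> (y, x) \<in> P"
proof (rule ccontr)
  assume no: "\<not> ((x, y) \<in> P \<or> (y, x) \<in> P)"
  have P: "priority I F P" using t unfolding total_priority_def by blast
  have cyc: "(b, a) \<in> P\<^sup>*" if ab: "neighbors I F a b" "(a, b) \<notin> P" for a b
  proof (rule ccontr)
    assume "(b, a) \<notin> P\<^sup>*"
    then have "acyclic (insert (a, b) P)" using P unfolding priority_def by (simp add: acyclic_insert)
    then have "priority I F (insert (a, b) P)"
      using P ab(1) unfolding priority_def neighbors_def by auto
    then show False using t ab(2) unfolding total_priority_def by blast
  qed
  have n': "neighbors I F y x" using n same_on_sym unfolding neighbors_iff by blast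
  have "x \<noteq> y" using n same_on_refl unfolding neighbors_iff by blast
  then have "(y, x) \<in> P\<^sup>+" using cyc[OF n] no by (metis rtranclD)
  then have "(y, y) \<in> P\<^sup>+" using cyc[OF n'] no by (meson trancl_rtrancl_trancl)
  then show False using P unfolding priority_def acyclic_def by blast
qed

lemma total_priority_exists:
  assumes "finite I" "priority I F P"
  shows "\<exists>P'. total_priority I F P' \<and> P \<subseteq> P'"
proof -
  have "{P'. priority I F P'} \<subseteq> Pow (I \<times> I)" unfolding priority_def by blast
  then have "finite {P'. priority I F P'}" using assms(1) by (meson finite_Pow_iff finite_SigmaI finite_subset)
  then obtain P' where "priority I F P'" "P \<subseteq> P'" "\<forall>P''\<in>{P'. priority I F P'}. P' \<subseteq> P'' \<longrightarrow> P' = P''"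
    using finite_has_maximal2[of "{P'. priority I F P'}" P] assms(2) by blast
  then show ?thesis unfolding total_priority_def by blast
qed

text \<open>Forward: in the total priority some fact \<open>m\<close> of the cluster is undominated,
  hence beats all its neighbours. If \<open>m\<close> were outside the part of \<open>f\<close>, it
  would dominate that part alone, against global optimality; so \<open>m\<close> is in it. Backward:
  let every undominated fact of the repair beat all its neighbours. This creates no cycle, because
  nothing points to these facts, and in any total extension each part of the repair keeps an
  unbeaten member.\<close>

lemma completion_optimal_iff:
  assumes I: "finite I" and J: "repair I F J" and P: "priority I F P"
  shows "completion_optimal I F P J \<longleftrightarrow> (\<forall>f\<in>J. good_C I P f)"
proof
  assume "completion_optimal I F P J"
  then obtain P' where P': "total_priority I F P'" "P \<subseteq> P'" "globally_optimal I F P' J"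
    unfolding completion_optimal_def by blast
  have prio: "priority I F P'" using P'(1) unfolding total_priority_def by blast
  show "\<forall>f\<in>J. good_C I P f"
  proof
    fix f assume f: "f \<in> J"
    have fI: "f \<in> I" using J f unfolding repair_iff by blast
    have good: "good_G I P' f" using globally_optimal_iff[OF J prio] P'(3) f by blast
    have "finite P'" "acyclic P'" using prio I unfolding priority_def by (auto intro: finite_subset)
    then obtain m where m: "m \<in> I" "clus f m" "\<forall>y\<in>{g \<in> I. clus f g}. (y, m) \<notin> P'"
      using finite_acyclic_minimal[of P' "{g \<in> I. clus f g}"] fI same_on_refl by blast
    have no: "(y, m) \<notin> P'" for y
    proof
      assume ym: "(y, m) \<in> P'"
      then have "clus f y" using priorityD(3)[OF prio ym] m(2) same_on_sym same_on_trans by blast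
      then show False using m(3) ym priorityD(1)[OF prio ym] by blast
    qed
    have "part f m"
    proof (rule ccontr)
      assume np: "\<not> part f m"
      have "(m, x) \<in> P'" if x: "x \<in> I" "part f x" for x
      proof -
        have "clus m x" using m(2) part_clus[OF x(2)] same_on_sym same_on_trans by blast
        moreover have "\<not> part m x" using np x(2) same_on_sym same_on_trans by blast
        ultimately have "neighbors I F m x" unfolding neighbors_iff using m(1) x(1) by blast
        then show ?thesis using total_priority_compares[OF P'(1)] no by blast
      qed
      then show False using good m(1) same_on_refl unfolding good_G_def by blast
    qed
    then show "good_C I P f" unfolding good_C_def using m(1) no P'(2) by blast
  qed
next
  assume good: "\<forall>f\<in>J. good_C I P f"
  define M where "M = {m \<in> J. \<forall>y\<in>I. (y, m) \<notin> P}"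
  define P1 where "P1 = P \<union> {(m, z). m \<in> M \<and> neighbors I F m z}"
  have MJ: "m \<in> I \<and> m \<in> J" if "m \<in> M" for m using J that unfolding M_def repair_iff by blast
  have noM: "z \<notin> M" if xz: "(x, z) \<in> P1" for x z
  proof
    assume z: "z \<in> M"
    show False
    proof (cases "(x, z) \<in> P")
      case True
      then show False using z priorityD(1)[OF P True] unfolding M_def by blast
    next
      case False
      then have "x \<in> M" "neighbors I F x z" using xz unfolding P1_def by auto
      then show False using MJ z J unfolding neighbors_iff repair_iff by blast
    qed
  qed
  have old: "x \<notin> M \<Longrightarrow> (x, y) \<in> P" if "(x, y) \<in> P1" for x y
    using that unfolding P1_def by simp
  \<comment> \<open>No edge of \<open>P1\<close> enters \<open>M\<close>, and edges from outside
    \<open>M\<close> are old. A cycle would thus avoid \<open>M\<close> altogether and already be a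
    cycle of \<open>P\<close>.\<close>
  have path: "y \<notin> M \<and> (x \<notin> M \<longrightarrow> (x, y) \<in> P\<^sup>+)" if "(x, y) \<in> P1\<^sup>+" for x y
    using that
  proof (induction rule: trancl_induct)
    case (base y)
    then show ?case using noM[OF base] old[OF base] by (simp add: trancl.r_into_trancl)
  next
    case (step y z)
    have "(y, z) \<in> P" using old[OF step(2)] step(3) by blast
    then show ?case using step(3) noM[OF step(2)] trancl.trancl_into_trancl[of x y P z] by simp
  qed
  have "acyclic P1"
    unfolding acyclic_def using path P unfolding priority_def acyclic_def by blast
  moreover have "P1 \<subseteq> I \<times> I" "\<forall>(x, y)\<in>P1. neighbors I F x y"
    using P unfolding P1_def priority_def neighbors_def by auto
  ultimately have "priority I F P1" unfolding priority_def by blast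
  then obtain P' where P': "total_priority I F P'" "P1 \<subseteq> P'" using total_priority_exists[OF I] by blast
  have prio: "priority I F P'" using P'(1) unfolding total_priority_def by blast
  have "good_G I P' f" if f: "f \<in> J" for f
  proof -
    obtain m where m: "m \<in> I" "part f m" "\<forall>y\<in>I. (y, m) \<notin> P" using good f unfolding good_C_def by blast
    have mM: "m \<in> M" using m f J unfolding M_def repair_iff by blast
    have "(y, m) \<notin> P'" for y
    proof
      assume ym: "(y, m) \<in> P'"
      then have "neighbors I F m y" using priorityD[OF prio ym] same_on_sym unfolding neighbors_iff by blast
      then have "(m, y) \<in> P'" using mM P'(2) unfolding P1_def by blast
      then have "(m, m) \<in> P'\<^sup>+" using ym by (meson trancl.r_into_trancl trancl.trancl_into_trancl)
      then show False using prio unfolding priority_def acyclic_def by blast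
    qed
    then show ?thesis unfolding good_G_def using m by blast
  qed
  then have "globally_optimal I F P' J" using globally_optimal_iff[OF J prio] by blast
  then show "completion_optimal I F P J"
    unfolding completion_optimal_def using P' unfolding P1_def by blast
qed

section \<open>Traces of preferred repairs on the facts of the query\<close>

definition realizable :: "(('r, 'd) fact \<Rightarrow> bool) \<Rightarrow> ('r, 'd) fact set \<Rightarrow> ('r, 'd) fact set \<Rightarrow> ('r, 'd) fact set \<Rightarrow> bool" where
  "realizable good A I T \<longleftrightarrow> T \<subseteq> I \<and> (\<forall>f\<in>I. \<exists>g\<in>I. clus f g \<and> good g \<and>
     (\<forall>q\<in>A. q \<in> I \<longrightarrow> clus f q \<longrightarrow> (q \<in> T \<longleftrightarrow> part g q)))"

text \<open>In \<open>realizable\<close> the fact \<open>g\<close> stands for the part picked in the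
  cluster of \<open>f\<close>. Membership of a query fact in the repair depends only on the pick in
  its own cluster, so suitable picks made cluster by cluster fit together, and quantification over
  repairs becomes quantification over two facts.\<close>

lemma realizable_iff:
  assumes good: "\<And>f g. part f g \<Longrightarrow> good f = good g" and T: "T \<subseteq> A"
  shows "realizable good A I T \<longleftrightarrow> (\<exists>J. repair I F J \<and> (\<forall>f\<in>J. good f) \<and> J \<inter> A = T)"
proof
  assume r: "realizable good A I T"
  define C where "C f g \<longleftrightarrow> g \<in> I \<and> clus f g \<and> good g \<and> (\<forall>q\<in>A. q \<in> I \<longrightarrow> clus f q \<longrightarrow> (q \<in> T \<longleftrightarrow> part g q))" for f g
  \<comment> \<open>\<open>C f\<close> depends on \<open>f\<close> only through its cluster, so the
    choice made by \<open>SOME\<close> is the same for all facts of a cluster, as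
    \<open>cong\<close> shows.\<close>
  define sel where "sel f = (SOME g. C f g)" for f
  have sel: "C f (sel f)" if "f \<in> I" for f
    unfolding sel_def by (rule someI_ex) (use r that in \<open>auto simp: realizable_def C_def\<close>)
  have cong: "sel f = sel g" if "clus f g" for f g
  proof -
    have "clus f x \<longleftrightarrow> clus g x" for x using that same_on_sym same_on_trans by blast
    then have "C f = C g" unfolding C_def by (intro ext) simp
    then show ?thesis unfolding sel_def by simp
  qed
  define J where "J = {x \<in> I. part (sel x) x}"
  have "repair I F J" unfolding repair_iff
  proof (intro conjI ballI impI)
    show "J \<subseteq> I" unfolding J_def by blast
    show "part f g" if "f \<in> J" "g \<in> J" "clus f g" for f g
    proof -
      have "part (sel f) f" "part (sel f) g" using that cong[OF that(3)] unfolding J_def by auto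
      then show ?thesis using same_on_sym same_on_trans by blast
    qed
    show "\<exists>g\<in>J. clus f g" if "f \<in> I" for f
    proof -
      have s: "sel f \<in> I" "clus f (sel f)" using sel[OF that] unfolding C_def by blast+
      have "sel (sel f) = sel f" using cong[OF s(2)] by simp
      then have "sel f \<in> J" unfolding J_def using s(1) same_on_refl by simp
      then show ?thesis using s(2) by blast
    qed
    show "g \<in> J" if "f \<in> J" "g \<in> I" "part f g" for f g
    proof -
      have "part (sel f) f" "sel f = sel g" using that cong[OF part_clus[OF that(3)]] unfolding J_def by auto
      then have "part (sel g) g" using that(3) same_on_trans by metis
      then show ?thesis unfolding J_def using that(2) by blast
    qed
  qed
  moreover have "good f" if "f \<in> J" for f
  proof -
    have "good (sel f)" "part (sel f) f" using that sel unfolding J_def C_def by auto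
    then show ?thesis using good by blast
  qed
  moreover have "J \<inter> A = T"
  proof -
    have "q \<in> T \<longleftrightarrow> q \<in> J" if q: "q \<in> A" "q \<in> I" for q
    proof -
      have "q \<in> T \<longleftrightarrow> part (sel q) q" using sel[OF q(2)] q same_on_refl unfolding C_def by blast
      then show ?thesis unfolding J_def using q(2) by simp
    qed
    moreover have "T \<subseteq> I" "J \<subseteq> I" using r unfolding realizable_def J_def by blast+
    ultimately show ?thesis using T by blast
  qed
  ultimately show "\<exists>J. repair I F J \<and> (\<forall>f\<in>J. good f) \<and> J \<inter> A = T" by blast
next
  assume "\<exists>J. repair I F J \<and> (\<forall>f\<in>J. good f) \<and> J \<inter> A = T"
  then obtain J where J: "repair I F J" "\<forall>f\<in>J. good f" "J \<inter> A = T" by blast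
  have JI: "J \<subseteq> I" using J(1) unfolding repair_iff by blast
  show "realizable good A I T"
    unfolding realizable_def
  proof (intro conjI ballI)
    show "T \<subseteq> I" using J(3) JI by blast
    fix f assume "f \<in> I"
    then obtain g where g: "g \<in> J" "clus f g" using J(1) unfolding repair_iff by blast
    have "q \<in> T \<longleftrightarrow> part g q" if q: "q \<in> A" "q \<in> I" "clus f q" for q
    proof -
      have "clus g q" using g(2) q(3) same_on_sym same_on_trans by blast
      then have "q \<in> J \<longleftrightarrow> part g q" using J(1) g(1) q(2) unfolding repair_iff by blast
      then show ?thesis using J(3) q(1) by blast
    qed
    then show "\<exists>g\<in>I. clus f g \<and> good g \<and> (\<forall>q\<in>A. q \<in> I \<longrightarrow> clus f q \<longrightarrow> (q \<in> T \<longleftrightarrow> part g q))"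
      using g J(2) JI by blast
  qed
qed

lemma all_repairs_satisfy_iff:
  assumes good: "\<And>f g. part f g \<Longrightarrow> good f = good g"
    and X: "\<And>J. J \<in> X \<longleftrightarrow> repair I F J \<and> (\<forall>f\<in>J. good f)"
  shows "(\<forall>J\<in>X. J \<Turnstile> Q) \<longleftrightarrow>
    (\<forall>T\<in>{T \<in> Pow (query_facts Q). \<not> T \<Turnstile> Q}. \<not> realizable good (query_facts Q) I T)"
proof -
  let ?A = "query_facts Q"
  have sat: "J \<inter> ?A \<Turnstile> Q \<longleftrightarrow> J \<Turnstile> Q" for J by (rule satisfies_Int) simp
  show ?thesis
  proof
    assume all: "\<forall>J\<in>X. J \<Turnstile> Q"
    show "\<forall>T\<in>{T \<in> Pow ?A. \<not> T \<Turnstile> Q}. \<not> realizable good ?A I T"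
    proof (intro ballI notI)
      fix T assume T: "T \<in> {T \<in> Pow ?A. \<not> T \<Turnstile> Q}" and r: "realizable good ?A I T"
      have TA: "T \<subseteq> ?A" using T by blast
      obtain J where J: "repair I F J" "\<forall>f\<in>J. good f" "J \<inter> ?A = T"
        using r realizable_iff[where good = good and I = I, OF good TA] by auto
      then have "J \<Turnstile> Q" using all X by blast
      then show False using sat[of J] J(3) T by simp
    qed
  next
    assume none: "\<forall>T\<in>{T \<in> Pow ?A. \<not> T \<Turnstile> Q}. \<not> realizable good ?A I T"
    show "\<forall>J\<in>X. J \<Turnstile> Q"
    proof (intro ballI, rule ccontr)
      fix J assume J: "J \<in> X" "\<not> J \<Turnstile> Q"
      then have r: "repair I F J" "\<forall>f\<in>J. good f" using X by blast+
      have "realizable good ?A I (J \<inter> ?A)"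
        using realizable_iff[where good = good and I = I, OF good, of "J \<inter> ?A" ?A] r by auto
      moreover have "\<not> J \<inter> ?A \<Turnstile> Q" using J(2) sat by simp
      ultimately show False using none by blast
    qed
  qed
qed

lemma PRep_iff: "priority I F P \<Longrightarrow> J \<in> PRep I F P \<longleftrightarrow> repair I F J \<and> (\<forall>f\<in>J. good_P I P f)"
  using pareto_optimal_iff unfolding PRep_def by blast

lemma GRep_iff: "priority I F P \<Longrightarrow> J \<in> GRep I F P \<longleftrightarrow> repair I F J \<and> (\<forall>f\<in>J. good_G I P f)"
  using globally_optimal_iff unfolding GRep_def by blast

lemma CRep_iff: "finite I \<Longrightarrow> priority I F P \<Longrightarrow> J \<in> CRep I F P \<longleftrightarrow> repair I F J \<and> (\<forall>f\<in>J. good_C I P f)"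
  using completion_optimal_iff unfolding CRep_def by blast

end

section \<open>Formulas over facts\<close>

context coded_input
begin

definition seg :: "sym list \<Rightarrow> (nat \<Rightarrow> nat) \<Rightarrow> nat \<Rightarrow> sym list" where
  "seg u e i = slice u (e (2 * i)) (e (2 * i + 1))"

text \<open>Formulas over facts: variable \<open>i\<close> is represented by the end points \<open>e (2 * i)\<close> and
  \<open>e (2 * i + 1)\<close> of an encoded fact; only the variables below \<open>n\<close> are in scope.\<close>

definition fdefinable ::
  "nat \<Rightarrow> (('r, 'd) fact set \<Rightarrow> ('r, 'd) prio \<Rightarrow> (nat \<Rightarrow> ('r, 'd) fact) \<Rightarrow> bool) \<Rightarrow> bool" where
  "fdefinable n R \<longleftrightarrow> (\<exists>Q. definable U Q \<and> (\<forall>u\<in>U. \<forall>D e. (\<forall>i. e i < length u) \<longrightarrow> input u \<in> inputs \<longrightarrow>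
     (\<forall>i<n. seg u e i \<in> fact_words) \<longrightarrow>
     Q u D e = R (Inst (input u)) (Prio (input u)) (\<lambda>i. dec (seg u e i))))"

lemma fdefinableI:
  assumes "definable U Q"
    and "\<And>u D e. u \<in> U \<Longrightarrow> \<forall>i. e i < length u \<Longrightarrow> input u \<in> inputs \<Longrightarrow> \<forall>i<n. seg u e i \<in> fact_words \<Longrightarrow>
      Q u D e = R (Inst (input u)) (Prio (input u)) (\<lambda>i. dec (seg u e i))"
  shows "fdefinable n R"
  unfolding fdefinable_def by (rule exI[of _ Q], intro conjI assms(1), intro ballI allI impI, rule assms(2))

lemma fdefinableE:
  assumes "fdefinable n R"
  obtains Q where "definable U Q"
    "\<And>u D e. u \<in> U \<Longrightarrow> \<forall>i. e i < length u \<Longrightarrow> input u \<in> inputs \<Longrightarrow> \<forall>i<n. seg u e i \<in> fact_words \<Longrightarrow>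
      Q u D e = R (Inst (input u)) (Prio (input u)) (\<lambda>i. dec (seg u e i))"
  using assms unfolding fdefinable_def by (elim exE conjE) (rule that, assumption, blast)

lemma fdefinable_not: "fdefinable n R \<Longrightarrow> fdefinable n (\<lambda>I P x. \<not> R I P x)"
  by (elim fdefinableE, rule fdefinableI, erule definable_not) simp

lemma fdefinable_conj:
  assumes "fdefinable n R" "fdefinable n R'" shows "fdefinable n (\<lambda>I P x. R I P x \<and> R' I P x)"
proof -
  obtain Q where Q: "definable U Q" "\<And>u D e. u \<in> U \<Longrightarrow> \<forall>i. e i < length u \<Longrightarrow> input u \<in> inputs \<Longrightarrow>
      \<forall>i<n. seg u e i \<in> fact_words \<Longrightarrow> Q u D e = R (Inst (input u)) (Prio (input u)) (\<lambda>i. dec (seg u e i))"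
    using assms(1) unfolding fdefinable_def by (elim exE conjE) (rule that, assumption, blast)
  obtain Q' where Q': "definable U Q'" "\<And>u D e. u \<in> U \<Longrightarrow> \<forall>i. e i < length u \<Longrightarrow> input u \<in> inputs \<Longrightarrow>
      \<forall>i<n. seg u e i \<in> fact_words \<Longrightarrow> Q' u D e = R' (Inst (input u)) (Prio (input u)) (\<lambda>i. dec (seg u e i))"
    using assms(2) unfolding fdefinable_def by (elim exE conjE) (rule that, assumption, blast)
  show ?thesis
    by (rule fdefinableI[OF definable_conj[OF Q(1) Q'(1)]]) (simp add: Q(2) Q'(2))
qed

lemma fdefinable_disj:
  assumes "fdefinable n R" "fdefinable n R'" shows "fdefinable n (\<lambda>I P x. R I P x \<or> R' I P x)"
  using fdefinable_not[OF fdefinable_conj[OF fdefinable_not[OF assms(1)] fdefinable_not[OF assms(2)]]] by simp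

lemma fdefinable_imp:
  assumes "fdefinable n R" "fdefinable n R'" shows "fdefinable n (\<lambda>I P x. R I P x \<longrightarrow> R' I P x)"
  unfolding imp_conv_disj by (intro fdefinable_disj fdefinable_not assms)

lemma fdefinable_const: "fdefinable n (\<lambda>I P x. b)"
  by (rule fdefinableI[OF definable_const]) simp

lemma fdefinable_iff_const:
  assumes "fdefinable n R" shows "fdefinable n (\<lambda>I P x. b \<longleftrightarrow> R I P x)"
  using assms fdefinable_not[OF assms] by (cases b) simp_all

lemma fdefinable_Ball:
  assumes "finite A" "\<And>a. a \<in> A \<Longrightarrow> fdefinable n (\<lambda>I P x. R I P x a)"
  shows "fdefinable n (\<lambda>I P x. \<forall>a\<in>A. R I P x a)"
  using assms
proof (induction A rule: finite_induct)
  case (insert b A)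
  then have "fdefinable n (\<lambda>I P x. R I P x b \<and> (\<forall>a\<in>A. R I P x a))"
    by (intro fdefinable_conj) auto
  then show ?case by simp
qed (simp add: fdefinable_const)

lemma seg_shift:
  "seg u (case_nat x (case_nat y e)) 0 = slice u x y"
  "seg u (case_nat x (case_nat y e)) (Suc i) = seg u e i"
  by (simp_all add: seg_def)

lemma definable_two:
  assumes "definable U A" "definable U Q"
  shows "definable U (\<lambda>u D e. \<exists>y<length u. \<exists>x<length u. A u D (case_nat x (case_nat y e)) \<and> Q u D (case_nat x (case_nat y e)))"
proof (rule definable_ex, rule definable_ex, rule definable_conj)
  have e: "case_nat (e 0) (case_nat (e (Suc 0)) (\<lambda>i. e (Suc (Suc i)))) = e" for e :: "nat \<Rightarrow> nat"
    by (rule ext) (simp split: nat.split)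
  show "definable U (\<lambda>u D e. A u D (case_nat (e 0) (case_nat (e (Suc 0)) (\<lambda>i. e (Suc (Suc i))))))"
    unfolding e by (rule assms(1))
  show "definable U (\<lambda>u D e. Q u D (case_nat (e 0) (case_nat (e (Suc 0)) (\<lambda>i. e (Suc (Suc i))))))"
    unfolding e by (rule assms(2))
qed

text \<open>Quantifying over the instance means choosing two positions that delimit an encoded fact
  in the list of facts. Repetitions and different codes of one fact are harmless, since
  \<open>R\<close> sees only the decoded fact.\<close>

lemma fdefinable_ex:
  fixes R :: "('r, 'd) fact set \<Rightarrow> ('r, 'd) prio \<Rightarrow> (nat \<Rightarrow> ('r, 'd) fact) \<Rightarrow> ('r, 'd) fact \<Rightarrow> bool"
  assumes "fdefinable (Suc n) (\<lambda>I P x. R I P (\<lambda>i. x (Suc i)) (x 0))"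
  shows "fdefinable n (\<lambda>I P x. \<exists>f\<in>I. R I P x f)"
proof -
  obtain Q where Q: "definable U Q" "\<And>u D e. u \<in> U \<Longrightarrow> \<forall>i. e i < length u \<Longrightarrow> input u \<in> inputs \<Longrightarrow>
      \<forall>i<Suc n. seg u e i \<in> fact_words \<Longrightarrow>
      Q u D e = R (Inst (input u)) (Prio (input u)) (\<lambda>i. dec (seg u e (Suc i))) (dec (seg u e 0))"
    using assms unfolding fdefinable_def by (elim exE conjE) (rule that, assumption, blast)
  show ?thesis
  proof (rule fdefinableI)
    show "definable U (\<lambda>u D e. \<exists>y<length u. \<exists>x<length u.
       is_fact_at u (case_nat x (case_nat y e) 0) (case_nat x (case_nat y e) 1) \<and> Q u D (case_nat x (case_nat y e)))"
      by (rule definable_two[OF definable_is_fact_at Q(1)])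
    fix u D and e :: "nat \<Rightarrow> nat"
    assume u: "u \<in> U" "\<forall>i. e i < length u" "input u \<in> inputs" "\<forall>i<n. seg u e i \<in> fact_words"
    let ?R = "R (Inst (input u)) (Prio (input u)) (\<lambda>i. dec (seg u e i))"
    have "Q u D (case_nat x (case_nat y e)) = ?R (dec (slice u x y))"
      if "x < length u" "y < length u" "is_fact_at u x y" for x y
    proof -
      let ?e = "case_nat x (case_nat y e)"
      have "slice u x y \<in> fact_words" using that(3) unfolding is_fact_at_def by blast
      then have "\<forall>i<Suc n. seg u ?e i \<in> fact_words" using u(4) by (auto simp: less_Suc_eq_0_disj seg_shift)
      moreover have "\<forall>i. ?e i < length u" using u(2) that by (simp split: nat.split)
      ultimately show ?thesis using Q(2)[of u ?e D] u(1,3) by (simp add: seg_shift)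
    qed
    then have "(\<exists>y<length u. \<exists>x<length u. is_fact_at u x y \<and> Q u D (case_nat x (case_nat y e))) \<longleftrightarrow>
       (\<exists>x<length u. \<exists>y<length u. is_fact_at u x y \<and> ?R (dec (slice u x y)))" by blast
    also have "\<dots> \<longleftrightarrow> (\<exists>s\<in>facts_of (input u). ?R (dec s))"
    proof
      assume "\<exists>x<length u. \<exists>y<length u. is_fact_at u x y \<and> ?R (dec (slice u x y))"
      then obtain x y where xy: "x < length u" "y < length u" "is_fact_at u x y" "?R (dec (slice u x y))"
        by (elim exE conjE) (rule that)
      then have "slice u x y \<in> facts_of (input u)" unfolding facts_of_input[OF u(1)] by blast
      with xy(4) show "\<exists>s\<in>facts_of (input u). ?R (dec s)" by (rule bexI)
    next
      assume "\<exists>s\<in>facts_of (input u). ?R (dec s)"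
      then obtain s where s: "s \<in> facts_of (input u)" "?R (dec s)" by (elim bexE) (rule that)
      then obtain x y where "x < length u" "y < length u" "is_fact_at u x y" "s = slice u x y"
        unfolding facts_of_input[OF u(1)] by (elim exE conjE) (rule that)
      with s(2) show "\<exists>x<length u. \<exists>y<length u. is_fact_at u x y \<and> ?R (dec (slice u x y))" by blast
    qed
    finally show "(\<exists>y<length u. \<exists>x<length u.
       is_fact_at u (case_nat x (case_nat y e) 0) (case_nat x (case_nat y e) 1) \<and> Q u D (case_nat x (case_nat y e))) =
       (\<exists>f\<in>Inst (input u). ?R f)"
      by (simp add: Inst_def)
  qed
qed

lemma fdefinable_all:
  fixes R :: "('r, 'd) fact set \<Rightarrow> ('r, 'd) prio \<Rightarrow> (nat \<Rightarrow> ('r, 'd) fact) \<Rightarrow> ('r, 'd) fact \<Rightarrow> bool"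
  assumes "fdefinable (Suc n) (\<lambda>I P x. R I P (\<lambda>i. x (Suc i)) (x 0))"
  shows "fdefinable n (\<lambda>I P x. \<forall>f\<in>I. R I P x f)"
  using fdefinable_not[OF fdefinable_ex[where R = "\<lambda>I P x f. \<not> R I P x f", OF fdefinable_not[OF assms]]] by simp

text \<open>A fixed fact is treated as a variable bound to a slice equal to its code; the prefix
  guarantees that such a slice exists even if the fact is absent from the input.\<close>

lemma fdefinable_fact:
  fixes R :: "('r, 'd) fact set \<Rightarrow> ('r, 'd) prio \<Rightarrow> (nat \<Rightarrow> ('r, 'd) fact) \<Rightarrow> ('r, 'd) fact \<Rightarrow> bool"
  assumes "fdefinable (Suc n) (\<lambda>I P x. R I P (\<lambda>i. x (Suc i)) (x 0))"
    and s: "s \<in> fact_words" "pre = a @ s @ b"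
  shows "fdefinable n (\<lambda>I P x. R I P x (dec s))"
proof -
  obtain Q where Q: "definable U Q" "\<And>u D e. u \<in> U \<Longrightarrow> \<forall>i. e i < length u \<Longrightarrow> input u \<in> inputs \<Longrightarrow>
      \<forall>i<Suc n. seg u e i \<in> fact_words \<Longrightarrow>
      Q u D e = R (Inst (input u)) (Prio (input u)) (\<lambda>i. dec (seg u e (Suc i))) (dec (seg u e 0))"
    using assms(1) unfolding fdefinable_def by (elim exE conjE) (rule that, assumption, blast)
  show ?thesis
  proof (rule fdefinableI)
    show "definable U (\<lambda>u D e. \<exists>y<length u. \<exists>x<length u.
       slice u (case_nat x (case_nat y e) 0) (case_nat x (case_nat y e) 1) \<in> {s} \<and> Q u D (case_nat x (case_nat y e)))"
      by (rule definable_two[OF segdefD[OF segdef_word] Q(1)])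
    fix u D and e :: "nat \<Rightarrow> nat"
    assume u: "u \<in> U" "\<forall>i. e i < length u" "input u \<in> inputs" "\<forall>i<n. seg u e i \<in> fact_words"
    let ?R = "R (Inst (input u)) (Prio (input u)) (\<lambda>i. dec (seg u e i))"
    have *: "Q u D (case_nat x (case_nat y e)) = ?R (dec s)"
      if "x < length u" "y < length u" "slice u x y = s" for x y
    proof -
      let ?e = "case_nat x (case_nat y e)"
      have "\<forall>i<Suc n. seg u ?e i \<in> fact_words" using u(4) s that(3) by (auto simp: less_Suc_eq_0_disj seg_shift)
      moreover have "\<forall>i. ?e i < length u" using u(2) that by (simp split: nat.split)
      ultimately show ?thesis using Q(2)[of u ?e D] u(1,3) that(3) by (simp add: seg_shift)
    qed
    have "u = a @ s @ (b @ input u @ [Minus])" using U_cases[OF u(1)] s(2) by simp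
    then obtain x y where xy: "x < length u" "y < length u" "s = slice u x y"
      using infix_slice[of u a s "b @ input u @ [Minus]"] by blast
    show "(\<exists>y<length u. \<exists>x<length u.
       slice u (case_nat x (case_nat y e) 0) (case_nat x (case_nat y e) 1) \<in> {s} \<and> Q u D (case_nat x (case_nat y e))) =
       ?R (dec s)"
      using * xy by auto
  qed
qed

lemma fdefinable_rel:
  assumes R: "word_rel R W" and ij: "i < n" "j < n"
  shows "fdefinable n (\<lambda>I P x. R (x i) (x j))"
proof (rule fdefinableI)
  show "definable U (\<lambda>u D e. W (seg u e i) (seg u e j))"
    unfolding seg_def by (rule word_rel_definable[OF R])
qed (use word_rel_iff[OF R] ij in auto)

lemma fdefinable_prio:
  assumes ij: "i < n" "j < n"
  shows "fdefinable n (\<lambda>I P x. (x i, x j) \<in> P)"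
proof (rule fdefinableI)
  show "definable U (\<lambda>u D e. pair_rel (input u) (seg u e i) (seg u e j))"
    unfolding seg_def by (rule definable_pair_rel)
qed (use ij in \<open>simp add: pair_rel_iff\<close>)

lemma fdefinable_acyclic: "fdefinable n (\<lambda>I P x. acyclic P)"
proof -
  obtain Q where "definable U Q" "\<forall>u\<in>U. \<forall>D e. input u \<in> inputs \<longrightarrow> Q u D e = acyclic (Prio (input u))"
    using definable_acyclic by (elim exE conjE) (rule that)
  then show ?thesis by (intro fdefinableI[where Q = Q]) auto
qed

lemma no_pair: "(\<not> (\<exists>(s, t)\<in>A. \<not> X s t)) \<longleftrightarrow> (\<forall>(s, t)\<in>A. X s t)"
  by auto

lemma image_pairs: "(\<forall>(f, g)\<in>(\<lambda>(s, t). (h s, h t)) ` A. Y f g) \<longleftrightarrow> (\<forall>(s, t)\<in>A. Y (h s) (h t))"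
  by auto

lemma fdefinable_edges:
  assumes R: "word_rel R W" "word_rel R' W'"
  shows "fdefinable n (\<lambda>I P x. \<forall>(f, g)\<in>P. f \<in> I \<and> g \<in> I \<and> R f g \<and> \<not> R' f g)"
proof (rule fdefinableI)
  show "definable U (\<lambda>u D e. \<not> pair_at (input u)
      (\<lambda>s t. \<not> (fact_at (input u) s \<and> fact_at (input u) t \<and> W s t \<and> \<not> W' s t)))"
    by (rule definable_not, rule definable_pair_at[where
          R = "\<lambda>u e s t. \<not> (fact_at (input u) s \<and> fact_at (input u) t \<and> W s t \<and> \<not> W' s t)"])
      (intro definable_not definable_conj definable_fact_at word_rel_definable[OF R(1)] word_rel_definable[OF R(2)])
  fix u :: "sym list" and e :: "nat \<Rightarrow> nat"
  let ?w = "input u"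
  have "fact_at ?w s \<and> fact_at ?w t \<and> W s t \<and> \<not> W' s t \<longleftrightarrow>
     dec s \<in> Inst ?w \<and> dec t \<in> Inst ?w \<and> R (dec s) (dec t) \<and> \<not> R' (dec s) (dec t)" if "(s, t) \<in> pairs_of ?w" for s t
  proof -
    have "s \<in> fact_words" "t \<in> fact_words" using that unfolding pairs_of_def by blast+
    then show ?thesis using fact_at_iff word_rel_iff[OF R(1)] word_rel_iff[OF R(2)] by simp
  qed
  then have "(\<forall>(s, t)\<in>pairs_of ?w. fact_at ?w s \<and> fact_at ?w t \<and> W s t \<and> \<not> W' s t) \<longleftrightarrow>
     (\<forall>(s, t)\<in>pairs_of ?w. dec s \<in> Inst ?w \<and> dec t \<in> Inst ?w \<and> R (dec s) (dec t) \<and> \<not> R' (dec s) (dec t))"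
    by (intro ball_cong) auto
  then show "(\<not> pair_at ?w (\<lambda>s t. \<not> (fact_at ?w s \<and> fact_at ?w t \<and> W s t \<and> \<not> W' s t))) =
      (\<forall>(f, g)\<in>Prio ?w. f \<in> Inst ?w \<and> g \<in> Inst ?w \<and> R f g \<and> \<not> R' f g)"
    unfolding pair_at_iff Prio_def no_pair image_pairs .
qed

definition clus_word :: "sym list \<Rightarrow> sym list \<Rightarrow> bool" where "clus_word = same_on_word lhs_of"
definition part_word :: "sym list \<Rightarrow> sym list \<Rightarrow> bool" where "part_word = same_on_word attrs_of"

lemma word_rel_clus: "word_rel clus clus_word"
  unfolding clus_word_def
  by (rule word_rel_same_on) (use wf_F in \<open>fastforce simp: wf_fd_def lhs_of_def\<close>)

lemma word_rel_part: "word_rel part part_word"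
  unfolding part_word_def
  by (rule word_rel_same_on) (use wf_F in \<open>fastforce simp: wf_fd_def attrs_of_def\<close>)

lemmas fdefinable_intros = fdefinable_not fdefinable_conj fdefinable_disj fdefinable_imp
  fdefinable_ex fdefinable_all fdefinable_prio
  fdefinable_rel[OF word_rel_clus] fdefinable_rel[OF word_rel_part] fdefinable_rel[OF word_rel_eq]

lemma priority_alt:
  "priority I F P \<longleftrightarrow> acyclic P \<and> (\<forall>(f, g)\<in>P. f \<in> I \<and> g \<in> I \<and> clus f g \<and> \<not> part f g)"
  unfolding priority_def neighbors_iff by auto

lemma fdefinable_priority: "fdefinable n (\<lambda>I P x. priority I F P)"
  unfolding priority_alt
  by (intro fdefinable_conj fdefinable_acyclic fdefinable_edges[OF word_rel_clus word_rel_part])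

lemma fdefinable_good:
  assumes "i < n"
  shows "fdefinable n (\<lambda>I P x. good_P I P (x i))" "fdefinable n (\<lambda>I P x. good_G I P (x i))"
    "fdefinable n (\<lambda>I P x. good_C I P (x i))"
  unfolding good_P_def good_G_def good_C_def by (intro fdefinable_intros; use assms in simp)+

lemma fdefinable_in: "i < n \<Longrightarrow> fdefinable n (\<lambda>I P x. x i \<in> I)"
proof -
  assume i: "i < n"
  have "fdefinable n (\<lambda>I P x. \<exists>f\<in>I. x i = f)" by (intro fdefinable_intros) (use i in simp_all)
  then show ?thesis by simp
qed

definition infix_word :: "('r, 'd) fact \<Rightarrow> bool" where
  "infix_word q \<longleftrightarrow> (\<exists>a s b. pre = a @ s @ b \<and> s \<in> fact_words \<and> dec s = q)"

lemma fdefinable_fact':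
  fixes R :: "('r, 'd) fact set \<Rightarrow> ('r, 'd) prio \<Rightarrow> (nat \<Rightarrow> ('r, 'd) fact) \<Rightarrow> ('r, 'd) fact \<Rightarrow> bool"
  assumes "infix_word q" "fdefinable (Suc n) (\<lambda>I P x. R I P (\<lambda>i. x (Suc i)) (x 0))"
  shows "fdefinable n (\<lambda>I P x. R I P x q)"
proof -
  obtain a s b where "pre = a @ s @ b" "s \<in> fact_words" "dec s = q" using assms(1) unfolding infix_word_def by blast
  then show ?thesis using fdefinable_fact[OF assms(2), of s a b] by simp
qed

lemma fdefinable_realizable:
  assumes good: "\<And>n i. i < n \<Longrightarrow> fdefinable n (\<lambda>I P x. good I P (x i))"
    and A: "finite A" "\<And>q. q \<in> A \<Longrightarrow> infix_word q" and T: "T \<subseteq> A"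
  shows "fdefinable n (\<lambda>I P x. realizable (good I P) A I T)"
proof -
  have 1: "fdefinable n (\<lambda>I P x. q \<in> I)" if "q \<in> A" for q n
    by (rule fdefinable_fact'[OF A(2)[OF that]], rule fdefinable_in) simp
  have 2: "fdefinable n (\<lambda>I P x. R (x i) q)" if "q \<in> A" "word_rel R W" "i < n" for q n R W i
    by (rule fdefinable_fact'[OF A(2)[OF that(1)], where R = "\<lambda>I P x q. R (x i) q"], rule fdefinable_rel[OF that(2)])
      (use that(3) in simp_all)
  have 3: "fdefinable n (\<lambda>I P x. \<forall>q\<in>T. q \<in> I)"
    by (rule fdefinable_Ball) (use T A 1 in \<open>auto intro: finite_subset\<close>)
  have 4: "fdefinable n (\<lambda>I P x. \<forall>f\<in>I. \<exists>g\<in>I. clus f g \<and> good I P g \<and>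
     (\<forall>q\<in>A. q \<in> I \<longrightarrow> clus f q \<longrightarrow> ((q \<in> T) \<longleftrightarrow> part g q)))"
    by (intro fdefinable_all fdefinable_ex fdefinable_conj fdefinable_rel[OF word_rel_clus] good fdefinable_Ball A(1)
        fdefinable_imp fdefinable_iff_const 1 2[OF _ word_rel_clus] 2[OF _ word_rel_part]) simp_all
  show ?thesis
    using fdefinable_conj[OF 3 4] unfolding realizable_def subset_iff Ball_def by simp
qed

lemma language_PTIME:
  assumes X: "\<And>I P J. finite I \<Longrightarrow> priority I F P \<Longrightarrow> J \<in> X I F P \<longleftrightarrow> repair I F J \<and> (\<forall>f\<in>J. good I P f)"
    and cong: "\<And>I P f g. part f g \<Longrightarrow> good I P f = good I P g"
    and good: "\<And>n i. i < n \<Longrightarrow> fdefinable n (\<lambda>I P x. good I P (x i))"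
    and A: "\<And>q. q \<in> query_facts Q \<Longrightarrow> infix_word q" and pre: "pre \<noteq> []"
  shows "language_of rn cn (preferred_consistent_answers S F Q X) \<in> PTIME"
proof -
  let ?A = "query_facts Q"
  have "finite (Pow ?A)" using finite_query_facts by simp
  then have "fdefinable 0 (\<lambda>I P x. priority I F P \<and>
     (\<forall>T\<in>{T \<in> Pow ?A. \<not> T \<Turnstile> Q}. \<not> realizable (good I P) ?A I T))"
    by (intro fdefinable_conj fdefinable_priority fdefinable_Ball fdefinable_not fdefinable_realizable good A finite_query_facts)
      auto
  then obtain R where R: "definable U R" "\<And>u D e. u \<in> U \<Longrightarrow> \<forall>i. e i < length u \<Longrightarrow> input u \<in> inputs \<Longrightarrow>
      \<forall>i<0. seg u e i \<in> fact_words \<Longrightarrow> R u D e = (priority (Inst (input u)) F (Prio (input u)) \<and>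
        (\<forall>T\<in>{T \<in> Pow ?A. \<not> T \<Turnstile> Q}. \<not> realizable (good (Inst (input u)) (Prio (input u))) ?A (Inst (input u)) T))"
    unfolding fdefinable_def by (elim exE conjE) (rule that, assumption, blast)
  have "definable U (\<lambda>u D e. input u \<in> inputs \<and> R u D e)"
  proof (rule definable_conj[OF _ R(1)])
    show "definable U (\<lambda>u D e. input u \<in> inputs)"
      by (rule definable_input[where P = "\<lambda>u D e w. w \<in> inputs"], rule segdefD, rule segdef_inputs)
  qed
  then obtain f where f: "\<And>u D e. u \<in> U \<Longrightarrow> \<forall>i. e i < length u \<Longrightarrow> eval u D e f = (input u \<in> inputs \<and> R u D e)"
    unfolding definable_def by (elim exE) (rule that, blast)
  have "w \<in> language_of rn cn (preferred_consistent_answers S F Q X) \<longleftrightarrow>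
      eval (pre @ w @ [Minus]) (\<lambda>_ _. False) (\<lambda>_. 0) f" for w
  proof -
    let ?u = "pre @ w @ [Minus]"
    have u: "?u \<in> U" "input ?u = w" using input_simp unfolding U_def by auto
    have e: "eval ?u (\<lambda>_ _. False) (\<lambda>_. 0) f = (w \<in> inputs \<and> R ?u (\<lambda>_ _. False) (\<lambda>_. 0))"
      using f[OF u(1), of "\<lambda>_. 0"] u(2) by simp
    have "(\<forall>J\<in>X (Inst w) F (Prio w). J \<Turnstile> Q) \<longleftrightarrow>
      (\<forall>T\<in>{T \<in> Pow ?A. \<not> T \<Turnstile> Q}. \<not> realizable (good (Inst w) (Prio w)) ?A (Inst w) T)"
      if "w \<in> inputs" "priority (Inst w) F (Prio w)"
    proof (rule all_repairs_satisfy_iff)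
      show "J \<in> X (Inst w) F (Prio w) \<longleftrightarrow> repair (Inst w) F J \<and> (\<forall>f\<in>J. good (Inst w) (Prio w) f)" for J
        by (rule X) (use that db_instance_Inst in \<open>auto simp: db_instance_def\<close>)
    qed (rule cong)
    then show ?thesis unfolding language_iff e using R(2)[OF u(1), of "\<lambda>_. 0" "\<lambda>_ _. False"] u(2) by auto
  qed
  then have "language_of rn cn (preferred_consistent_answers S F Q X) = {w. eval (pre @ w @ [Minus]) (\<lambda>_ _. False) (\<lambda>_. 0) f}"
    by blast
  then show ?thesis using sentence_PTIME[OF pre, of Minus f] by simp
qed

end

section \<open>Codes for the facts of the query\<close>

lemma encodes_rat_exists: "\<exists>w. encodes_rat w q"
proof -
  have bits: "\<exists>bs. bits_val bs = n" for n
  proof (induction n rule: less_induct)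
    case (less n)
    show ?case
    proof (cases "n = 0")
      case True
      then show ?thesis by (intro exI[of _ "[]"]) (simp add: bits_val_def)
    next
      case False
      then obtain bs where "bits_val bs = n div 2" using less[of "n div 2"] by auto
      then show ?thesis by (intro exI[of _ "odd n # bs"]) (simp add: bits_val_def)
    qed
  qed
  obtain a b where ab: "quotient_of q = (a, b)" by force
  have b: "b > 0" using quotient_of_denom_pos[OF ab] .
  obtain n d where nd: "bits_val n = nat \<bar>a\<bar>" "bits_val d = nat b" using bits by metis
  have "q = of_int a / of_int b" using quotient_of_div[OF ab] .
  also have "\<dots> = (if a < 0 then -1 else 1) * (of_nat (bits_val n) / of_nat (bits_val d))"
    using b by (simp add: nd)
  finally have "encodes_rat ((if a < 0 then [Minus] else []) @ map Bit n @ [Slash] @ map Bit d) q"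
    unfolding encodes_rat_def using nd b by (intro exI[of _ "a < 0"] exI[of _ n] exI[of _ d]) auto
  then show ?thesis by blast
qed

lemma encodes_fact_exists:
  fixes rn :: "'r \<Rightarrow> bool list"
  shows "\<exists>w. encodes_fact rn cn w f"
proof -
  obtain r cs where f: "f = Fact r cs" by (cases f)
  have "\<exists>w. encodes_const cn w c" for c
    using encodes_rat_exists by (cases c) auto
  then obtain g where "\<And>c. encodes_const cn (g c) c" by metis
  then have "encodes_list (encodes_const cn) (concat (map g cs)) cs"
    unfolding encodes_list_def by (intro exI[of _ "map g cs"]) (simp add: list_all2_conv_all_nth)
  then show ?thesis unfolding f by auto
qed


theorem theorem5:
  fixes S :: "'r schema" and F :: "'r fd set" and Q :: "('r, 'd) query"
    and rn :: "'r \<Rightarrow> bool list" and cn :: "'d \<Rightarrow> bool list"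
  assumes "wf_schema S"
    and "\<forall>d\<in>F. wf_fd S d"
    and "inj_on fd_rel F"
    and "wf_query S Q"
    and "inj_on rn (dom S)"
    and "bij cn"
  shows "language_of rn cn (preferred_consistent_answers S F Q PRep) \<in> PTIME \<and>
         language_of rn cn (preferred_consistent_answers S F Q GRep) \<in> PTIME \<and>
         language_of rn cn (preferred_consistent_answers S F Q CRep) \<in> PTIME"
proof -
  obtain code_of where code_of: "\<And>f :: ('r, 'd) fact. encodes_fact rn cn (code_of f) f"
    using encodes_fact_exists[of rn cn] by metis
  obtain qs where qs: "set qs = query_facts Q" using finite_list[OF finite_query_facts] by blast
  \<comment> \<open>The leading \<open>Minus\<close> keeps the prefix nonempty also for a query that
    mentions no facts.\<close>
  define pre where "pre = Minus # concat (map code_of qs)"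
  interpret coded_input S F rn cn pre
    by unfold_locales (use assms in auto)
  have A: "infix_word q" if q: "q \<in> query_facts Q" for q
  proof -
    have wf: "wf_fact S q" using wf_query_facts[OF assms(4) q] .
    obtain xs ys where "qs = xs @ q # ys" using q qs split_list by metis
    then have "pre = (Minus # concat (map code_of xs)) @ code_of q @ concat (map code_of ys)"
      unfolding pre_def by simp
    moreover have "code_of q \<in> fact_words" using fact_words_iff wf code_of by blast
    moreover have "dec (code_of q) = q" using dec_eq[OF wf code_of] .
    ultimately show ?thesis unfolding infix_word_def by blast
  qed
  have pre: "pre \<noteq> []" by (simp add: pre_def)
  note PTIME = language_PTIME[OF _ _ _ A pre]
  show ?thesis
  proof (intro conjI)
    show "language_of rn cn (preferred_consistent_answers S F Q PRep) \<in> PTIME"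
      by (rule PTIME[where good = good_P]) (rule PRep_iff good_cong fdefinable_good; assumption)+
    show "language_of rn cn (preferred_consistent_answers S F Q GRep) \<in> PTIME"
      by (rule PTIME[where good = good_G]) (rule GRep_iff good_cong fdefinable_good; assumption)+
    show "language_of rn cn (preferred_consistent_answers S F Q CRep) \<in> PTIME"
      by (rule PTIME[where good = good_C]) (rule CRep_iff good_cong fdefinable_good; assumption)+
  qed
qed

end
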